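(* Let $n,k\in\mathbb{N}$ with $n\ge2$ and $k\ge3$ (the space dimension being $d=1$), let $1\le i\le l$, put $\widetilde\Omega_i=D\times[0,t_i]$ with $D=[a,b]$, and suppose that the solution $u$ of the Burgers' problem satisfies $u\in H^k(\widetilde\Omega_i)$. Then for every integer $N>5$ there exists an HLConcPINN $u_{\theta_i}$ (together with HLConcPINNs $u_{\theta_1},\dots,u_{\theta_{i-1}}$ for the earlier time blocks, which enter the definition of $R_{tb_i}$) such that $$\|R_{int_i}\|_{L^2(\widetilde\Omega_i)}\lesssim N^{-k+2}\ln^2N,$$ and, for $1\le j\le i$, $$\|R_{tb_i}(\cdot,t_{j-1})\|_{L^2(D)},\ \|R_{sb1_i}\|_{L^2(\{a\}\times[0,t_i])},\ \|R_{sb2_i}\|_{L^2(\{b\}\times[0,t_i])}\ \lesssim\ N^{-k+1}\ln N .$$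
   Context: Burgers' problem. $D=[a,b]\subset\mathbb{R}$, $T>0$, $\nu>0$ is the constant viscosity, and $u:D\times[0,T]\to\mathbb{R}$ solves $\partial_t u-\nu\partial_x^2u+u\,\partial_xu=f$ in $D\times[0,T]$, $u(x,0)=u_{in}(x)$ for $x\in D$, $u(a,t)=g_1(t)$, $u(b,t)=g_2(t)$, for given data $f,u_{in},g_1,g_2$. Time blocks. For an integer $l\ge1$ put $\Delta t=T/l$ and $t_i=i\Delta t$, $0\le i\le l$. HLConcPINN (hidden-layer concatenated neural network). With $L\ge 3$, input dimension $l_0$, output dimension $l_L$ and hidden widths $l_1,\dots,l_{L-1}$, it is a map $z\in\mathbb{R}^{l_0}\mapsto\sum_{m=1}^{L-1}M_m h_m(z)+b_L$, where $h_0(z)=z$ and $h_m(z)=\sigma_m(W_m h_{m-1}(z)+b_m)$, with $W_m\in\mathbb{R}^{l_m\times l_{m-1}}$, $b_m\in\mathbb{R}^{l_m}$, $M_m\in\mathbb{R}^{l_L\times l_m}$, $b_L\in\mathbb{R}^{l_L}$; activations act componentwise, $\sigma_1=\sigma_2=\tanh$, and $\sigma_m$ for $m\ge3$ are smooth activation functions. $\theta$ denotes the collection of all parameters. Here $l_0=2$ (input $(x,t)$), $l_L=1$, and $u_{\theta_i}$ is considered on $D\times[0,t_i]$. Residuals. $R_{int_i}=\partial_tu_{\theta_i}-\nu\partial_x^2u_{\theta_i}+u_{\theta_i}\partial_xu_{\theta_i}-f$; $R_{tb_i}(x,t_{j-1})=u_{\theta_i}(x,t_{j-1})-u_{\theta_{j-1}}(x,t_{j-1})$,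 $1\le j\le i$, with the convention $u_{\theta_0}(x,t_0)=u_{in}(x)$; $R_{sb1_i}(a,t)=u_{\theta_i}(a,t)-g_1(t)$; $R_{sb2_i}(b,t)=u_{\theta_i}(b,t)-g_2(t)$. $a\lesssim b$ between nonnegative quantities means $a\le Cb$ with a constant $C$ independent of $N$. *)

theory Defs
  imports "HOL-Analysis.Analysis"
begin

section \<open>Smooth functions and iterated partial derivatives\<close>

definition partial_deriv :: "'a::euclidean_space \<Rightarrow> ('a \<Rightarrow> real) \<Rightarrow> 'a \<Rightarrow> real" where
  "partial_deriv e g z = frechet_derivative g (at z) e"

primrec C_k :: "nat \<Rightarrow> ('a::euclidean_space \<Rightarrow> real) \<Rightarrow> bool" where
  "C_k 0 g \<longleftrightarrow> continuous_on UNIV g"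
| "C_k (Suc k) g \<longleftrightarrow> (\<forall>z. g differentiable (at z)) \<and> (\<forall>e\<in>Basis. C_k k (partial_deriv e g))"

definition smooth :: "('a::euclidean_space \<Rightarrow> real) \<Rightarrow> bool" where
  "smooth g \<longleftrightarrow> (\<forall>k. C_k k g)"

text \<open>Points of the space-time plane are pairs \<open>(x, t)\<close>.\<close>

abbreviation d_x :: "(real \<times> real \<Rightarrow> real) \<Rightarrow> real \<times> real \<Rightarrow> real" where
  "d_x \<equiv> partial_deriv (1, 0)"

abbreviation d_t :: "(real \<times> real \<Rightarrow> real) \<Rightarrow> real \<times> real \<Rightarrow> real" where
  "d_t \<equiv> partial_deriv (0, 1)"

section \<open>Weak derivatives and the spaces \<open>L\<^sup>2\<close> and \<open>H\<^sup>k\<close>\<close>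

definition in_L2 :: "'a::euclidean_space set \<Rightarrow> ('a \<Rightarrow> real) \<Rightarrow> bool" where
  "in_L2 S g \<longleftrightarrow> set_borel_measurable lebesgue S g \<and> set_integrable lebesgue S (\<lambda>z. (g z)\<^sup>2)"

text \<open>Meaningful only together with \<^term>\<open>in_L2 S g\<close>, since the integral of a non-integrable
  function is \<open>0\<close>.\<close>

definition L2_norm :: "'a::euclidean_space set \<Rightarrow> ('a \<Rightarrow> real) \<Rightarrow> real" where
  "L2_norm S g = sqrt (LINT z:S|lebesgue. (g z)\<^sup>2)"

definition locally_integrable :: "'a::euclidean_space set \<Rightarrow> ('a \<Rightarrow> real) \<Rightarrow> bool" where
  "locally_integrable U g \<longleftrightarrow> (\<forall>K. compact K \<and> K \<subseteq> U \<longrightarrow> set_integrable lebesgue K g)"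

definition test_function :: "'a::euclidean_space set \<Rightarrow> ('a \<Rightarrow> real) \<Rightarrow> bool" where
  "test_function U \<phi> \<longleftrightarrow>
     smooth \<phi> \<and> compact (closure {z. \<phi> z \<noteq> 0}) \<and> closure {z. \<phi> z \<noteq> 0} \<subseteq> U"

text \<open>\<open>v\<close> is the weak derivative of order \<open>p\<close> in \<open>x\<close> and \<open>q\<close> in \<open>t\<close> of \<open>g\<close> on the open set \<open>U\<close>.\<close>

definition weak_deriv ::
  "(real \<times> real) set \<Rightarrow> nat \<Rightarrow> nat \<Rightarrow> (real \<times> real \<Rightarrow> real) \<Rightarrow> (real \<times> real \<Rightarrow> real) \<Rightarrow> bool" where
  "weak_deriv U p q g v \<longleftrightarrow>
     locally_integrable U g \<and> locally_integrable U v \<and>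
     (\<forall>\<phi>. test_function U \<phi> \<longrightarrow>
        (LINT z:U|lebesgue. g z * (d_x ^^ p) ((d_t ^^ q) \<phi>) z)
          = (- 1) ^ (p + q) * (LINT z:U|lebesgue. v z * \<phi> z))"

text \<open>\<open>H\<^sup>k\<close> of a set with negligible boundary, such as a closed rectangle, is \<open>H\<^sup>k\<close> of its interior.\<close>

definition sobolev_H :: "nat \<Rightarrow> (real \<times> real) set \<Rightarrow> (real \<times> real \<Rightarrow> real) \<Rightarrow> bool" where
  "sobolev_H k S g \<longleftrightarrow>
     in_L2 (interior S) g \<and>
     (\<forall>p q. p + q \<le> k \<longrightarrow> (\<exists>v. weak_deriv (interior S) p q g v \<and> in_L2 (interior S) v))"

section \<open>Burgers' problem\<close>

text \<open>The equation holds almost everywhere, for weak derivatives, because an \<open>H\<^sup>3\<close> function of two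
  variables need not have a classical \<open>\<partial>\<^sub>x\<^sup>2\<close>.  The initial and boundary values are taken
  pointwise, so they carry information only for a solution that is continuous up to the
  boundary.  Continuity is not imposed here: a user of this predicate should require it on
  the time interval of interest.\<close>

definition burgers_solution ::
  "real \<Rightarrow> real \<Rightarrow> real \<Rightarrow> real \<Rightarrow> (real \<times> real \<Rightarrow> real) \<Rightarrow> (real \<Rightarrow> real) \<Rightarrow> (real \<Rightarrow> real)
     \<Rightarrow> (real \<Rightarrow> real) \<Rightarrow> (real \<times> real \<Rightarrow> real) \<Rightarrow> bool" where
  "burgers_solution a b T \<nu> f u_in g1 g2 u \<longleftrightarrow>
     (let U = {a<..<b} \<times> {0<..<T} in
       \<exists>ut ux uxx. weak_deriv U 0 1 u ut \<and> weak_deriv U 1 0 u ux \<and> weak_deriv U 2 0 u uxx \<and>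
         (AE z in lebesgue. z \<in> U \<longrightarrow> ut z - \<nu> * uxx z + u z * ux z = f z)) \<and>
     (\<forall>x\<in>{a..b}. u (x, 0) = u_in x) \<and>
     (\<forall>t\<in>{0..T}. u (a, t) = g1 t \<and> u (b, t) = g2 t)"

definition block_time :: "real \<Rightarrow> nat \<Rightarrow> nat \<Rightarrow> real" where
  "block_time T l i = real i * (T / real l)"

section \<open>Hidden-layer concatenated networks\<close>

text \<open>Vectors and matrices are functions of natural-number indices starting at \<open>0\<close>; \<open>w m\<close> is the
  width of layer \<open>m\<close>, and only the entries with indices below the widths matter.\<close>

record hlconc_param =
  hl_W :: "nat \<Rightarrow> nat \<Rightarrow> nat \<Rightarrow> real"
  hl_b :: "nat \<Rightarrow> nat \<Rightarrow> real"
  hl_M :: "nat \<Rightarrow> nat \<Rightarrow> nat \<Rightarrow> real"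
  hl_bout :: "nat \<Rightarrow> real"

primrec hlconc_layer ::
  "(nat \<Rightarrow> real \<Rightarrow> real) \<Rightarrow> (nat \<Rightarrow> nat) \<Rightarrow> hlconc_param \<Rightarrow> (nat \<Rightarrow> real) \<Rightarrow> nat \<Rightarrow> nat \<Rightarrow> real" where
  "hlconc_layer \<sigma> w \<theta> z 0 = z"
| "hlconc_layer \<sigma> w \<theta> z (Suc m) =
     (\<lambda>r. \<sigma> (Suc m) ((\<Sum>c<w m. hl_W \<theta> (Suc m) r c * hlconc_layer \<sigma> w \<theta> z m c) + hl_b \<theta> (Suc m) r))"

definition hlconc_net ::
  "nat \<Rightarrow> (nat \<Rightarrow> real \<Rightarrow> real) \<Rightarrow> (nat \<Rightarrow> nat) \<Rightarrow> hlconc_param \<Rightarrow> (nat \<Rightarrow> real) \<Rightarrow> nat \<Rightarrow> real" where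
  "hlconc_net L \<sigma> w \<theta> z r =
     (\<Sum>m=1..L - 1. \<Sum>c<w m. hl_M \<theta> m r c * hlconc_layer \<sigma> w \<theta> z m c) + hl_bout \<theta> r"

definition hlconc_activations :: "nat \<Rightarrow> (nat \<Rightarrow> real \<Rightarrow> real) \<Rightarrow> bool" where
  "hlconc_activations L \<sigma> \<longleftrightarrow> \<sigma> 1 = tanh \<and> \<sigma> 2 = tanh \<and> (\<forall>m\<in>{3..<L}. smooth (\<sigma> m))"

definition is_hlconc_pinn :: "nat \<Rightarrow> (nat \<Rightarrow> real \<Rightarrow> real) \<Rightarrow> (real \<times> real \<Rightarrow> real) \<Rightarrow> bool" where
  "is_hlconc_pinn L \<sigma> v \<longleftrightarrow>
     3 \<le> L \<and> hlconc_activations L \<sigma> \<and>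
     (\<exists>w \<theta>. w 0 = 2 \<and> w L = 1 \<and> (\<forall>m\<in>{1..<L}. 1 \<le> w m) \<and>
        (\<forall>x t. v (x, t) = hlconc_net L \<sigma> w \<theta> (\<lambda>c. if c = 0 then x else t) 0))"

section \<open>Residuals\<close>

definition R_int ::
  "real \<Rightarrow> (real \<times> real \<Rightarrow> real) \<Rightarrow> (real \<times> real \<Rightarrow> real) \<Rightarrow> real \<times> real \<Rightarrow> real" where
  "R_int \<nu> f v z = d_t v z - \<nu> * d_x (d_x v) z + v z * d_x v z - f z"

text \<open>\<open>u\<theta> i\<close> is the network of block \<open>i\<close>; the argument \<open>j\<close> refers to the time \<open>t\<^bsub>j - 1\<^esub>\<close>, and
  \<open>u\<theta> 0\<close> is never used.\<close>

definition R_tb ::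
  "real \<Rightarrow> nat \<Rightarrow> (real \<Rightarrow> real) \<Rightarrow> (nat \<Rightarrow> real \<times> real \<Rightarrow> real) \<Rightarrow> nat \<Rightarrow> nat \<Rightarrow> real \<Rightarrow> real" where
  "R_tb T l u_in u\<theta> i j x =
     u\<theta> i (x, block_time T l (j - 1))
       - (if j = 1 then u_in x else u\<theta> (j - 1) (x, block_time T l (j - 1)))"

definition R_sb :: "real \<Rightarrow> (real \<Rightarrow> real) \<Rightarrow> (real \<times> real \<Rightarrow> real) \<Rightarrow> real \<Rightarrow> real" where
  "R_sb c g v t = v (c, t) - g t"

end

theory Submission
  imports Defs
begin

text \<open>
  The size of the networks is not tied to \<open>N\<close>, so the rates follow from a density statement: a solution
  with the assumed regularity can be approximated by networks so well that the
  interior residual in \<open>L\<^sup>2\<close> and the other residuals in the supremum norm become as small as desired.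
  One and the same network then serves for all time blocks, and the residuals between
  two blocks vanish.

  It suffices to approximate \<open>u\<close> uniformly on the closed rectangle and, simultaneously, the weak
  derivatives \<open>u\<^sub>t\<close>, \<open>u\<^sub>x\<close>, \<open>u\<^sub>x\<^sub>x\<close> in \<open>L\<^sup>2\<close>; the residual is then estimated by means of the equation,
  because weak derivatives are unique (\<open>weak_deriv_unique\<close>).  The approximation has two stages.

  First \<open>u\<close> is multiplied by a smooth cutoff, convolved with a kernel, and evaluated at the image
  of the point under a slight contraction of the rectangle towards its centre.  The
  kernel is the normalised power of a combination of the functions \<open>e\<^sup>p\<^sup>x\<^sup>+\<^sup>q\<^sup>t\<close> with its unique maximum at the
  origin (\<open>landau_kernel_exists\<close>), hence the result is a finite sum of exponentials.  Derivatives pass from the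
  kernel to \<open>u\<close> by the definition of weak derivatives; the terms with a derivative of the cutoff
  disappear in the limit, as the cutoff is constant near the contracted rectangle
  (\<open>mollify_far\<close>).  Convergence is uniform for continuous functions (\<open>mollify_uniform\<close>) and carries over to \<open>L\<^sup>2\<close> by
  density and Young's inequality (\<open>mollify_L2\<close>).  This gives \<open>exp_sum_approximation\<close>.

  Secondly, \<open>e\<^sup>s\<close> is the limit, with two derivatives and locally uniformly, of \<open>e\<^sup>s / (1 + \<rho> e\<^sup>s)\<close> as \<open>\<rho>\<close>
  tends to \<open>0\<close>, and that function is a rescaled \<open>tanh\<close> (\<open>logi_close\<close>, \<open>logi_eq_tanh\<close>).  So sums
  of exponentials are limits of networks that use only the first hidden layer.
\<close>

section \<open>Calculus of smooth functions\<close>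

lemma partial_derivI:
  assumes "(g has_derivative g') (at z)"
  shows "partial_deriv e g z = g' e"
  using frechet_derivative_at[OF assms] by (simp add: partial_deriv_def)

lemma partial_deriv_const [simp]: "partial_deriv e (\<lambda>z. c) = (\<lambda>z. 0)"
  by (simp add: partial_deriv_def fun_eq_iff)

lemma partial_deriv_add:
  assumes "f differentiable (at z)" "g differentiable (at z)"
  shows "partial_deriv e (\<lambda>z. f z + g z) z = partial_deriv e f z + partial_deriv e g z"
  unfolding partial_deriv_def
  using has_derivative_add[OF assms[unfolded frechet_derivative_works]]
  by (simp flip: frechet_derivative_at)

lemma partial_deriv_mult:
  assumes "f differentiable (at z)" "g differentiable (at z)"
  shows "partial_deriv e (\<lambda>z. f z * g z) z = partial_deriv e f z * g z + f z * partial_deriv e g z"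
  unfolding partial_deriv_def
  using has_derivative_mult[OF assms[unfolded frechet_derivative_works]]
  by (simp flip: frechet_derivative_at)

lemma partial_deriv_compose:
  fixes h :: "real \<Rightarrow> real"
  assumes "h differentiable (at (g z))" "g differentiable (at z)"
  shows "partial_deriv e (\<lambda>z. h (g z)) z = partial_deriv 1 h (g z) * partial_deriv e g z"
proof -
  have "linear (frechet_derivative h (at (g z)))"
    using assms(1) by (rule linear_frechet_derivative)
  then have "frechet_derivative h (at (g z)) r = r * frechet_derivative h (at (g z)) 1" for r
    by (metis linear_scale mult.right_neutral real_scaleR_def)
  moreover have "frechet_derivative (\<lambda>z. h (g z)) (at z) e
      = frechet_derivative h (at (g z)) (frechet_derivative g (at z) e)"
    using frechet_derivative_compose[OF assms(2,1)] by (simp add: o_def)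
  ultimately show ?thesis by (metis mult.commute partial_deriv_def)
qed

lemma partial_deriv_eq_0_if_const_on_open:
  assumes "open S" "z \<in> S" "\<And>y. y \<in> S \<Longrightarrow> g y = c"
  shows "partial_deriv e g z = 0"
proof -
  have "((\<lambda>y. c) has_derivative (\<lambda>h. 0)) (at z)" by simp
  then have "(g has_derivative (\<lambda>h. 0)) (at z)"
    by (rule has_derivative_transform_within_open[OF _ assms(1,2)]) (simp add: assms(3))
  then show ?thesis by (simp add: partial_derivI)
qed

lemma C_k_Suc_imp: "C_k (Suc k) g \<Longrightarrow> C_k k g"
proof (induction k arbitrary: g)
  case 0
  then show ?case
    by (simp add: continuous_at_imp_continuous_on differentiable_imp_continuous_within)
next
  case (Suc k)
  then show ?case by (metis C_k.simps(2))
qed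

lemma C_k_const: "C_k k (\<lambda>z. c)"
  by (induction k arbitrary: c) auto

lemma C_k_add: "C_k k f \<Longrightarrow> C_k k g \<Longrightarrow> C_k k (\<lambda>z. f z + g z)"
proof (induction k arbitrary: f g)
  case 0
  then show ?case by (simp add: continuous_on_add)
next
  case (Suc k)
  have "partial_deriv e (\<lambda>z. f z + g z) = (\<lambda>z. partial_deriv e f z + partial_deriv e g z)" for e
    using Suc.prems by (auto simp: partial_deriv_add)
  then show ?case using Suc by (auto intro: derivative_intros)
qed

lemma C_k_mult: "C_k k f \<Longrightarrow> C_k k g \<Longrightarrow> C_k k (\<lambda>z. f z * g z)"
proof (induction k arbitrary: f g)
  case 0
  then show ?case by (simp add: continuous_on_mult)
next
  case (Suc k)
  have "partial_deriv e (\<lambda>z. f z * g z) = (\<lambda>z. partial_deriv e f z * g z + f z * partial_deriv e g z)" for e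
    using Suc.prems by (auto simp: partial_deriv_mult)
  moreover have "C_k k f" "C_k k g" using Suc.prems by (auto dest: C_k_Suc_imp simp del: C_k.simps)
  ultimately show ?case using Suc by (auto intro: derivative_intros C_k_add)
qed

lemma C_k_compose:
  fixes h :: "real \<Rightarrow> real"
  shows "C_k k h \<Longrightarrow> C_k k g \<Longrightarrow> C_k k (\<lambda>z. h (g z))"
proof (induction k arbitrary: h)
  case 0
  then show ?case by (auto intro: continuous_on_compose2)
next
  case (Suc k)
  have "partial_deriv e (\<lambda>z. h (g z)) = (\<lambda>z. partial_deriv 1 h (g z) * partial_deriv e g z)" for e
    using Suc.prems by (auto simp: partial_deriv_compose)
  moreover have "C_k k g" using Suc.prems(2) by (rule C_k_Suc_imp)
  moreover have "(\<lambda>z. h (g z)) differentiable at z" for z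
    using Suc.prems differentiable_chain_at[of g z h] by (simp add: o_def)
  ultimately show ?case using Suc by (auto intro!: C_k_mult)
qed

lemma smooth_const: "smooth (\<lambda>z. c)"
  and smooth_add: "smooth f \<Longrightarrow> smooth g \<Longrightarrow> smooth (\<lambda>z. f z + g z)"
  and smooth_mult: "smooth f \<Longrightarrow> smooth g \<Longrightarrow> smooth (\<lambda>z. f z * g z)"
  by (simp_all add: smooth_def C_k_const C_k_add C_k_mult)

lemma smooth_compose:
  fixes h :: "real \<Rightarrow> real"
  shows "smooth h \<Longrightarrow> smooth g \<Longrightarrow> smooth (\<lambda>z. h (g z))"
  by (simp add: smooth_def C_k_compose)

lemma smooth_partial_deriv: "smooth g \<Longrightarrow> e \<in> Basis \<Longrightarrow> smooth (partial_deriv e g)"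
  unfolding smooth_def by (metis C_k.simps(2))

lemma smooth_differentiable: "smooth g \<Longrightarrow> g differentiable (at z)"
  unfolding smooth_def by (metis C_k.simps(2))

lemma smooth_continuous_on: "smooth g \<Longrightarrow> continuous_on S g"
  unfolding smooth_def by (metis C_k.simps(1) continuous_on_subset subset_UNIV)

lemma smooth_linear:
  assumes "bounded_linear g"
  shows "smooth (g :: 'a::euclidean_space \<Rightarrow> real)"
proof -
  have d: "(g has_derivative g) (at z)" for z
    using assms by (rule bounded_linear_imp_has_derivative)
  have "C_k k g" for k
  proof (cases k)
    case 0
    then show ?thesis by (simp add: assms linear_continuous_on)
  next
    case (Suc j)
    have "partial_deriv e g = (\<lambda>z. g e)" for e
      by (rule ext) (rule partial_derivI[OF d])
    then show ?thesis using Suc d by (auto simp: C_k_const differentiable_def)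
  qed
  then show ?thesis by (simp add: smooth_def)
qed

lemma partial_deriv_1_real:
  assumes "(g has_real_derivative D) (at x)"
  shows "partial_deriv 1 g x = D"
  using partial_derivI[OF assms[unfolded has_field_derivative_def]] by simp

lemma smooth_exp: "smooth (exp :: real \<Rightarrow> real)"
proof -
  have d: "partial_deriv 1 (exp :: real \<Rightarrow> real) = exp"
    by (rule ext) (rule partial_deriv_1_real, rule DERIV_exp)
  have "C_k k (exp :: real \<Rightarrow> real)" for k
    by (induction k)
       (auto simp: d continuous_on_exp intro: field_differentiable_imp_differentiable
          field_differentiable_within_exp)
  then show ?thesis by (simp add: smooth_def)
qed

section \<open>Smooth cutoff functions\<close>

text \<open>The functions \<open>x\<^sup>-\<^sup>m exp (-1/x)\<close>, extended by zero to \<open>x \<le> 0\<close>.  The derivative of each is a linear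
  combination of two others, so all of them are smooth.\<close>

definition flat_exp :: "nat \<Rightarrow> real \<Rightarrow> real" where
  "flat_exp m x = (if 0 < x then (1/x)^m * exp (- (1/x)) else 0)"

lemma flat_exp_tendsto: "(flat_exp m \<longlongrightarrow> 0) (at 0)"
proof -
  have "((\<lambda>x::real. x ^ m / exp x) \<longlongrightarrow> 0) at_top" by (rule tendsto_power_div_exp_0)
  then have "((\<lambda>x::real. (inverse x) ^ m / exp (inverse x)) \<longlongrightarrow> 0) (at_right 0)"
    by (rule filterlim_compose) (rule filterlim_inverse_at_top_right)
  then have "(flat_exp m \<longlongrightarrow> 0) (at_right 0)"
    by (rule Lim_transform_eventually)
       (auto simp: flat_exp_def eventually_at_filter exp_minus field_simps)
  moreover have "(flat_exp m \<longlongrightarrow> 0) (at_left 0)"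
    by (rule Lim_transform_eventually[OF tendsto_const])
       (auto simp: flat_exp_def eventually_at_filter)
  ultimately show ?thesis by (simp add: filterlim_at_split)
qed

lemma flat_exp_deriv:
  "(flat_exp m has_real_derivative (- real m * flat_exp (Suc m) x + flat_exp (Suc (Suc m)) x)) (at x)"
proof -
  consider "x < 0" | "x = 0" | "0 < x" by linarith
  then show ?thesis
  proof cases
    case 1
    have "((\<lambda>x. 0) has_real_derivative (- real m * flat_exp (Suc m) x + flat_exp (Suc (Suc m)) x)) (at x)"
      using 1 by (simp add: flat_exp_def)
    then show ?thesis
      by (rule DERIV_cong_ev[THEN iffD1, OF refl _ refl, rotated])
         (use 1 in \<open>auto simp: flat_exp_def eventually_nhds intro!: exI[of _ "{..<0}"]\<close>)
  next
    case 2
    have "((\<lambda>y. (flat_exp m (0 + y) - flat_exp m 0) / y) \<longlongrightarrow> 0) (at 0)"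
      by (rule Lim_transform_eventually[OF flat_exp_tendsto[of "Suc m"]])
         (auto simp: flat_exp_def eventually_at_filter)
    then show ?thesis using 2 by (simp add: DERIV_def flat_exp_def)
  next
    case 3
    have "((\<lambda>x. (1/x)^m * exp (- (1/x))) has_real_derivative
        (- real m * flat_exp (Suc m) x + flat_exp (Suc (Suc m)) x)) (at x)"
    proof -
      have "((\<lambda>x. 1/x) has_real_derivative - ((1/x)^2)) (at x)"
        using 3 by (auto intro!: derivative_eq_intros simp: power2_eq_square)
      from DERIV_mult[OF DERIV_power[OF this, of m] DERIV_fun_exp[OF DERIV_minus[OF this]]]
      show ?thesis
        by (rule DERIV_cong) (use 3 in \<open>cases m; simp add: flat_exp_def power2_eq_square field_simps\<close>)
    qed
    then show ?thesis
      by (rule DERIV_cong_ev[THEN iffD1, OF refl _ refl, rotated])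
         (use 3 in \<open>auto simp: flat_exp_def eventually_nhds intro!: exI[of _ "{0<..}"]\<close>)
  qed
qed

lemma smooth_flat_exp: "smooth (flat_exp m)"
proof -
  have "C_k k (flat_exp m)" for k
  proof (induction k arbitrary: m)
    case 0
    show ?case
      by (auto intro!: continuous_at_imp_continuous_on DERIV_isCont[OF flat_exp_deriv])
  next
    case (Suc k)
    have "partial_deriv 1 (flat_exp m) = (\<lambda>x. - real m * flat_exp (Suc m) x + flat_exp (Suc (Suc m)) x)"
      by (rule ext) (rule partial_deriv_1_real, rule flat_exp_deriv)
    moreover have "flat_exp m differentiable at x" for x
      using flat_exp_deriv field_differentiable_def field_differentiable_imp_differentiable by blast
    moreover have "C_k k (\<lambda>x. - real m * flat_exp (Suc m) x + flat_exp (Suc (Suc m)) x)"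
      by (intro C_k_add C_k_mult[OF C_k_const] Suc)
    ultimately show ?case by simp
  qed
  then show ?thesis by (simp add: smooth_def)
qed

text \<open>A smooth function that vanishes on \<open>x \<le> 0\<close> and equals \<open>1\<close> on \<open>x \<ge> 1\<close>.  Composing \<open>flat_exp 0\<close> with
  itself avoids the reciprocal of a smooth function.\<close>

definition smooth_step :: "real \<Rightarrow> real" where
  "smooth_step x = flat_exp 0 (1 - flat_exp 0 (1 - x) / flat_exp 0 1) / flat_exp 0 1"

lemma smooth_step_smooth: "smooth smooth_step"
proof -
  have aff: "smooth (\<lambda>x::real. c + d * x)" for c d
    by (intro smooth_add smooth_const smooth_linear bounded_linear_mult_right)
  have 1: "smooth (\<lambda>x. flat_exp 0 (1 + -1 * x))"
    by (rule smooth_compose[OF smooth_flat_exp aff])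
  have 2: "smooth (\<lambda>x. 1 + - (1 / flat_exp 0 1) * flat_exp 0 (1 + -1 * x))"
    by (rule smooth_add[OF smooth_const smooth_mult[OF smooth_const 1]])
  have 3: "smooth (\<lambda>x. (1 / flat_exp 0 1) * flat_exp 0 (1 + - (1 / flat_exp 0 1) * flat_exp 0 (1 + -1 * x)))"
    by (rule smooth_mult[OF smooth_const smooth_compose[OF smooth_flat_exp 2]])
  show ?thesis
    by (rule back_subst[of smooth, OF 3]) (auto simp: smooth_step_def fun_eq_iff)
qed

lemma flat_exp_0_mono: "x \<le> y \<Longrightarrow> flat_exp 0 x \<le> flat_exp 0 y"
  by (auto simp: flat_exp_def field_simps)

lemma smooth_step_le_0: "x \<le> 0 \<Longrightarrow> smooth_step x = 0"
proof -
  assume "x \<le> 0"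
  then have "flat_exp 0 1 \<le> flat_exp 0 (1 - x)" by (intro flat_exp_0_mono) auto
  moreover have "0 < flat_exp 0 1" by (simp add: flat_exp_def)
  ultimately have "1 - flat_exp 0 (1 - x) / flat_exp 0 1 \<le> 0" by (simp add: field_simps)
  then show ?thesis by (simp add: smooth_step_def flat_exp_def)
qed

lemma smooth_step_ge_1: "1 \<le> x \<Longrightarrow> smooth_step x = 1"
  by (simp add: smooth_step_def flat_exp_def)

lemma smooth_step_nonneg: "0 \<le> smooth_step x"
  by (simp add: smooth_step_def flat_exp_def)

lemma smooth_step_le_1: "smooth_step x \<le> 1"
proof -
  have "1 - flat_exp 0 (1 - x) / flat_exp 0 1 \<le> 1" by (simp add: flat_exp_def)
  from flat_exp_0_mono[OF this] show ?thesis by (simp add: smooth_step_def flat_exp_def)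
qed

text \<open>Smooth minorants of the indicator function of the open rectangle with opposite corners \<open>p\<close> and
  \<open>q\<close>, which converge to it pointwise as \<open>m\<close> tends to infinity.\<close>

definition box_bump :: "real \<Rightarrow> real \<times> real \<Rightarrow> real \<times> real \<Rightarrow> real \<times> real \<Rightarrow> real" where
  "box_bump m p q z =
     (smooth_step (m * (fst z - fst p)) * smooth_step (m * (fst q - fst z))) *
     (smooth_step (m * (snd z - snd p)) * smooth_step (m * (snd q - snd z)))"

lemma smooth_box_bump: "smooth (box_bump m p q)"
proof -
  have st: "smooth (\<lambda>z::real\<times>real. smooth_step (c + (d * fst z + d' * snd z)))" for c d d'
    by (intro smooth_compose[OF smooth_step_smooth] smooth_add[OF smooth_const] smooth_linear
        bounded_linear_add bounded_linear_const_mult bounded_linear_fst bounded_linear_snd)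
  note st1 = st[of "- (m * fst p)" m 0] and st2 = st[of "m * fst q" "-m" 0]
    and st3 = st[of "- (m * snd p)" 0 m] and st4 = st[of "m * snd q" 0 "-m"]
  show ?thesis
    by (rule back_subst[of smooth, OF smooth_mult[OF smooth_mult[OF st1 st2] smooth_mult[OF st3 st4]]])
       (auto simp: box_bump_def fun_eq_iff algebra_simps)
qed

lemma box_bump_nonneg: "0 \<le> box_bump m p q z"
  by (simp add: box_bump_def smooth_step_nonneg)

lemma box_bump_le_1: "box_bump m p q z \<le> 1"
  unfolding box_bump_def by (intro mult_le_one mult_nonneg_nonneg smooth_step_nonneg smooth_step_le_1)

lemma mem_box_prod:
  fixes z p q :: "real \<times> real"
  shows "z \<in> box p q \<longleftrightarrow> fst p < fst z \<and> fst z < fst q \<and> snd p < snd z \<and> snd z < snd q"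
    and "z \<in> cbox p q \<longleftrightarrow> fst p \<le> fst z \<and> fst z \<le> fst q \<and> snd p \<le> snd z \<and> snd z \<le> snd q"
  by (auto simp: mem_box Basis_prod_def inner_prod_def)

lemma box_bump_outside:
  assumes "0 < m" "z \<notin> box p q"
  shows "box_bump m p q z = 0"
  using assms unfolding mem_box_prod box_bump_def
  by (auto simp: not_less mult_nonneg_nonpos intro!: smooth_step_le_0)

lemma box_bump_inside:
  assumes "0 < m" "fst p + 1/m \<le> fst z" "fst z \<le> fst q - 1/m" "snd p + 1/m \<le> snd z" "snd z \<le> snd q - 1/m"
  shows "box_bump m p q z = 1"
proof -
  have "1 \<le> m * (fst z - fst p)" "1 \<le> m * (fst q - fst z)" "1 \<le> m * (snd z - snd p)" "1 \<le> m * (snd q - snd z)"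
    using assms by (simp_all add: field_simps)
  then show ?thesis by (simp add: box_bump_def smooth_step_ge_1)
qed

lemma test_functionI:
  assumes "smooth \<phi>" "\<And>z. z \<notin> cbox p q \<Longrightarrow> \<phi> z = 0" "cbox p q \<subseteq> U"
  shows "test_function U \<phi>"
proof -
  have "closure {z. \<phi> z \<noteq> 0} \<subseteq> cbox p q"
    by (rule closure_minimal) (use assms(2) in auto)
  then show ?thesis unfolding test_function_def
    by (metis assms(1,3) closed_Int_compact closed_closure compact_cbox inf.absorb1 order_trans)
qed

section \<open>Integration lemmas\<close>

lemma nn_integral_lborel_affine:
  fixes k :: "'a::euclidean_space \<Rightarrow> ennreal"
  assumes [measurable]: "k \<in> borel_measurable borel" and "c \<noteq> 0"
  shows "(\<integral>\<^sup>+z. k z \<partial>lborel) = ennreal (\<bar>c\<bar> ^ DIM('a)) * (\<integral>\<^sup>+z. k (t + c *\<^sub>R z) \<partial>lborel)"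
  by (subst lborel_affine[OF assms(2), of t])
     (simp add: nn_integral_density nn_integral_distr nn_integral_cmult)

lemma integral_lborel_reflect:
  fixes k :: "'a::euclidean_space \<Rightarrow> real"
  assumes "integrable lborel k"
  shows "integrable lborel (\<lambda>y. k (x - y))" "(LINT y|lborel. k (x - y)) = (LINT y|lborel. k y)"
proof -
  have [measurable]: "k \<in> borel_measurable borel" using assms by auto
  have eq: "lborel = distr lborel borel (\<lambda>y. x - y)"
    using lborel_affine[of "-1" x] by (simp add: density_1)
  show "integrable lborel (\<lambda>y. k (x - y))"
    using assms by (subst (asm) eq) (simp add: integrable_distr_eq)
  show "(LINT y|lborel. k (x - y)) = (LINT y|lborel. k y)"
    by (subst (2) eq) (simp add: integral_distr)
qed

text \<open>Young's inequality for the convolution of a square-integrable function with a probability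
  density, in the form needed after an affine change of variables: by Jensen's inequality the
  square of the average is at most the average of the square.\<close>

lemma convolution_L2_bound:
  fixes h k :: "'a::euclidean_space \<Rightarrow> real"
  assumes h [measurable]: "h \<in> borel_measurable borel" and h2: "integrable lborel (\<lambda>y. (h y)\<^sup>2)"
    and k: "integrable lborel k" "(LINT y|lborel. k y) = 1" "\<And>y. 0 \<le> k y" "\<And>y. k y \<le> B"
    and "0 < c"
  shows "(\<integral>\<^sup>+z. ennreal ((LINT y|lborel. h y * k (t + c *\<^sub>R z - y))\<^sup>2) \<partial>lborel)
      \<le> ennreal ((LINT y|lborel. (h y)\<^sup>2) / c ^ DIM('a))"
proof -
  have [measurable]: "k \<in> borel_measurable borel" using k(1) by auto
  note kx = integral_lborel_reflect[OF k(1)]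
  have int2: "integrable lborel (\<lambda>y. (h y)\<^sup>2 * k (x - y))" for x
  proof (rule Bochner_Integration.integrable_bound[OF integrable_mult_right[OF h2, of B]])
    have "(h y)\<^sup>2 * k (x - y) \<le> B * (h y)\<^sup>2" for y
      using mult_left_mono[OF k(4)[of "x - y"], of "(h y)\<^sup>2"] by (simp add: mult.commute)
    moreover have "0 \<le> B" using k(3,4) order_trans by blast
    ultimately show "AE y in lborel. norm ((h y)\<^sup>2 * k (x - y)) \<le> norm (B * (h y)\<^sup>2)"
      using k(3) by simp
  qed auto
  have int1: "integrable lborel (\<lambda>y. h y * k (x - y))" for x
  proof (rule Bochner_Integration.integrable_bound[OF Bochner_Integration.integrable_add[OF int2[of x] kx(1)[of x]]])
    have "\<bar>h y\<bar> * k (x - y) \<le> ((h y)\<^sup>2 + 1) * k (x - y)" for y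
    proof (rule mult_right_mono)
      have "(\<bar>h y\<bar> - 1/2)\<^sup>2 = (h y)\<^sup>2 - \<bar>h y\<bar> + 1/4"
        by (simp add: power2_diff power2_eq_square[of "1/2"])
      then show "\<bar>h y\<bar> \<le> (h y)\<^sup>2 + 1" using zero_le_power2[of "\<bar>h y\<bar> - 1/2"] by linarith
    qed (use k in auto)
    moreover have "norm (h y * k (x - y)) = \<bar>h y\<bar> * k (x - y)" for y
      using k(3)[of "x - y"] by (simp add: abs_mult)
    moreover have "norm ((h y)\<^sup>2 * k (x - y) + k (x - y)) = ((h y)\<^sup>2 + 1) * k (x - y)" for y
      using k(3)[of "x - y"] by (simp add: algebra_simps)
    ultimately show "AE y in lborel. norm (h y * k (x - y)) \<le> norm ((h y)\<^sup>2 * k (x - y) + k (x - y))"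
      by simp
  qed auto
  have jensen: "(LINT y|lborel. h y * k (x - y))\<^sup>2 \<le> (LINT y|lborel. (h y)\<^sup>2 * k (x - y))" for x
  proof -
    let ?m = "LINT y|lborel. h y * k (x - y)"
    have "0 \<le> (LINT y|lborel. (h y - ?m)\<^sup>2 * k (x - y))"
      by (rule integral_nonneg_AE) (use k in auto)
    also have "\<dots> = (LINT y|lborel. (h y)\<^sup>2 * k (x - y) - 2 * ?m * (h y * k (x - y)) + ?m\<^sup>2 * k (x - y))"
      by (rule Bochner_Integration.integral_cong) (auto simp: power2_eq_square algebra_simps)
    also have "\<dots> = (LINT y|lborel. (h y)\<^sup>2 * k (x - y)) - 2 * ?m * ?m + ?m\<^sup>2 * 1"
      using int1[of x] int2[of x] kx[of x] k(2) by simp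
    finally show ?thesis by (simp add: power2_eq_square)
  qed
  have "(\<integral>\<^sup>+z. ennreal ((LINT y|lborel. h y * k (t + c *\<^sub>R z - y))\<^sup>2) \<partial>lborel)
      \<le> (\<integral>\<^sup>+z. (\<integral>\<^sup>+y. ennreal ((h y)\<^sup>2 * k (t + c *\<^sub>R z - y)) \<partial>lborel) \<partial>lborel)"
  proof (rule nn_integral_mono)
    fix z
    have "(\<integral>\<^sup>+y. ennreal ((h y)\<^sup>2 * k (t + c *\<^sub>R z - y)) \<partial>lborel)
        = ennreal (LINT y|lborel. (h y)\<^sup>2 * k (t + c *\<^sub>R z - y))"
      by (rule nn_integral_eq_integral[OF int2]) (use k in auto)
    then show "ennreal ((LINT y|lborel. h y * k (t + c *\<^sub>R z - y))\<^sup>2)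
        \<le> (\<integral>\<^sup>+y. ennreal ((h y)\<^sup>2 * k (t + c *\<^sub>R z - y)) \<partial>lborel)"
      using jensen by (simp add: ennreal_leI)
  qed
  also have "\<dots> = (\<integral>\<^sup>+y. (\<integral>\<^sup>+z. ennreal ((h y)\<^sup>2 * k (t + c *\<^sub>R z - y)) \<partial>lborel) \<partial>lborel)"
    by (rule lborel_pair.Fubini') measurable
  also have "\<dots> = (\<integral>\<^sup>+y. ennreal ((h y)\<^sup>2) * ennreal (1 / c ^ DIM('a)) \<partial>lborel)"
  proof (rule nn_integral_cong)
    fix y
    have "ennreal (c ^ DIM('a)) * (\<integral>\<^sup>+z. ennreal (k (t - y + c *\<^sub>R z)) \<partial>lborel) = (\<integral>\<^sup>+z. ennreal (k z) \<partial>lborel)"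
      using nn_integral_lborel_affine[of "\<lambda>z. ennreal (k z)" c "t - y"] \<open>0 < c\<close> by simp
    also have "\<dots> = 1"
      using nn_integral_eq_integral[OF k(1)] k by simp
    finally have "ennreal (1 / c ^ DIM('a)) * (ennreal (c ^ DIM('a)) * (\<integral>\<^sup>+z. ennreal (k (t - y + c *\<^sub>R z)) \<partial>lborel))
        = ennreal (1 / c ^ DIM('a))" by simp
    then have "(\<integral>\<^sup>+z. ennreal (k (t - y + c *\<^sub>R z)) \<partial>lborel) = ennreal (1 / c ^ DIM('a))"
      using \<open>0 < c\<close> by (simp flip: mult.assoc ennreal_mult')
    moreover have "(\<integral>\<^sup>+z. ennreal ((h y)\<^sup>2 * k (t + c *\<^sub>R z - y)) \<partial>lborel)
        = ennreal ((h y)\<^sup>2) * (\<integral>\<^sup>+z. ennreal (k (t - y + c *\<^sub>R z)) \<partial>lborel)"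
      using k by (subst nn_integral_cmult[symmetric]) (auto simp: ennreal_mult' algebra_simps intro!: nn_integral_cong)
    ultimately show "(\<integral>\<^sup>+z. ennreal ((h y)\<^sup>2 * k (t + c *\<^sub>R z - y)) \<partial>lborel)
        = ennreal ((h y)\<^sup>2) * ennreal (1 / c ^ DIM('a))" by simp
  qed
  also have "\<dots> = ennreal ((LINT y|lborel. (h y)\<^sup>2) / c ^ DIM('a))"
    using \<open>0 < c\<close> nn_integral_eq_integral[OF h2]
    by (subst nn_integral_multc) (auto simp flip: ennreal_mult)
  finally show ?thesis .
qed

lemma L2_approx_bounded:
  fixes w :: "'a::euclidean_space \<Rightarrow> real"
  assumes [measurable]: "w \<in> borel_measurable borel" and w2: "integrable lborel (\<lambda>y. (w y)\<^sup>2)" and "0 < e"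
  obtains M where "0 < M" "(LINT y|lborel. (w y - max (- M) (min M (w y)))\<^sup>2) \<le> e"
proof -
  have "(\<lambda>n. LINT y|lborel. (w y - max (- real n) (min (real n) (w y)))\<^sup>2) \<longlonglongrightarrow> (LINT y|(lborel::'a measure). 0::real)"
  proof (rule integral_dominated_convergence[where w="\<lambda>y. (w y)\<^sup>2"])
    have "(\<lambda>n. (w y - max (- real n) (min (real n) (w y)))\<^sup>2) \<longlonglongrightarrow> 0" for y
    proof (rule tendsto_eventually)
      obtain N where "\<bar>w y\<bar> \<le> real N" using real_arch_simple by blast
      then show "\<forall>\<^sub>F n in sequentially. (w y - max (- real n) (min (real n) (w y)))\<^sup>2 = 0"
        by (auto simp: eventually_sequentially max_def min_def intro!: exI[of _ N])
    qed
    then show "AE y in lborel. (\<lambda>n. (w y - max (- real n) (min (real n) (w y)))\<^sup>2) \<longlonglongrightarrow> 0" by simp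
    have "(w y - max (- real n) (min (real n) (w y)))\<^sup>2 \<le> (w y)\<^sup>2" for y n
      by (rule abs_le_square_iff[THEN iffD1]) auto
    then show "AE y in lborel. norm ((w y - max (- real n) (min (real n) (w y)))\<^sup>2) \<le> (w y)\<^sup>2" for n
      by simp
  qed (use w2 in auto)
  then have "\<forall>\<^sub>F n in sequentially. (LINT y|lborel. (w y - max (- real n) (min (real n) (w y)))\<^sup>2) < e"
    using \<open>0 < e\<close> by (intro order_tendstoD(2)[where a=e]) auto
  then obtain n where "\<forall>m\<ge>n. (LINT y|lborel. (w y - max (- real m) (min (real m) (w y)))\<^sup>2) < e"
    by (auto simp: eventually_sequentially)
  then have "(LINT y|lborel. (w y - max (- real (Suc n)) (min (real (Suc n)) (w y)))\<^sup>2) < e"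
    by (simp del: of_nat_Suc)
  then show thesis using that[of "real (Suc n)"] by (simp del: of_nat_Suc)
qed

text \<open>Continuous functions are dense in \<open>L\<^sup>2\<close> of a set of finite measure.\<close>

lemma L2_approx_continuous:
  fixes w :: "'a::euclidean_space \<Rightarrow> real"
  assumes [measurable]: "w \<in> borel_measurable borel" and w2: "integrable lborel (\<lambda>y. (w y)\<^sup>2)" and "0 < e"
    and \<Omega> [measurable]: "\<Omega> \<in> sets borel" and fin: "emeasure lborel \<Omega> < \<infinity>"
  obtains g :: "'a \<Rightarrow> real" where "continuous_on UNIV g"
    "integrable lborel (\<lambda>y. indicator \<Omega> y * (w y - g y)\<^sup>2)"
    "(LINT y|lborel. indicator \<Omega> y * (w y - g y)\<^sup>2) \<le> e"
proof -
  obtain M where M: "0 < M" "(LINT y|lborel. (w y - max (- M) (min M (w y)))\<^sup>2) \<le> e/4"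
    using L2_approx_bounded[OF assms(1) w2, of "e/4"] \<open>0 < e\<close> by auto
  define wM where "wM y = max (- M) (min M (w y))" for y
  have [measurable]: "wM \<in> borel_measurable borel" unfolding wM_def by measurable
  have "wM \<in> borel_measurable lebesgue" by (simp add: measurable_completion)
  then have "wM measurable_on UNIV" by (rule lebesgue_measurable_imp_measurable_on_real) auto
  then obtain N G where N: "negligible N" and G: "\<And>n::nat. continuous_on UNIV (G n)"
    and lim: "\<And>y. y \<notin> N \<Longrightarrow> (\<lambda>n. G n y) \<longlonglongrightarrow> wM y"
    unfolding measurable_on_def by auto
  define H where "H n y = max (- M) (min M (G n y))" for n y
  have H: "continuous_on UNIV (H n)" for n
    unfolding H_def by (intro continuous_on_max continuous_on_min continuous_on_const G)
  then have [measurable]: "H n \<in> borel_measurable borel" for n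
    by (rule borel_measurable_continuous_onI)
  have ind: "integrable lborel (\<lambda>y. indicator \<Omega> y * (c::real))" for c
    using fin by (intro integrable_mult_left integrable_real_indicator) auto
  obtain C where bnd: "(wM y - H n y)\<^sup>2 \<le> C" for n y
  proof
    show "(wM y - H n y)\<^sup>2 \<le> (2 * M)\<^sup>2" for n y
      by (rule abs_le_square_iff[THEN iffD1]) (use M(1) in \<open>auto simp: wM_def H_def\<close>)
  qed
  have "AE y in lebesgue. y \<notin> N"
    using N by (simp add: negligible_iff_null_sets AE_not_in)
  then have lim': "AE y in lborel. (\<lambda>n. indicator \<Omega> y * (wM y - H n y)\<^sup>2) \<longlonglongrightarrow> 0"
    unfolding AE_completion_iff
  proof eventually_elim
    case (elim y)
    have "(\<lambda>n. H n y) \<longlonglongrightarrow> max (- M) (min M (wM y))"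
      unfolding H_def by (intro tendsto_max tendsto_min tendsto_const lim elim)
    also have "max (- M) (min M (wM y)) = wM y" using M(1) by (auto simp: wM_def)
    finally have "(\<lambda>n. indicator \<Omega> y * (wM y - H n y)\<^sup>2) \<longlonglongrightarrow> indicator \<Omega> y * (wM y - wM y)\<^sup>2"
      by (intro tendsto_intros)
    then show ?case by simp
  qed
  have "(\<lambda>n. LINT y|lborel. indicator \<Omega> y * (wM y - H n y)\<^sup>2) \<longlonglongrightarrow> (LINT y|(lborel::'a measure). 0::real)"
    by (rule integral_dominated_convergence[OF _ _ ind[of C] lim'])
       (auto intro!: AE_I2 bnd simp: abs_mult indicator_def)
  then have "\<forall>\<^sub>F n in sequentially. (LINT y|lborel. indicator \<Omega> y * (wM y - H n y)\<^sup>2) < e/4"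
    using \<open>0 < e\<close> by (intro order_tendstoD(2)[where a="e/4"]) auto
  then obtain n where n: "(LINT y|lborel. indicator \<Omega> y * (wM y - H n y)\<^sup>2) < e/4"
    by (auto dest: eventually_happens)
  have i1: "integrable lborel (\<lambda>y. (w y - wM y)\<^sup>2)"
    by (rule Bochner_Integration.integrable_bound[OF w2])
       (use M(1) in \<open>auto simp: wM_def intro!: AE_I2 abs_le_square_iff[THEN iffD1]\<close>)
  have i2: "integrable lborel (\<lambda>y. indicator \<Omega> y * (wM y - H n y)\<^sup>2)"
    by (rule Bochner_Integration.integrable_bound[OF ind[of C]])
       (auto intro!: AE_I2 order_trans[OF bnd abs_ge_self] simp: indicator_def)
  have i3: "integrable lborel (\<lambda>y. 2 * (w y - wM y)\<^sup>2 + 2 * (indicator \<Omega> y * (wM y - H n y)\<^sup>2))"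
    using i1 i2 by simp
  have le: "indicator \<Omega> y * (w y - H n y)\<^sup>2 \<le> 2 * (w y - wM y)\<^sup>2 + 2 * (indicator \<Omega> y * (wM y - H n y)\<^sup>2)" for y
  proof -
    have "(w y - H n y)\<^sup>2 \<le> 2 * (w y - wM y)\<^sup>2 + 2 * (wM y - H n y)\<^sup>2"
      using sum_squares_bound[of "w y - wM y" "wM y - H n y"] by (simp add: power2_eq_square algebra_simps)
    then show ?thesis by (auto simp: indicator_def)
  qed
  show thesis
  proof (rule that[OF H[of n]])
    show i4: "integrable lborel (\<lambda>y. indicator \<Omega> y * (w y - H n y)\<^sup>2)"
      by (rule Bochner_Integration.integrable_bound[OF i3])
         (auto intro!: AE_I2 order_trans[OF le] simp: abs_mult)
    have "(LINT y|lborel. indicator \<Omega> y * (w y - H n y)\<^sup>2)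
        \<le> (LINT y|lborel. 2 * (w y - wM y)\<^sup>2 + 2 * (indicator \<Omega> y * (wM y - H n y)\<^sup>2))"
      by (rule integral_mono[OF i4 i3 le])
    also have "\<dots> = 2 * (LINT y|lborel. (w y - wM y)\<^sup>2) + 2 * (LINT y|lborel. indicator \<Omega> y * (wM y - H n y)\<^sup>2)"
      using i1 i2 by simp
    also have "\<dots> \<le> e" using M(2) n by (simp add: wM_def)
    finally show "(LINT y|lborel. indicator \<Omega> y * (w y - H n y)\<^sup>2) \<le> e" .
  qed
qed

section \<open>Borel representatives and uniqueness of weak derivatives\<close>

text \<open>Fubini's theorem and the translation invariance are used for \<^term>\<open>lborel\<close>, so Lebesgue measurable
  functions are first replaced by Borel functions that agree with them almost everywhere.\<close>

lemma borel_representative: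
  fixes w :: "'a::euclidean_space \<Rightarrow> real"
  assumes [measurable]: "\<Omega> \<in> sets borel" and w: "set_borel_measurable lebesgue \<Omega> w"
  obtains w0 where "w0 \<in> borel_measurable borel" "\<And>z. z \<notin> \<Omega> \<Longrightarrow> w0 z = 0"
    "AE z in lborel. z \<in> \<Omega> \<longrightarrow> w0 z = w z"
proof -
  obtain w1 where [measurable]: "w1 \<in> borel_measurable lborel"
    and ae: "AE z in lborel. indicator \<Omega> z *\<^sub>R w z = w1 z"
    using w completion_ex_borel_measurable_real unfolding set_borel_measurable_def by blast
  show thesis
  proof (rule that[of "\<lambda>z. indicator \<Omega> z * w1 z"])
    show "AE z in lborel. z \<in> \<Omega> \<longrightarrow> indicator \<Omega> z * w1 z = w z"
      using ae by eventually_elim auto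
  qed auto
qed

lemma set_integral_eq_representative:
  fixes w w0 \<phi> :: "'a::euclidean_space \<Rightarrow> real"
  assumes [measurable]: "\<Omega> \<in> sets borel" and w: "set_borel_measurable lebesgue \<Omega> w"
    and w0 [measurable]: "w0 \<in> borel_measurable borel" and out: "\<And>z. z \<notin> \<Omega> \<Longrightarrow> w0 z = 0"
    and ae: "AE z in lborel. z \<in> \<Omega> \<longrightarrow> w0 z = w z"
    and \<phi> [measurable]: "\<phi> \<in> borel_measurable borel"
  shows "(LINT z:\<Omega>|lebesgue. w z * \<phi> z) = (LINT z|lborel. w0 z * \<phi> z)"
proof -
  have "(LINT z|lborel. w0 z * \<phi> z) = (LINT z|lebesgue. w0 z * \<phi> z)"
    by (subst integral_completion) auto
  also have "\<dots> = (LINT z|lebesgue. (indicator \<Omega> z *\<^sub>R w z) * \<phi> z)"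
  proof (rule integral_cong_AE)
    show "(\<lambda>z. (indicator \<Omega> z *\<^sub>R w z) * \<phi> z) \<in> borel_measurable lebesgue"
      using w unfolding set_borel_measurable_def
      by (intro borel_measurable_times) (auto intro: measurable_completion)
    show "AE z in lebesgue. w0 z * \<phi> z = indicator \<Omega> z *\<^sub>R w z * \<phi> z"
      using AE_completion[OF ae] by eventually_elim (auto simp: out indicator_def)
  qed (auto intro: measurable_completion)
  finally show ?thesis by (simp add: set_lebesgue_integral_def mult.assoc)
qed

lemma AE_zero_if_box_integrals_zero:
  fixes w :: "'a::euclidean_space \<Rightarrow> real"
  assumes w: "integrable lborel w"
    and zero: "\<And>l u. (LINT y|lborel. indicator (box l u) y * w y) = 0"
  shows "AE y in lborel. w y = 0"
proof -
  have [measurable]: "w \<in> borel_measurable borel" using w by auto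
  define P where "P = density lborel (\<lambda>y. ennreal (w y))"
  define N where "N = density lborel (\<lambda>y. ennreal (- w y))"
  have P: "emeasure P (box l u) = (\<integral>\<^sup>+y. ennreal (indicator (box l u) y * w y) \<partial>lborel)"
    and N: "emeasure N (box l u) = (\<integral>\<^sup>+y. ennreal (- (indicator (box l u) y * w y)) \<partial>lborel)" for l u
    unfolding P_def N_def
    by (auto simp: emeasure_density indicator_def intro!: nn_integral_cong)
  have int: "integrable lborel (\<lambda>y. indicator (box l u) y * w y)" for l u
    using integrable_real_mult_indicator[OF _ w, of "box l u"] by (simp add: mult.commute)
  note fin = int[unfolded real_integrable_def, THEN conjunct2]
  have "P = N"
  proof (rule measure_eqI_generator_eq)
    let ?E = "range (\<lambda>(a, b). box a b::'a set)"
    show "Int_stable ?E" by (auto simp: Int_stable_def box_Int_box)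
    show "?E \<subseteq> Pow UNIV" "sets P = sigma_sets UNIV ?E" "sets N = sigma_sets UNIV ?E"
      by (simp_all add: borel_eq_box P_def N_def)
    let ?A = "\<lambda>n::nat. box (- (real n *\<^sub>R One)) (real n *\<^sub>R One) :: 'a set"
    show "range ?A \<subseteq> ?E" "(\<Union>i. ?A i) = UNIV"
      unfolding UN_box_eq_UNIV by auto
    show "emeasure P (?A i) \<noteq> \<infinity>" for i unfolding P using fin by simp
    fix X :: "'a set" assume "X \<in> ?E"
    then obtain l u where X: "X = box l u" by auto
    have "enn2real (emeasure P X) = enn2real (emeasure N X)"
      using real_lebesgue_integral_def[OF int[of l u]] zero[of l u] unfolding X P N by simp
    moreover have "emeasure P X < \<infinity>" "emeasure N X < \<infinity>"
      unfolding X P N using fin[of l u] by (auto simp: less_top)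
    ultimately show "emeasure P X = emeasure N X"
      by (metis ennreal_enn2real infinity_ennreal_def)
  qed
  then have "AE y in lborel. ennreal (w y) = ennreal (- w y)"
    unfolding P_def N_def by (intro sigma_finite_measure.density_unique[OF sigma_finite_lborel]) auto
  then show ?thesis
  proof eventually_elim
    case (elim y)
    then show ?case
      by (cases "0 \<le> w y") (auto simp: ennreal_neg ennreal_eq_0_iff not_le)
  qed
qed

lemma box_bump_tendsto_indicator:
  "(\<lambda>n. box_bump (real (Suc n)) p q z) \<longlonglongrightarrow> indicator (box p q) z"
proof (rule tendsto_eventually, cases "z \<in> box p q")
  case False
  then show "\<forall>\<^sub>F n in sequentially. box_bump (real (Suc n)) p q z = indicator (box p q) z"
    by (simp add: box_bump_outside)
next
  case True
  have lim: "\<forall>\<^sub>F n in sequentially. 1 / real (Suc n) < d" if "0 < d" for d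
    using order_tendstoD(2)[OF LIMSEQ_inverse_real_of_nat that] by (simp add: inverse_eq_divide)
  from True have pos: "0 < fst z - fst p" "0 < fst q - fst z" "0 < snd z - snd p" "0 < snd q - snd z"
    by (simp_all add: mem_box_prod)
  from lim[OF pos(1)] lim[OF pos(2)] lim[OF pos(3)] lim[OF pos(4)]
  show "\<forall>\<^sub>F n in sequentially. box_bump (real (Suc n)) p q z = indicator (box p q) z"
    by eventually_elim (use True in \<open>simp add: box_bump_inside del: of_nat_Suc\<close>)
qed

lemma AE_zero_if_orthogonal_to_bumps:
  fixes h :: "real \<times> real \<Rightarrow> real"
  assumes h: "integrable lborel h" and out: "\<And>z. z \<notin> box r s \<Longrightarrow> h z = 0"
    and orth: "\<And>n p q. cbox p q \<subseteq> cbox r s \<Longrightarrow> (LINT z|lborel. h z * box_bump (real (Suc n)) p q z) = 0"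
  shows "AE z in lborel. h z = 0"
proof (rule AE_zero_if_box_integrals_zero[OF h])
  fix l u :: "real \<times> real"
  have [measurable]: "h \<in> borel_measurable borel" using h by auto
  define p q where "p = (max (fst l) (fst r), max (snd l) (snd r))"
    and "q = (min (fst u) (fst s), min (snd u) (snd s))"
  have sub: "cbox p q \<subseteq> cbox r s" by (auto simp: mem_box_prod p_def q_def)
  have eq: "indicator (box l u) z * h z = h z * indicator (box p q) z" for z
    using out[of z] by (cases "z \<in> box r s") (auto simp: indicator_def mem_box_prod p_def q_def)
  have [measurable]: "box_bump m p q \<in> borel_measurable borel" for m
    by (intro borel_measurable_continuous_onI smooth_continuous_on smooth_box_bump)
  have "(\<lambda>n. LINT z|lborel. h z * box_bump (real (Suc n)) p q z)
      \<longlonglongrightarrow> (LINT z|lborel. h z * indicator (box p q) z)"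
  proof (rule integral_dominated_convergence[where w="\<lambda>z. \<bar>h z\<bar>"])
    show "AE z in lborel. (\<lambda>n. h z * box_bump (real (Suc n)) p q z) \<longlonglongrightarrow> h z * indicator (box p q) z"
      by (intro AE_I2 tendsto_mult tendsto_const box_bump_tendsto_indicator)
    show "AE z in lborel. norm (h z * box_bump (real (Suc n)) p q z) \<le> \<bar>h z\<bar>" for n
      by (intro AE_I2) (simp add: abs_mult box_bump_nonneg box_bump_le_1 mult_left_le)
  qed (use h in auto)
  then show "(LINT z|lborel. indicator (box l u) z * h z) = 0"
    unfolding eq orth[OF sub] by (simp add: LIMSEQ_const_iff)
qed

text \<open>Bumps approximate the indicator functions of rectangles, and the integrals over all rectangles
  determine an integrable function.  A weak derivative is only locally integrable, so this is
  applied on the members of an exhaustion by compactly contained rectangles.\<close>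

lemma weak_deriv_unique:
  assumes v1: "weak_deriv (box p q) i j g v1" and v2: "weak_deriv (box p q) i j g v2"
  shows "AE z in lborel. z \<in> box p q \<longrightarrow> v1 z = v2 z"
proof -
  define r where "r n = (fst p + 1 / real (Suc n), snd p + 1 / real (Suc n))" for n
  define s where "s n = (fst q - 1 / real (Suc n), snd q - 1 / real (Suc n))" for n
  have local: "AE z in lborel. z \<in> box (r n) (s n) \<longrightarrow> v1 z = v2 z" for n
  proof -
    have pos: "0 < 1 / real (Suc n)" by simp
    have sub: "cbox (r n) (s n) \<subseteq> box p q"
    proof
      fix z assume "z \<in> cbox (r n) (s n)"
      then show "z \<in> box p q"
        unfolding mem_box_prod r_def s_def fst_conv snd_conv using pos by linarith
    qed
    have li: "set_integrable lebesgue (cbox (r n) (s n)) v1" "set_integrable lebesgue (cbox (r n) (s n)) v2"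
      using v1 v2 sub by (auto simp: weak_deriv_def locally_integrable_def)
    then have li': "set_integrable lebesgue (box (r n) (s n)) (\<lambda>z. v1 z - v2 z)"
      by (intro set_integral_diff(1) set_integrable_subset[OF _ _ box_subset_cbox]) auto
    then have meas: "set_borel_measurable lebesgue (box (r n) (s n)) (\<lambda>z. v1 z - v2 z)"
      by (simp add: set_integrable_def set_borel_measurable_def borel_measurable_integrable)
    obtain h where [measurable]: "h \<in> borel_measurable borel"
      and out: "\<And>z. z \<notin> box (r n) (s n) \<Longrightarrow> h z = 0"
      and ae: "AE z in lborel. z \<in> box (r n) (s n) \<longrightarrow> h z = v1 z - v2 z"
      using borel_representative[OF _ meas] by auto
    have hint: "integrable lborel h"
    proof -
      have "integrable lebesgue h"
        using li'[unfolded set_integrable_def]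
        by (rule integrable_cong_AE_imp)
           (use AE_completion[OF ae] out in \<open>auto intro: measurable_completion elim!: eventually_mono simp: indicator_def\<close>)
      then show ?thesis by (simp add: integrable_completion)
    qed
    have "AE z in lborel. h z = 0"
    proof (rule AE_zero_if_orthogonal_to_bumps[OF hint out])
      fix m and p' q' :: "real \<times> real" assume sub': "cbox p' q' \<subseteq> cbox (r n) (s n)"
      let ?\<phi> = "box_bump (real (Suc m)) p' q'"
      have test: "test_function (box p q) ?\<phi>"
      proof (rule test_functionI[OF smooth_box_bump])
        show "?\<phi> z = 0" if "z \<notin> cbox p' q'" for z
          using that box_subset_cbox[of p' q'] by (intro box_bump_outside) auto
        show "cbox p' q' \<subseteq> box p q" using sub sub' by simp
      qed
      have \<phi>m [measurable]: "?\<phi> \<in> borel_measurable borel"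
        by (intro borel_measurable_continuous_onI smooth_continuous_on smooth_box_bump)
      have \<phi>out: "?\<phi> z = 0" if "z \<notin> box (r n) (s n)" for z
      proof (rule box_bump_outside)
        show "z \<notin> box p' q'"
        proof
          assume z: "z \<in> box p' q'"
          have "box p' q' \<subseteq> interior (cbox (r n) (s n))"
            using sub' box_subset_cbox[of p' q'] by (intro interior_maximal open_box) auto
          then show False using z that by (auto simp: interior_cbox)
        qed
      qed simp
      have int: "integrable lebesgue (\<lambda>z. indicator (box p q) z *\<^sub>R (v z * ?\<phi> z))"
        if v: "set_integrable lebesgue (cbox (r n) (s n)) v" for v
      proof -
        have eq: "indicator (box p q) z *\<^sub>R (v z * ?\<phi> z) = (indicator (cbox (r n) (s n)) z *\<^sub>R v z) * ?\<phi> z" for z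
          using \<phi>out[of z] sub box_subset_cbox[of "r n" "s n"] by (auto simp: indicator_def)
        note v' = v[unfolded set_integrable_def]
        have "?\<phi> \<in> borel_measurable lebesgue" using \<phi>m
          by (intro measurable_completion) (simp del: of_nat_Suc)
        from borel_measurable_times[OF borel_measurable_integrable[OF v'] this]
        show ?thesis unfolding eq
          by (rule Bochner_Integration.integrable_bound[OF v'])
             (auto simp: abs_mult box_bump_nonneg box_bump_le_1 mult_left_le)
      qed
      have "(LINT z:box p q|lebesgue. v1 z * ?\<phi> z) = (LINT z:box p q|lebesgue. v2 z * ?\<phi> z)"
      proof -
        have "(LINT z:box p q|lebesgue. g z * (d_x ^^ i) ((d_t ^^ j) ?\<phi>) z)
            = (- 1) ^ (i + j) * (LINT z:box p q|lebesgue. v z * ?\<phi> z)"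
          if "weak_deriv (box p q) i j g v" for v
          using that test unfolding weak_deriv_def by blast
        from this[OF v1] this[OF v2] show ?thesis by simp
      qed
      then have "0 = (LINT z:box p q|lebesgue. v1 z * ?\<phi> z - v2 z * ?\<phi> z)"
        using int[OF li(1)] int[OF li(2)] by (subst set_integral_diff(2)) (auto simp: set_integrable_def)
      also have "\<dots> = (LINT z:box (r n) (s n)|lebesgue. (v1 z - v2 z) * ?\<phi> z)"
        unfolding set_lebesgue_integral_def
        using \<phi>out sub box_subset_cbox[of "r n" "s n"]
        by (intro Bochner_Integration.integral_cong) (auto simp: indicator_def left_diff_distrib)
      also have "\<dots> = (LINT z|lborel. h z * ?\<phi> z)"
        by (rule set_integral_eq_representative[OF _ meas _ out ae]) (simp_all del: of_nat_Suc add: \<phi>m)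
      finally show "(LINT z|lborel. h z * ?\<phi> z) = 0" by simp
    qed
    with ae show ?thesis by eventually_elim auto
  qed
  have "AE z in lborel. \<forall>n. z \<in> box (r n) (s n) \<longrightarrow> v1 z = v2 z"
    unfolding AE_all_countable using local by blast
  then show ?thesis
  proof (eventually_elim, intro impI)
    fix z assume z: "\<forall>n. z \<in> box (r n) (s n) \<longrightarrow> v1 z = v2 z" "z \<in> box p q"
    define d where "d = min (min (fst z - fst p) (fst q - fst z)) (min (snd z - snd p) (snd q - snd z))"
    have "0 < d" using z(2) by (simp add: d_def mem_box_prod)
    then obtain n where "1 / real (Suc n) < d"
      using reals_Archimedean[of d] by (auto simp: inverse_eq_divide)
    then have "z \<in> box (r n) (s n)"
      by (auto simp: mem_box_prod r_def s_def d_def simp del: of_nat_Suc)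
    then show "v1 z = v2 z" using z(1) by auto
  qed
qed

section \<open>Finite sums of ridge functions and an exponential kernel\<close>

text \<open>A quadruple \<open>(c, \<alpha>, \<beta>, \<gamma>)\<close> in the list stands for the summand \<open>c * g (\<alpha> x + \<beta> t + \<gamma>)\<close>.  For
  \<open>g = tanh\<close> these are the networks with one hidden layer, for \<open>g = exp\<close> they form an algebra.\<close>

definition ridge :: "(real \<Rightarrow> real) \<Rightarrow> (real \<times> real \<times> real \<times> real) list \<Rightarrow> real \<times> real \<Rightarrow> real" where
  "ridge g xs z = (\<Sum>(c, \<alpha>, \<beta>, \<gamma>)\<leftarrow>xs. c * g (\<alpha> * fst z + \<beta> * snd z + \<gamma>))"

text \<open>The coefficient lists of the derivatives in \<open>x\<close> and in \<open>t\<close>.\<close>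

definition ridge_dx :: "(real \<times> real \<times> real \<times> real) list \<Rightarrow> (real \<times> real \<times> real \<times> real) list" where
  "ridge_dx = map (\<lambda>(c, \<alpha>, \<beta>, \<gamma>). (c * \<alpha>, \<alpha>, \<beta>, \<gamma>))"

definition ridge_dt :: "(real \<times> real \<times> real \<times> real) list \<Rightarrow> (real \<times> real \<times> real \<times> real) list" where
  "ridge_dt = map (\<lambda>(c, \<alpha>, \<beta>, \<gamma>). (c * \<beta>, \<alpha>, \<beta>, \<gamma>))"

lemma ridge_Nil [simp]: "ridge g [] z = 0"
  and ridge_Cons [simp]: "ridge g ((c, \<alpha>, \<beta>, \<gamma>) # xs) z
    = c * g (\<alpha> * fst z + \<beta> * snd z + \<gamma>) + ridge g xs z"
  and ridge_append: "ridge g (xs @ ys) z = ridge g xs z + ridge g ys z"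
  by (simp_all add: ridge_def)

lemma ridge_dx_simps [simp]: "ridge_dx [] = []"
    "ridge_dx ((c, \<alpha>, \<beta>, \<gamma>) # xs) = (c * \<alpha>, \<alpha>, \<beta>, \<gamma>) # ridge_dx xs"
  and ridge_dt_simps [simp]: "ridge_dt [] = []"
    "ridge_dt ((c, \<alpha>, \<beta>, \<gamma>) # xs) = (c * \<beta>, \<alpha>, \<beta>, \<gamma>) # ridge_dt xs"
  by (simp_all add: ridge_dx_def ridge_dt_def)

lemma ridge_continuous_on:
  assumes "continuous_on UNIV g"
  shows "continuous_on S (ridge g xs)"
proof (induction xs)
  case (Cons x xs)
  obtain c \<alpha> \<beta> \<gamma> where x: "x = (c, \<alpha>, \<beta>, \<gamma>)" by (cases x) auto
  have "continuous_on S (\<lambda>z. g (\<alpha> * fst z + \<beta> * snd z + \<gamma>))"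
    by (rule continuous_on_compose2[OF assms]) (auto intro!: continuous_intros)
  then have "continuous_on S (\<lambda>z. c * g (\<alpha> * fst z + \<beta> * snd z + \<gamma>) + ridge g xs z)"
    using Cons by (intro continuous_intros) auto
  then show ?case by (simp add: x)
qed (simp add: ridge_def)

lemma ridge_has_derivative:
  assumes "\<And>s. (g has_real_derivative g' s) (at s)"
  shows "(ridge g xs has_derivative
           (\<lambda>h. ridge g' (ridge_dx xs) z * fst h + ridge g' (ridge_dt xs) z * snd h)) (at z)"
proof (induction xs)
  case Nil
  then show ?case by (simp add: ridge_def)
next
  case (Cons x xs)
  obtain c \<alpha> \<beta> \<gamma> where x: "x = (c, \<alpha>, \<beta>, \<gamma>)" by (cases x) auto
  have "((\<lambda>z. \<alpha> * fst z + \<beta> * snd z + \<gamma>) has_derivative (\<lambda>h. \<alpha> * fst h + \<beta> * snd h)) (at z)"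
    by (auto intro!: derivative_eq_intros)
  from DERIV_compose_FDERIV[OF assms this]
  have "((\<lambda>z. c * g (\<alpha> * fst z + \<beta> * snd z + \<gamma>)) has_derivative
      (\<lambda>h. c * ((\<alpha> * fst h + \<beta> * snd h) * g' (\<alpha> * fst z + \<beta> * snd z + \<gamma>)))) (at z)"
    by (rule has_derivative_mult_right)
  from has_derivative_add[OF this Cons]
  have "((\<lambda>z. c * g (\<alpha> * fst z + \<beta> * snd z + \<gamma>) + ridge g xs z) has_derivative
      (\<lambda>h. ridge g' (ridge_dx (x # xs)) z * fst h + ridge g' (ridge_dt (x # xs)) z * snd h)) (at z)"
    by (rule has_derivative_eq_rhs) (auto simp: x algebra_simps)
  then show ?case by (simp add: x)
qed

lemma ridge_partial_deriv:
  assumes "\<And>s. (g has_real_derivative g' s) (at s)"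
  shows "d_x (ridge g xs) = ridge g' (ridge_dx xs)" "d_t (ridge g xs) = ridge g' (ridge_dt xs)"
  using partial_derivI[OF ridge_has_derivative[OF assms]] by (auto simp: fun_eq_iff)

lemma ridge_exp_mult: "\<exists>zs. \<forall>z. ridge exp zs z = ridge exp xs z * ridge exp ys z"
proof (induction xs)
  case Nil
  show ?case by (rule exI[of _ "[]"]) simp
next
  case (Cons x xs)
  obtain c \<alpha> \<beta> \<gamma> where x: "x = (c, \<alpha>, \<beta>, \<gamma>)" by (cases x) auto
  obtain zs where zs: "\<And>z. ridge exp zs z = ridge exp xs z * ridge exp ys z" using Cons by blast
  have "\<exists>us. \<forall>z. ridge exp us z = c * exp (\<alpha> * fst z + \<beta> * snd z + \<gamma>) * ridge exp ys z"
  proof (induction ys)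
    case Nil
    show ?case by (rule exI[of _ "[]"]) simp
  next
    case (Cons y ys)
    obtain c' \<alpha>' \<beta>' \<gamma>' where y: "y = (c', \<alpha>', \<beta>', \<gamma>')" by (cases y) auto
    obtain us where us: "\<And>z. ridge exp us z = c * exp (\<alpha> * fst z + \<beta> * snd z + \<gamma>) * ridge exp ys z"
      using Cons by blast
    show ?case
      by (rule exI[of _ "(c * c', \<alpha> + \<alpha>', \<beta> + \<beta>', \<gamma> + \<gamma>') # us"])
         (simp add: y us algebra_simps exp_add)
  qed
  then obtain us where us: "\<And>z. ridge exp us z = c * exp (\<alpha> * fst z + \<beta> * snd z + \<gamma>) * ridge exp ys z"
    by blast
  show ?case
    by (rule exI[of _ "us @ zs"]) (simp add: x ridge_append us zs algebra_simps)
qed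

lemma ridge_exp_power: "\<exists>zs. \<forall>z. ridge exp zs z = d * ridge exp xs z ^ n"
proof (induction n)
  case 0
  show ?case by (rule exI[of _ "[(d, 0, 0, 0)]"]) simp
next
  case (Suc n)
  then obtain zs where "\<And>z. ridge exp zs z = d * ridge exp xs z ^ n" by auto
  with ridge_exp_mult[of zs xs] show ?case by (auto simp: algebra_simps)
qed

lemma cbox_prod_eq: "cbox (p :: real \<times> real) q = {fst p..fst q} \<times> {snd p..snd q}"
  by (auto simp: mem_box_prod)

text \<open>The normalised powers of a function that is nonnegative on a rectangle and has its only maximum
  there at the origin form an approximate identity, as in Landau's proof of the Weierstrass theorem.
  If the function is a combination of exponentials, then so are the powers.\<close>

lemma landau_kernel_exists:
  fixes R1 R2 :: real
  assumes "0 < R1" "0 < R2"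
  defines "D \<equiv> cbox (- R1, - R2) (R1, R2)"
  obtains K :: "nat \<Rightarrow> (real \<times> real \<times> real \<times> real) list" where
    "\<And>n s. s \<in> D \<Longrightarrow> 0 \<le> ridge exp (K n) s"
    "\<And>n. (LINT s|lborel. indicator D s * ridge exp (K n) s) = 1"
    "\<And>\<delta> e. 0 < \<delta> \<Longrightarrow> 0 < e \<Longrightarrow>
       \<forall>\<^sub>F n in sequentially. \<forall>s\<in>D. \<delta> \<le> norm s \<longrightarrow> ridge exp (K n) s \<le> e"
proof -
  \<comment> \<open>This weight keeps the bracket in the next definition at most \<open>1 / \<theta>\<close> on \<open>D\<close>.\<close>
  define \<theta> where "\<theta> = 1 / (exp (2 * R1) + exp (2 * R2))"
  define \<kappa> where "\<kappa> s = 1 - \<theta> * ((exp (fst s) - 1)\<^sup>2 + (exp (snd s) - 1)\<^sup>2)" for s :: "real \<times> real"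
  define xs :: "(real \<times> real \<times> real \<times> real) list"
    where "xs = [(1 - 2 * \<theta>, 0, 0, 0), (- \<theta>, 2, 0, 0), (2 * \<theta>, 1, 0, 0), (- \<theta>, 0, 2, 0), (2 * \<theta>, 0, 1, 0)]"
  have den: "0 < exp (2 * R1) + exp (2 * R2)" by (simp add: add_pos_pos)
  then have \<theta>: "0 < \<theta>" by (simp add: \<theta>_def)
  have \<kappa>_ridge: "\<kappa> s = ridge exp xs s" for s
    by (simp add: xs_def \<kappa>_def power2_eq_square algebra_simps exp_double flip: mult_exp_exp)
       (simp add: algebra_simps flip: exp_add)
  have \<kappa>_cont: "continuous_on S \<kappa>" for S
    unfolding \<kappa>_def by (intro continuous_intros)
  have sq: "(exp x - 1)\<^sup>2 \<le> exp (2 * R)" if "- R \<le> x" "x \<le> R" "0 < R" for x R :: real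
  proof -
    have "\<bar>exp x - 1\<bar> \<le> exp R"
    proof (cases "0 \<le> x")
      case True
      have "exp x \<le> exp R" using that by simp
      moreover have "1 \<le> exp x" using True by simp
      ultimately show ?thesis by linarith
    next
      case False
      then have "exp x < 1" by simp
      moreover have "1 \<le> exp R" using that by simp
      ultimately show ?thesis using exp_gt_zero[of x] by linarith
    qed
    then have "\<bar>exp x - 1\<bar>\<^sup>2 \<le> (exp R)\<^sup>2" by (intro power_mono) auto
    then show ?thesis by (simp add: exp_double)
  qed
  have \<kappa>_nonneg: "0 \<le> \<kappa> s" if "s \<in> D" for s
  proof -
    have "(exp (fst s) - 1)\<^sup>2 + (exp (snd s) - 1)\<^sup>2 \<le> exp (2 * R1) + exp (2 * R2)"
      using that assms by (intro add_mono sq) (auto simp: D_def mem_box_prod)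
    then show ?thesis using den by (simp add: \<kappa>_def \<theta>_def field_simps)
  qed
  have \<kappa>_less: "\<kappa> s < 1" if "s \<noteq> 0" for s
  proof -
    have "exp (fst s) - 1 \<noteq> 0 \<or> exp (snd s) - 1 \<noteq> 0" using that by (cases s) (auto simp: zero_prod_def)
    then have "0 < (exp (fst s) - 1)\<^sup>2 + (exp (snd s) - 1)\<^sup>2"
      by (simp add: sum_power2_gt_zero_iff)
    then show ?thesis using \<theta> by (simp add: \<kappa>_def)
  qed
  have \<kappa>_0: "\<kappa> 0 = 1" by (simp add: \<kappa>_def)
  have D0: "0 \<in> D" using assms by (simp add: D_def mem_box_prod)
  have [measurable]: "\<kappa> \<in> borel_measurable borel"
    by (intro borel_measurable_continuous_onI \<kappa>_cont)
  have int: "integrable lborel (\<lambda>s. indicator D s * \<kappa> s ^ n)" for n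
    using borel_integrable_compact[of D "\<lambda>s. \<kappa> s ^ n"] \<kappa>_cont
    by (auto simp: D_def intro!: continuous_intros)
  define c where "c n = (LINT s|lborel. indicator D s * \<kappa> s ^ n)" for n
  \<comment> \<open>\<open>\<kappa>\<close> exceeds \<open>m\<close> on a small square around the origin, whose measure is a possible \<open>\<mu>\<close>.\<close>
  have lower: "\<exists>\<mu>>0. \<forall>n. \<mu> * m ^ n \<le> c n" if "0 \<le> m" "m < 1" for m
  proof -
    have "open {s. m < \<kappa> s}"
      by (intro open_Collect_less \<kappa>_cont continuous_intros)
    moreover have "0 \<in> {s. m < \<kappa> s}" using that \<kappa>_0 by simp
    ultimately obtain e where e: "0 < e" "ball 0 e \<subseteq> {s. m < \<kappa> s}"
      by (meson open_contains_ball)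
    define \<rho> where "\<rho> = min (e / 3) (min R1 R2)"
    have \<rho>: "0 < \<rho>" using e assms by (simp add: \<rho>_def)
    define D' where "D' = cbox (- \<rho>, - \<rho>) (\<rho>, \<rho>)"
    have D': "D' \<subseteq> D" by (auto simp: D'_def D_def mem_box_prod \<rho>_def)
    have m\<kappa>: "m \<le> \<kappa> s" if "s \<in> D'" for s
    proof -
      have "norm s \<le> \<bar>fst s\<bar> + \<bar>snd s\<bar>" by (cases s) (simp add: norm_Pair sqrt_sum_squares_le_sum_abs)
      also have "\<dots> \<le> \<rho> + \<rho>" using that by (auto simp: D'_def mem_box_prod)
      also have "\<dots> < e" using \<rho> e by (auto simp: \<rho>_def)
      finally show ?thesis using e(2) by (force simp: dist_norm)
    qed
    then have le: "indicator D' s * m ^ n \<le> indicator D s * \<kappa> s ^ n" for s n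
    proof (cases "s \<in> D'")
      case True
      then show ?thesis using D' power_mono[OF m\<kappa>[OF True] \<open>0 \<le> m\<close>, of n] by auto
    next
      case False
      then show ?thesis using \<kappa>_nonneg[of s] by (auto simp: indicator_def)
    qed
    have eD': "emeasure lborel D' < \<infinity>" unfolding D'_def by (rule emeasure_lborel_cbox_finite)
    have "measure lborel D' * m ^ n \<le> c n" for n
    proof -
      have "(LINT s|lborel. indicator D' s * m ^ n) \<le> c n"
        unfolding c_def
        by (intro integral_mono int le integrable_mult_left integrable_real_indicator eD') (simp add: D'_def)
      then show ?thesis by (simp add: D'_def)
    qed
    moreover have "0 < measure lborel D'"
      using \<rho> by (simp add: D'_def content_pos_lt_eq Basis_prod_def)
    ultimately show ?thesis by blast
  qed
  have c_pos: "0 < c n" for n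
  proof -
    obtain \<mu> where "0 < \<mu>" "\<And>n. \<mu> * (1/2) ^ n \<le> c n" using lower[of "1/2"] by auto
    then show ?thesis by (meson less_le_trans mult_pos_pos zero_less_power half_gt_zero zero_less_one)
  qed
  obtain K where K: "\<And>n s. ridge exp (K n) s = (1 / c n) * ridge exp xs s ^ n"
  proof -
    have "\<forall>n. \<exists>zs. \<forall>s. ridge exp zs s = (1 / c n) * ridge exp xs s ^ n"
      using ridge_exp_power by blast
    from choice[OF this] show ?thesis using that by blast
  qed
  show thesis
  proof (rule that[of K])
    show "0 \<le> ridge exp (K n) s" if "s \<in> D" for n s
      using \<kappa>_nonneg[OF that] c_pos[of n] by (simp add: K flip: \<kappa>_ridge)
    show "(LINT s|lborel. indicator D s * ridge exp (K n) s) = 1" for n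
    proof -
      have "(LINT s|lborel. indicator D s * ridge exp (K n) s) = (LINT s|lborel. (1 / c n) * (indicator D s * \<kappa> s ^ n))"
        by (simp add: K algebra_simps flip: \<kappa>_ridge)
      also have "\<dots> = (1 / c n) * c n" unfolding c_def by (rule integral_mult_right_zero)
      finally show ?thesis using c_pos[of n] by simp
    qed
    fix \<delta> e :: real assume "0 < \<delta>" "0 < e"
    define S where "S = D \<inter> {s. \<delta> \<le> norm s}"
    have "compact S" unfolding S_def D_def
      by (intro compact_Int_closed compact_cbox closed_Collect_le continuous_intros)
    have "\<exists>M. 0 \<le> M \<and> M < 1 \<and> (\<forall>s\<in>S. \<kappa> s \<le> M)"
    proof (cases "S = {}")
      case False
      then obtain s0 where s0: "s0 \<in> S" "\<forall>s\<in>S. \<kappa> s \<le> \<kappa> s0"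
        using continuous_attains_sup[OF \<open>compact S\<close> False \<kappa>_cont] by auto
      then have "s0 \<noteq> 0" "s0 \<in> D" using \<open>0 < \<delta>\<close> by (auto simp: S_def)
      then show ?thesis using s0 \<kappa>_nonneg \<kappa>_less by blast
    qed (auto intro: exI[of _ 0])
    then obtain M where M: "0 \<le> M" "M < 1" "\<And>s. s \<in> S \<Longrightarrow> \<kappa> s \<le> M" by auto
    \<comment> \<open>The decay like \<open>M ^ n\<close> away from the origin beats the lower bound \<open>\<mu> * m ^ n\<close> for the integral.\<close>
    define m where "m = (M + 1) / 2"
    have m: "0 < m" "M < m" "m < 1" using M by (auto simp: m_def)
    obtain \<mu> where \<mu>: "0 < \<mu>" "\<And>n. \<mu> * m ^ n \<le> c n" using lower[of m] m by auto
    have "(\<lambda>n. (M / m) ^ n / \<mu>) \<longlonglongrightarrow> 0 / \<mu>"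
      using m M \<mu> by (intro tendsto_divide LIMSEQ_realpow_zero tendsto_const) auto
    then have "\<forall>\<^sub>F n in sequentially. (M / m) ^ n / \<mu> < e"
      using \<open>0 < e\<close> by (intro order_tendstoD(2)[where a=e]) auto
    then show "\<forall>\<^sub>F n in sequentially. \<forall>s\<in>D. \<delta> \<le> norm s \<longrightarrow> ridge exp (K n) s \<le> e"
    proof (eventually_elim, intro ballI impI)
      fix n s assume n: "(M / m) ^ n / \<mu> < e" and s: "s \<in> D" "\<delta> \<le> norm s"
      have "ridge exp (K n) s = \<kappa> s ^ n / c n" by (simp add: K flip: \<kappa>_ridge)
      also have "\<dots> \<le> M ^ n / (\<mu> * m ^ n)"
        using M(1) M(3)[of s] s \<kappa>_nonneg[of s] \<mu> m
        by (intro frac_le power_mono) (auto simp: S_def)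
      also have "\<dots> = (M / m) ^ n / \<mu>" by (simp add: power_divide)
      finally show "ridge exp (K n) s \<le> e" using n by simp
    qed
  qed
qed

section \<open>Dilated convolution with the kernel\<close>

text \<open>The rectangle has opposite corners \<open>p\<close> and \<open>q\<close>; the lists \<open>K n\<close> are the coefficients of the
  kernels, which are used only on the set of differences of points of the rectangle.\<close>

locale approx_kernel =
  fixes p q :: "real \<times> real" and K :: "nat \<Rightarrow> (real \<times> real \<times> real \<times> real) list"
  assumes pq: "fst p < fst q" "snd p < snd q"
    and K_nonneg: "\<And>n s. s \<in> cbox (p - q) (q - p) \<Longrightarrow> 0 \<le> ridge exp (K n) s"
    and K_int: "\<And>n. (LINT s|lborel. indicator (cbox (p - q) (q - p)) s * ridge exp (K n) s) = 1"
    and K_tail: "\<And>\<delta> e. 0 < \<delta> \<Longrightarrow> 0 < e \<Longrightarrow> \<forall>\<^sub>F n in sequentially.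
      \<forall>s\<in>cbox (p - q) (q - p). \<delta> \<le> norm s \<longrightarrow> ridge exp (K n) s \<le> e"
begin

text \<open>The kernel truncated to the differences of points of the rectangle, where it is nonnegative.\<close>

definition kern :: "nat \<Rightarrow> real \<times> real \<Rightarrow> real" where
  "kern n s = indicator (cbox (p - q) (q - p)) s * ridge exp (K n) s"

text \<open>The contraction of the rectangle towards its centre by the factor \<open>r\<close>.\<close>

definition dil :: "real \<Rightarrow> real \<times> real \<Rightarrow> real \<times> real" where
  "dil r z = ((1 - r) / 2) *\<^sub>R (p + q) + r *\<^sub>R z"

text \<open>Convolution with the truncated kernel.\<close>

definition mollify :: "nat \<Rightarrow> (real \<times> real \<Rightarrow> real) \<Rightarrow> real \<times> real \<Rightarrow> real" where
  "mollify n h z = (LINT y|lborel. h y * kern n (z - y))"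

text \<open>Vanishing outside a closed rectangle inside the open one.\<close>

definition compact_support :: "(real \<times> real \<Rightarrow> real) \<Rightarrow> bool" where
  "compact_support \<eta> \<longleftrightarrow> (\<exists>p' q'. cbox p' q' \<subseteq> box p q \<and> (\<forall>y. y \<notin> cbox p' q' \<longrightarrow> \<eta> y = 0))"

text \<open>A smooth cutoff with compact support in the open rectangle that is equal to \<open>1\<close> on the
  \<open>\<delta>\<close>-neighbourhood of the contracted rectangle.\<close>

definition cutoff :: "real \<Rightarrow> (real \<times> real \<Rightarrow> real) \<Rightarrow> real \<Rightarrow> bool" where
  "cutoff r \<eta> \<delta> \<longleftrightarrow> smooth \<eta> \<and> (\<forall>y. 0 \<le> \<eta> y \<and> \<eta> y \<le> 1) \<and> 0 < \<delta> \<and>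
     compact_support \<eta> \<and>
     (\<forall>z\<in>cbox p q. \<forall>y. dist y (dil r z) < \<delta> \<longrightarrow> \<eta> y = 1)"

lemma cutoff_exists:
  assumes "0 < r" "r < 1"
  obtains \<eta> \<delta> where "cutoff r \<eta> \<delta>"
proof -
  define \<mu> where "\<mu> = (1 + r) / 2"
  have \<mu>: "r < \<mu>" "\<mu> < 1" "0 < \<mu>" using assms by (auto simp: \<mu>_def)
  define g where "g = (\<mu> - r) * min ((fst q - fst p) / 2) ((snd q - snd p) / 2)"
  have g: "0 < g" using \<mu> pq by (simp add: g_def)
  have g1: "g \<le> (\<mu> - r) * ((fst q - fst p) / 2)" "g \<le> (\<mu> - r) * ((snd q - snd p) / 2)"
    unfolding g_def using \<mu> by (intro mult_left_mono min.cobounded1 min.cobounded2; simp)+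
  have "cutoff r (box_bump (2 / g) (dil \<mu> p) (dil \<mu> q)) (g / 2)"
    unfolding cutoff_def compact_support_def
  proof (intro conjI allI ballI impI)
    show "\<exists>p' q'. cbox p' q' \<subseteq> box p q \<and> (\<forall>y. y \<notin> cbox p' q' \<longrightarrow> box_bump (2 / g) (dil \<mu> p) (dil \<mu> q) y = 0)"
    proof (intro exI conjI allI impI)
      have d1: "0 < (1 - \<mu>) * ((fst q - fst p) / 2)" "0 < (1 - \<mu>) * ((snd q - snd p) / 2)"
        using \<mu> pq by auto
      show "cbox (dil \<mu> p) (dil \<mu> q) \<subseteq> box p q"
      proof
        fix z assume "z \<in> cbox (dil \<mu> p) (dil \<mu> q)"
        then show "z \<in> box p q"
          using d1 unfolding mem_box_prod dil_def by (simp add: field_simps)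
      qed
      fix y assume "y \<notin> cbox (dil \<mu> p) (dil \<mu> q)"
      then show "box_bump (2 / g) (dil \<mu> p) (dil \<mu> q) y = 0"
        using g box_subset_cbox[of "dil \<mu> p" "dil \<mu> q"] by (intro box_bump_outside) auto
    qed
    fix z y assume z: "z \<in> cbox p q" and "dist y (dil r z) < g / 2"
    then have "\<bar>fst y - fst (dil r z)\<bar> < g / 2" "\<bar>snd y - snd (dil r z)\<bar> < g / 2"
      using dist_fst_le[of y "dil r z"] dist_snd_le[of y "dil r z"] by (auto simp: dist_real_def)
    moreover have "r * fst p \<le> r * fst z" "r * fst z \<le> r * fst q" "r * snd p \<le> r * snd z" "r * snd z \<le> r * snd q"
      using z assms by (auto simp: mem_box_prod)
    ultimately show "box_bump (2 / g) (dil \<mu> p) (dil \<mu> q) y = 1"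
      using g g1 by (intro box_bump_inside) (auto simp: dil_def field_simps)
  qed (use g in \<open>auto simp: smooth_box_bump box_bump_nonneg box_bump_le_1\<close>)
  then show thesis by (rule that)
qed

lemma kern_nonneg: "0 \<le> kern n s"
  using K_nonneg by (simp add: kern_def indicator_def)

lemma continuous_K: "continuous_on S (ridge exp xs)"
  by (intro ridge_continuous_on continuous_intros)

lemma kern_integrable: "integrable lborel (kern n)"
  unfolding kern_def
  using borel_integrable_compact[OF compact_cbox continuous_K, of "p - q" "q - p" "K n"]
  by simp

lemma kern_measurable [measurable]: "kern n \<in> borel_measurable borel"
  using kern_integrable[of n] by auto

lemma kern_int: "(LINT s|lborel. kern n s) = 1"
  unfolding kern_def by (rule K_int)

lemma kern_bounded: obtains B where "\<And>s. kern n s \<le> B" "0 \<le> B"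
proof -
  have "bounded (ridge exp (K n) ` cbox (p - q) (q - p))"
    by (intro compact_imp_bounded compact_continuous_image continuous_K compact_cbox)
  then obtain B where "\<And>s. s \<in> cbox (p - q) (q - p) \<Longrightarrow> \<bar>ridge exp (K n) s\<bar> \<le> B"
    by (auto simp: bounded_iff)
  then have "ridge exp (K n) s \<le> max B 0" if "s \<in> cbox (p - q) (q - p)" for s
    using that by (meson abs_le_D1 max.coboundedI1)
  then have "kern n s \<le> max B 0" for s
    by (simp add: kern_def indicator_def)
  then show thesis using that[of "max B 0"] by simp
qed

lemma diff_in_cbox: "z \<in> cbox p q \<Longrightarrow> y \<in> cbox p q \<Longrightarrow> z - y \<in> cbox (p - q) (q - p)"
  by (auto simp: mem_box_prod)

lemma dil_in_cbox:
  assumes "0 \<le> r" "r \<le> 1" "z \<in> cbox p q"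
  shows "dil r z \<in> cbox p q"
proof -
  have m: "(1/2) *\<^sub>R (p + q) \<in> cbox p q" using pq by (auto simp: mem_box_prod)
  have "(1 - r) *\<^sub>R ((1/2) *\<^sub>R (p + q)) + r *\<^sub>R z \<in> cbox p q"
    using convex_box(1)[of p q] assms m by (auto simp: convex_def)
  then show ?thesis by (simp add: dil_def)
qed

lemma integrable_mult_kern:
  assumes "integrable lborel h"
  shows "integrable lborel (\<lambda>y. h y * kern n (z - y))"
proof -
  have [measurable]: "h \<in> borel_measurable borel" using assms by auto
  obtain B where B: "\<And>s. kern n s \<le> B" "0 \<le> B" using kern_bounded[of n] by blast
  show ?thesis
  proof (rule Bochner_Integration.integrable_bound[OF integrable_mult_right[OF assms, of B]])
    have "\<bar>h y\<bar> * kern n (z - y) \<le> B * \<bar>h y\<bar>" for y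
      using mult_left_mono[OF B(1), of "\<bar>h y\<bar>"] by (simp add: mult.commute)
    then show "AE y in lborel. norm (h y * kern n (z - y)) \<le> norm (B * h y)"
      using kern_nonneg B(2) by (simp add: abs_mult)
  qed auto
qed

lemma mollify_add:
  "integrable lborel h \<Longrightarrow> integrable lborel h' \<Longrightarrow>
    mollify n (\<lambda>y. h y + h' y) z = mollify n h z + mollify n h' z"
  unfolding mollify_def by (simp add: distrib_right integrable_mult_kern)

text \<open>What \<open>h\<close> does away from the point of evaluation is irrelevant in the limit.  This disposes of the
  terms in which a derivative has fallen on the cutoff.\<close>

lemma mollify_far:
  assumes h: "integrable lborel h" and out: "\<And>y. y \<notin> box p q \<Longrightarrow> h y = 0"
    and r: "0 \<le> r" "r \<le> 1" and "0 < \<delta>"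
    and near: "\<And>z y. z \<in> cbox p q \<Longrightarrow> dist y (dil r z) < \<delta> \<Longrightarrow> h y = 0" and "0 < e"
  shows "\<forall>\<^sub>F n in sequentially. \<forall>z\<in>cbox p q. \<bar>mollify n h (dil r z)\<bar> \<le> e"
proof -
  define I where "I = (LINT y|lborel. \<bar>h y\<bar>)"
  have I: "0 \<le> I" unfolding I_def by (rule integral_nonneg_AE) simp
  define e' where "e' = e / (I + 1)"
  have e': "0 < e'" using I \<open>0 < e\<close> by (simp add: e'_def)
  show ?thesis
    using K_tail[OF \<open>0 < \<delta>\<close> e']
  proof (eventually_elim, intro ballI)
    fix n z assume n: "\<forall>s\<in>cbox (p - q) (q - p). \<delta> \<le> norm s \<longrightarrow> ridge exp (K n) s \<le> e'" and z: "z \<in> cbox p q"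
    have "\<bar>h y * kern n (dil r z - y)\<bar> \<le> e' * \<bar>h y\<bar>" for y
    proof (cases "y \<in> box p q \<and> \<delta> \<le> dist y (dil r z)")
      case True
      then have "dil r z - y \<in> cbox (p - q) (q - p)"
        using diff_in_cbox[OF dil_in_cbox[OF r z]] box_subset_cbox by blast
      moreover have "\<delta> \<le> norm (dil r z - y)" using True by (simp add: dist_norm norm_minus_commute)
      ultimately have "kern n (dil r z - y) \<le> e'" using n by (simp add: kern_def)
      then show ?thesis
        using kern_nonneg[of n "dil r z - y"] mult_left_mono[of "kern n (dil r z - y)" e' "\<bar>h y\<bar>"]
        by (simp add: abs_mult mult.commute)
    next
      case False
      then have "h y = 0" using out near[OF z] by (meson linorder_not_less)
      then show ?thesis by simp
    qed
    then have "\<bar>mollify n h (dil r z)\<bar> \<le> (LINT y|lborel. e' * \<bar>h y\<bar>)"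
      unfolding mollify_def using h
      by (intro order_trans[OF integral_abs_bound] integral_mono integrable_abs integrable_mult_kern) auto
    also have "\<dots> = e' * I" by (simp add: I_def)
    also have "\<dots> \<le> e"
    proof -
      have "e * I \<le> e * (I + 1)" using \<open>0 < e\<close> by simp
      then show ?thesis using I by (simp add: e'_def divide_le_eq)
    qed
    finally show "\<bar>mollify n h (dil r z)\<bar> \<le> e" .
  qed
qed

lemma dist_dil_le: "z \<in> cbox p q \<Longrightarrow> r \<le> 1 \<Longrightarrow> dist (dil r z) z \<le> (1 - r) * norm (q - p)"
proof -
  assume z: "z \<in> cbox p q" "r \<le> 1"
  have "dil r z - z = (1 - r) *\<^sub>R ((1/2) *\<^sub>R (p + q) - z)"
    by (simp add: dil_def algebra_simps)
  then have "dist (dil r z) z = (1 - r) * dist ((1/2) *\<^sub>R (p + q)) z"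
    using z(2) by (simp add: dist_norm)
  also have "dist ((1/2) *\<^sub>R (p + q)) z \<le> norm (q - p)"
  proof -
    have "\<bar>fst ((1/2) *\<^sub>R (p + q) - z)\<bar> \<le> \<bar>fst (q - p)\<bar>" "\<bar>snd ((1/2) *\<^sub>R (p + q) - z)\<bar> \<le> \<bar>snd (q - p)\<bar>"
    proof -
      have "fst p \<le> fst z" "fst z \<le> fst q" "snd p \<le> snd z" "snd z \<le> snd q"
        using z(1) by (auto simp: mem_box_prod)
      moreover have "\<bar>(a + b) / 2 - x\<bar> \<le> \<bar>b - a\<bar>" if "a \<le> x" "x \<le> b" for a b x :: real
        using that by (auto simp: abs_if field_simps)
      ultimately show "\<bar>fst ((1/2) *\<^sub>R (p + q) - z)\<bar> \<le> \<bar>fst (q - p)\<bar>"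
        "\<bar>snd ((1/2) *\<^sub>R (p + q) - z)\<bar> \<le> \<bar>snd (q - p)\<bar>"
        by simp_all
    qed
    then show ?thesis
      by (simp add: dist_norm norm_prod_def abs_le_square_iff add_mono)
  qed
  finally show ?thesis using z(2) by (simp add: mult_left_mono)
qed

lemma mollify_uniform:
  assumes g: "continuous_on (cbox p q) g" and "0 < e"
  shows "\<forall>\<^sub>F r in at_left 1. \<forall>\<eta> \<delta>. cutoff r \<eta> \<delta> \<longrightarrow> (\<forall>\<^sub>F n in sequentially. \<forall>z\<in>cbox p q.
    \<bar>mollify n (\<lambda>y. indicator (box p q) y * g y * \<eta> y) (dil r z) - g z\<bar> \<le> e)"
proof -
  obtain M where M: "0 < M" "\<And>z. z \<in> cbox p q \<Longrightarrow> \<bar>g z\<bar> \<le> M"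
    using compact_imp_bounded[OF compact_continuous_image[OF g compact_cbox]]
    by (auto simp: bounded_pos)
  have "uniformly_continuous_on (cbox p q) g"
    by (rule compact_uniformly_continuous[OF g compact_cbox])
  then obtain d where d: "0 < d" "\<And>y z. y \<in> cbox p q \<Longrightarrow> z \<in> cbox p q \<Longrightarrow> dist y z < d \<Longrightarrow> \<bar>g y - g z\<bar> < e/2"
    using \<open>0 < e\<close> unfolding uniformly_continuous_on_def dist_real_def
    by (metis half_gt_zero)
  have "((\<lambda>r. (1 - r) * norm (q - p)) \<longlongrightarrow> (1 - 1) * norm (q - p)) (at_left 1)"
    by (intro tendsto_intros)
  then have "\<forall>\<^sub>F r in at_left 1. (1 - r) * norm (q - p) < d / 2"
    using d by (intro order_tendstoD(2)[where a="d/2"]) auto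
  moreover have "\<forall>\<^sub>F r in at_left (1::real). 0 < r \<and> r < 1"
    by (auto simp: eventually_at_left_field intro!: exI[of _ 0])
  ultimately show ?thesis
  proof (eventually_elim, intro allI impI)
    fix r \<eta> \<delta>
    assume small: "(1 - r) * norm (q - p) < d / 2" and r: "0 < r \<and> r < 1" and cut: "cutoff r \<eta> \<delta>"
    define h where "h y = indicator (box p q) y * g y * \<eta> y" for y
    have \<eta>: "smooth \<eta>" "\<And>y. 0 \<le> \<eta> y" "\<And>y. \<eta> y \<le> 1" "0 < \<delta>"
      "\<And>z y. z \<in> cbox p q \<Longrightarrow> dist y (dil r z) < \<delta> \<Longrightarrow> \<eta> y = 1"
      using cut unfolding cutoff_def by auto
    have \<eta>0: "\<eta> y = 0" if "y \<notin> box p q" for y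
      using cut that unfolding cutoff_def compact_support_def by blast
    define D where "D = cbox (p - q) (q - p)"
    define m where "m = measure lborel D"
    have m: "0 \<le> m" by (simp add: m_def)
    define e' where "e' = e / (4 * M * (m + 1))"
    have e': "0 < e'" using M m \<open>0 < e\<close> by (simp add: e'_def)
    define \<delta>' where "\<delta>' = min \<delta> (d / 2)"
    have "0 < \<delta>'" using \<eta> d by (simp add: \<delta>'_def)
    have [measurable]: "\<eta> \<in> borel_measurable borel"
      by (intro borel_measurable_continuous_onI smooth_continuous_on \<eta>)
    have "(\<lambda>y. indicator (box p q) y *\<^sub>R g y) \<in> borel_measurable borel"
      by (intro borel_measurable_continuous_on_indicator continuous_on_subset[OF g box_subset_cbox]) auto
    then have [measurable]: "h \<in> borel_measurable borel" unfolding h_def by simp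
    have hM: "\<bar>h y\<bar> \<le> M * indicator (box p q) y" for y
    proof (cases "y \<in> box p q")
      case True
      then have "\<bar>g y\<bar> * \<bar>\<eta> y\<bar> \<le> M * 1"
        using M(1) M(2)[of y] subsetD[OF box_subset_cbox True] \<eta>(2,3)[of y]
        by (intro mult_mono) auto
      then show ?thesis using True by (simp add: h_def abs_mult)
    qed (simp add: h_def)
    have hint: "integrable lborel h"
      by (rule Bochner_Integration.integrable_bound[where f="\<lambda>y. M * indicator (box p q) y"])
         (use hM M in \<open>auto intro!: AE_I2 integrable_mult_right integrable_real_indicator
            simp: emeasure_lborel_box_finite[unfolded infinity_ennreal_def]\<close>)
    show "\<forall>\<^sub>F n in sequentially. \<forall>z\<in>cbox p q.
      \<bar>mollify n (\<lambda>y. indicator (box p q) y * g y * \<eta> y) (dil r z) - g z\<bar> \<le> e"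
      using K_tail[OF \<open>0 < \<delta>'\<close> e']
    proof (eventually_elim, intro ballI)
      fix n z
      assume n: "\<forall>s\<in>cbox (p - q) (q - p). \<delta>' \<le> norm s \<longrightarrow> ridge exp (K n) s \<le> e'" and z: "z \<in> cbox p q"
      define x where "x = dil r z"
      note k = integral_lborel_reflect[OF kern_integrable[of n], of x]
      have Dint: "integrable lborel (indicator D :: _ \<Rightarrow> real)"
        by (simp add: D_def emeasure_lborel_cbox_finite[unfolded infinity_ennreal_def])
      note D = integral_lborel_reflect[OF Dint, of x]
      have diff: "mollify n h x - g z = (LINT y|lborel. h y * kern n (x - y) - g z * kern n (x - y))"
        using integrable_mult_kern[OF hint] k kern_int[of n] by (simp add: mollify_def)
      \<comment> \<open>Near \<open>x\<close> the oscillation of \<open>g\<close> is small, away from \<open>x\<close> the kernel is.\<close>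
      have bound: "\<bar>h y * kern n (x - y) - g z * kern n (x - y)\<bar>
          \<le> e/2 * kern n (x - y) + 2 * M * e' * indicator D (x - y)" for y
      proof (cases "dist y x < \<delta>'")
        case True
        then have \<eta>1: "\<eta> y = 1" using \<eta>(5)[OF z] by (simp add: x_def \<delta>'_def)
        then have y: "y \<in> box p q" by (metis \<eta>0 zero_neq_one)
        have "dist y z < d"
          using dist_triangle[of y z x] True dist_dil_le[OF z, of r] small r by (simp add: x_def \<delta>'_def)
        then have "\<bar>h y - g z\<bar> \<le> e/2"
          using d(2)[OF subsetD[OF box_subset_cbox y] z] y \<eta>1 by (simp add: h_def)
        then have "\<bar>h y - g z\<bar> * kern n (x - y) \<le> e/2 * kern n (x - y)"
          by (rule mult_right_mono) (rule kern_nonneg)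
        moreover have "\<bar>h y * kern n (x - y) - g z * kern n (x - y)\<bar> = \<bar>h y - g z\<bar> * kern n (x - y)"
          using kern_nonneg by (simp add: abs_mult flip: left_diff_distrib)
        moreover have "0 \<le> 2 * M * e' * indicator D (x - y)" using M e' by simp
        ultimately show ?thesis by linarith
      next
        case False
        have "\<bar>h y - g z\<bar> \<le> 2 * M"
          using hM[of y] M(2)[OF z] M(1) by (cases "y \<in> box p q") auto
        moreover have "kern n (x - y) \<le> e' * indicator D (x - y)"
          using n False by (auto simp: kern_def D_def indicator_def dist_norm norm_minus_commute)
        ultimately have "\<bar>h y - g z\<bar> * kern n (x - y) \<le> 2 * M * (e' * indicator D (x - y))"
          using kern_nonneg by (intro mult_mono) auto
        moreover have "\<bar>h y * kern n (x - y) - g z * kern n (x - y)\<bar> = \<bar>h y - g z\<bar> * kern n (x - y)"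
          using kern_nonneg by (simp add: abs_mult flip: left_diff_distrib)
        moreover have "0 \<le> e/2 * kern n (x - y)" using \<open>0 < e\<close> kern_nonneg by simp
        ultimately show ?thesis by (simp add: mult.assoc)
      qed
      have "\<bar>mollify n h x - g z\<bar> \<le> (LINT y|lborel. e/2 * kern n (x - y) + 2 * M * e' * indicator D (x - y))"
        unfolding diff
        by (intro order_trans[OF integral_abs_bound] integral_mono bound integrable_abs
            Bochner_Integration.integrable_diff Bochner_Integration.integrable_add integrable_mult_right
            integrable_mult_kern hint k D)
      also have "\<dots> = e/2 * 1 + 2 * M * e' * m"
        using k D kern_int[of n] by (simp add: m_def D_def)
      also have "\<dots> \<le> e"
      proof -
        have "2 * M * e' * m = (e / 2) * (m / (m + 1))"
        proof -
          define N where "N = m + 1"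
          have "N \<noteq> 0" "M \<noteq> 0" using M(1) m by (auto simp: N_def)
          then have "2 * M * (e / (4 * M * N)) * m = (e / 2) * (m / N)" by simp
          then show ?thesis by (simp only: e'_def N_def)
        qed
        also have "\<dots> \<le> (e / 2) * 1"
          using m \<open>0 < e\<close> by (intro mult_left_mono) (auto simp: divide_le_eq)
        finally show ?thesis by simp
      qed
      finally show "\<bar>mollify n (\<lambda>y. indicator (box p q) y * g y * \<eta> y) (dil r z) - g z\<bar> \<le> e"
        by (simp add: h_def[abs_def] x_def)
    qed
  qed
qed

end

lemma integrable_abs_bound:
  fixes f g :: "'a \<Rightarrow> real"
  assumes "integrable M f" "g \<in> borel_measurable M" "\<And>x. \<bar>g x\<bar> \<le> f x"
  shows "integrable M g"
  by (rule Bochner_Integration.integrable_bound[OF assms(1,2)])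
     (use assms(3) in \<open>auto intro: order_trans[OF _ abs_ge_self]\<close>)

context approx_kernel begin

lemma mollify_measurable:
  assumes [measurable]: "h \<in> borel_measurable borel"
  shows "(\<lambda>z. mollify n h (dil r z)) \<in> borel_measurable borel"
  unfolding mollify_def dil_def by measurable

lemma mollify_square_integrable:
  assumes [measurable]: "h \<in> borel_measurable borel" and h2: "integrable lborel (\<lambda>y. (h y)\<^sup>2)" and "0 < r"
  shows "integrable lborel (\<lambda>z. (mollify n h (dil r z))\<^sup>2)"
    and "(LINT z|lborel. (mollify n h (dil r z))\<^sup>2) \<le> (LINT y|lborel. (h y)\<^sup>2) / r\<^sup>2"
proof -
  note [measurable] = mollify_measurable[OF assms(1), of n r]
  obtain B where B: "\<And>s. kern n s \<le> B" using kern_bounded[of n] by blast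
  have DIM: "DIM(real \<times> real) = 2" by simp
  have I: "0 \<le> (LINT y|lborel. (h y)\<^sup>2) / r\<^sup>2" by simp
  have bound: "(\<integral>\<^sup>+z. ennreal ((mollify n h (dil r z))\<^sup>2) \<partial>lborel) \<le> ennreal ((LINT y|lborel. (h y)\<^sup>2) / r\<^sup>2)"
    using convolution_L2_bound[where t="((1 - r) / 2) *\<^sub>R (p + q)",
        OF assms(1) h2 kern_integrable[of n] kern_int kern_nonneg B \<open>0 < r\<close>]
    unfolding DIM by (simp add: mollify_def dil_def)
  show int: "integrable lborel (\<lambda>z. (mollify n h (dil r z))\<^sup>2)"
    by (rule integrableI_bounded) (use bound in \<open>auto intro: le_less_trans\<close>)
  show "(LINT z|lborel. (mollify n h (dil r z))\<^sup>2) \<le> (LINT y|lborel. (h y)\<^sup>2) / r\<^sup>2"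
    using bound nn_integral_eq_integral[OF int] I by simp
qed

lemma indicator_box_integrable: "integrable lborel (\<lambda>z. indicator (box p q) z * (c::real))"
  by (simp add: emeasure_lborel_box_finite[unfolded infinity_ennreal_def])

lemma integrable_if_square_integrable:
  fixes h :: "real \<times> real \<Rightarrow> real"
  assumes [measurable]: "h \<in> borel_measurable borel" and h2: "integrable lborel (\<lambda>y. (h y)\<^sup>2)"
    and out: "\<And>y. y \<notin> box p q \<Longrightarrow> h y = 0"
  shows "integrable lborel h"
proof (rule integrable_abs_bound[OF Bochner_Integration.integrable_add[OF h2 indicator_box_integrable[of 1]]])
  show "\<bar>h y\<bar> \<le> (h y)\<^sup>2 + indicator (box p q) y * 1" for y
  proof (cases "y \<in> box p q")
    case True
    have "(\<bar>h y\<bar> - 1/2)\<^sup>2 = (h y)\<^sup>2 - \<bar>h y\<bar> + 1/4"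
      by (simp add: power2_diff power2_eq_square[of "1/2"])
    then show ?thesis using zero_le_power2[of "\<bar>h y\<bar> - 1/2"] True by simp
  qed (simp add: out)
qed auto

lemma four_term_square_bound:
  fixes a b c d :: real
  shows "(a + b + c + d)\<^sup>2 \<le> 4 * (a\<^sup>2 + b\<^sup>2 + c\<^sup>2 + d\<^sup>2)"
proof -
  have "4 * (a\<^sup>2 + b\<^sup>2 + c\<^sup>2 + d\<^sup>2) - (a + b + c + d)\<^sup>2
      = (a - b)\<^sup>2 + (a - c)\<^sup>2 + (a - d)\<^sup>2 + (b - c)\<^sup>2 + (b - d)\<^sup>2 + (c - d)\<^sup>2"
    by (simp add: power2_eq_square algebra_simps)
  then show ?thesis by (smt (verit) zero_le_power2)
qed

text \<open>Approximate \<open>w\<close> in \<open>L\<^sup>2\<close> by a continuous function: mollification enlarges the \<open>L\<^sup>2\<close> norm of the error at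
  most by the factor \<open>1/r\<close> and converges uniformly for the continuous function.  The factor
  \<open>r ^ m\<close> is what the chain rule produces when the contraction is differentiated \<open>m\<close> times.\<close>

lemma mollify_L2:
  assumes [measurable]: "w \<in> borel_measurable borel" and w2: "integrable lborel (\<lambda>z. (w z)\<^sup>2)"
    and out: "\<And>z. z \<notin> box p q \<Longrightarrow> w z = 0" and "0 < e"
  shows "\<forall>\<^sub>F r in at_left 1. \<forall>\<eta> \<delta>. cutoff r \<eta> \<delta> \<longrightarrow> (\<forall>\<^sub>F n in sequentially.
    integrable lborel (\<lambda>z. indicator (box p q) z * (r ^ m * mollify n (\<lambda>y. w y * \<eta> y) (dil r z) - w z)\<^sup>2) \<and>
    (LINT z|lborel. indicator (box p q) z * (r ^ m * mollify n (\<lambda>y. w y * \<eta> y) (dil r z) - w z)\<^sup>2) \<le> e)"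
proof -
  define A where "A = measure lborel (box p q)"
  have A: "0 \<le> A" by (simp add: A_def)
  \<comment> \<open>The squared error is bounded by four times the sum of four squares; the shares of \<open>e\<close> are chosen so that
    the contributions \<open>16 e/40\<close>, \<open>e/4\<close>, \<open>e/4\<close> and \<open>4 e/40\<close> add up to \<open>e\<close>.\<close>
  obtain g where g: "continuous_on UNIV g"
    and gint: "integrable lborel (\<lambda>y. indicator (box p q) y * (w y - g y)\<^sup>2)"
    and gle: "(LINT y|lborel. indicator (box p q) y * (w y - g y)\<^sup>2) \<le> e / 40"
    using L2_approx_continuous[OF assms(1) w2, of "e / 40" "box p q"] \<open>0 < e\<close>
      emeasure_lborel_box_finite by auto
  have [measurable]: "g \<in> borel_measurable borel" by (rule borel_measurable_continuous_onI[OF g])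
  have gc: "continuous_on (cbox p q) g" using g continuous_on_subset by blast
  obtain M where M: "0 < M" "\<And>z. z \<in> cbox p q \<Longrightarrow> \<bar>g z\<bar> \<le> M"
    using compact_imp_bounded[OF compact_continuous_image[OF gc compact_cbox]]
    by (auto simp: bounded_pos)
  define e2 where "e2 = sqrt (e / (16 * (A + 1)))"
  have "0 < e2" using A \<open>0 < e\<close> by (simp add: e2_def)
  have e2: "4 * (e2\<^sup>2 * A) \<le> e / 4"
  proof -
    have "e2\<^sup>2 = e / (16 * (A + 1))" using A \<open>0 < e\<close> by (simp add: e2_def)
    moreover have "e * A \<le> e * (A + 1)" using \<open>0 < e\<close> by simp
    ultimately show ?thesis using A \<open>0 < e\<close> by (simp add: divide_le_eq)
  qed
  have "((\<lambda>r. 4 * ((r ^ m - 1)\<^sup>2 * (M\<^sup>2 * A))) \<longlongrightarrow> 4 * ((1 ^ m - 1)\<^sup>2 * (M\<^sup>2 * A))) (at_left 1)"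
    by (intro tendsto_intros)
  then have "\<forall>\<^sub>F r in at_left 1. 4 * ((r ^ m - 1)\<^sup>2 * (M\<^sup>2 * A)) < e / 4"
    using \<open>0 < e\<close> by (intro order_tendstoD(2)[where a="e/4"]) auto
  moreover have "\<forall>\<^sub>F r in at_left (1::real). 1/2 < r \<and> r < 1"
    by (auto simp: eventually_at_left_field intro!: exI[of _ "1/2"])
  ultimately show ?thesis
    using mollify_uniform[OF gc \<open>0 < e2\<close>]
  proof (eventually_elim, intro allI impI)
    fix r \<eta> \<delta>
    assume r1: "4 * ((r ^ m - 1)\<^sup>2 * (M\<^sup>2 * A)) < e / 4" and r: "1/2 < r \<and> r < 1"
      and unif: "\<forall>\<eta> \<delta>. cutoff r \<eta> \<delta> \<longrightarrow> (\<forall>\<^sub>F n in sequentially. \<forall>z\<in>cbox p q.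
        \<bar>mollify n (\<lambda>y. indicator (box p q) y * g y * \<eta> y) (dil r z) - g z\<bar> \<le> e2)"
      and cut: "cutoff r \<eta> \<delta>"
    have \<eta>: "smooth \<eta>" "\<And>y. 0 \<le> \<eta> y" "\<And>y. \<eta> y \<le> 1"
      using cut unfolding cutoff_def by auto
    have [measurable]: "\<eta> \<in> borel_measurable borel"
      by (intro borel_measurable_continuous_onI smooth_continuous_on \<eta>)
    define h1 where "h1 y = (w y - indicator (box p q) y * g y) * \<eta> y" for y
    define h2 where "h2 y = indicator (box p q) y * g y * \<eta> y" for y
    have [measurable]: "h1 \<in> borel_measurable borel" "h2 \<in> borel_measurable borel"
      unfolding h1_def h2_def by measurable
    have h1le: "(h1 y)\<^sup>2 \<le> indicator (box p q) y * (w y - g y)\<^sup>2" for y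
    proof (cases "y \<in> box p q")
      case True
      have "(h1 y)\<^sup>2 = (w y - g y)\<^sup>2 * (\<eta> y)\<^sup>2" using True by (simp add: h1_def power_mult_distrib)
      also have "\<dots> \<le> (w y - g y)\<^sup>2 * 1" using \<eta> by (intro mult_left_mono power_le_one) auto
      finally show ?thesis using True by simp
    qed (simp add: h1_def out)
    have h1sq: "integrable lborel (\<lambda>y. (h1 y)\<^sup>2)"
      by (rule integrable_abs_bound[OF gint]) (simp_all add: h1le)
    have h1out: "h1 y = 0" "h2 y = 0" if "y \<notin> box p q" for y using that by (auto simp: h1_def h2_def out)
    have h1int: "integrable lborel h1"
      by (rule integrable_if_square_integrable[OF _ h1sq h1out(1)]) auto
    have h2le: "\<bar>h2 y\<bar> \<le> indicator (box p q) y * M" for y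
    proof (cases "y \<in> box p q")
      case True
      then have "\<bar>g y\<bar> * \<bar>\<eta> y\<bar> \<le> M * 1"
        using M(1) M(2)[OF subsetD[OF box_subset_cbox True]] \<eta>(2,3)[of y] by (intro mult_mono) auto
      then show ?thesis using True by (simp add: h2_def abs_mult)
    qed (simp add: h2_def)
    have h2int: "integrable lborel h2"
      by (rule integrable_abs_bound[OF indicator_box_integrable[of M] _ h2le]) simp
    have split: "mollify n (\<lambda>y. w y * \<eta> y) x = mollify n h1 x + mollify n h2 x" for n x
    proof -
      have "(\<lambda>y. w y * \<eta> y) = (\<lambda>y. h1 y + h2 y)" by (auto simp: h1_def h2_def algebra_simps)
      then show ?thesis using mollify_add[OF h1int h2int] by simp
    qed
    note [measurable] = mollify_measurable[of h1] mollify_measurable[of h2]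
    from unif cut have "\<forall>\<^sub>F n in sequentially. \<forall>z\<in>cbox p q. \<bar>mollify n h2 (dil r z) - g z\<bar> \<le> e2"
      unfolding h2_def by blast
    then show "\<forall>\<^sub>F n in sequentially.
      integrable lborel (\<lambda>z. indicator (box p q) z * (r ^ m * mollify n (\<lambda>y. w y * \<eta> y) (dil r z) - w z)\<^sup>2) \<and>
      (LINT z|lborel. indicator (box p q) z * (r ^ m * mollify n (\<lambda>y. w y * \<eta> y) (dil r z) - w z)\<^sup>2) \<le> e"
    proof eventually_elim
      fix n assume n: "\<forall>z\<in>cbox p q. \<bar>mollify n h2 (dil r z) - g z\<bar> \<le> e2"
      define F where "F z = indicator (box p q) z * (r ^ m * mollify n (\<lambda>y. w y * \<eta> y) (dil r z) - w z)\<^sup>2" for z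
      define G where "G z = 4 * (mollify n h1 (dil r z))\<^sup>2
        + indicator (box p q) z * (4 * e2\<^sup>2 + 4 * ((r ^ m - 1)\<^sup>2 * M\<^sup>2))
        + 4 * (indicator (box p q) z * (w z - g z)\<^sup>2)" for z
      have [measurable]: "F \<in> borel_measurable borel" unfolding F_def split by measurable
      note sq = mollify_square_integrable[OF _ h1sq, of r n]
      have G: "integrable lborel G"
        unfolding G_def using sq(1) r gint indicator_box_integrable
        by (intro Bochner_Integration.integrable_add integrable_mult_right) auto
      have rm: "0 \<le> r ^ m" "r ^ m \<le> 1" using r by (auto intro: power_le_one)
      have FG: "F z \<le> G z" for z
      proof (cases "z \<in> box p q")
        case True
        then have z: "z \<in> cbox p q" using box_subset_cbox by blast
        have "F z = (r ^ m * mollify n (\<lambda>y. w y * \<eta> y) (dil r z) - w z)\<^sup>2"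
          using True by (simp add: F_def)
        also have "\<dots> = (r ^ m * mollify n h1 (dil r z) + r ^ m * (mollify n h2 (dil r z) - g z)
            + (r ^ m - 1) * g z + (g z - w z))\<^sup>2"
          unfolding split by (simp add: algebra_simps)
        also have "\<dots> \<le> 4 * ((r ^ m * mollify n h1 (dil r z))\<^sup>2 + (r ^ m * (mollify n h2 (dil r z) - g z))\<^sup>2
            + ((r ^ m - 1) * g z)\<^sup>2 + (g z - w z)\<^sup>2)"
          by (rule four_term_square_bound)
        also have "\<dots> \<le> 4 * ((mollify n h1 (dil r z))\<^sup>2 + e2\<^sup>2 + (r ^ m - 1)\<^sup>2 * M\<^sup>2 + (w z - g z)\<^sup>2)"
        proof -
          have "(r ^ m * mollify n h1 (dil r z))\<^sup>2 \<le> (mollify n h1 (dil r z))\<^sup>2"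
            using rm by (intro abs_le_square_iff[THEN iffD1]) (simp add: abs_mult mult_left_le_one_le)
          moreover have "(r ^ m * (mollify n h2 (dil r z) - g z))\<^sup>2 \<le> e2\<^sup>2"
          proof (rule abs_le_square_iff[THEN iffD1])
            have "r ^ m * \<bar>mollify n h2 (dil r z) - g z\<bar> \<le> 1 * e2"
              using rm n z by (intro mult_mono) auto
            then show "\<bar>r ^ m * (mollify n h2 (dil r z) - g z)\<bar> \<le> \<bar>e2\<bar>" using rm by (simp add: abs_mult)
          qed
          moreover have "((r ^ m - 1) * g z)\<^sup>2 \<le> (r ^ m - 1)\<^sup>2 * M\<^sup>2"
            unfolding power_mult_distrib using M(1) M(2)[OF z]
            by (intro mult_left_mono abs_le_square_iff[THEN iffD1]) auto
          ultimately show ?thesis by (simp add: power2_commute[of "g z"])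
        qed
        finally show ?thesis using True by (simp add: G_def)
      qed (simp add: F_def G_def)
      have F: "integrable lborel F"
      proof (rule integrable_abs_bound[OF G])
        show "\<bar>F z\<bar> \<le> G z" for z
        proof -
          have "0 \<le> F z" by (simp add: F_def)
          then show ?thesis using FG[of z] by simp
        qed
      qed simp
      have "(LINT z|lborel. F z) \<le> (LINT z|lborel. G z)" by (rule integral_mono[OF F G FG])
      also have "\<dots> = 4 * (LINT z|lborel. (mollify n h1 (dil r z))\<^sup>2)
          + A * (4 * e2\<^sup>2 + 4 * ((r ^ m - 1)\<^sup>2 * M\<^sup>2)) + 4 * (LINT z|lborel. indicator (box p q) z * (w z - g z)\<^sup>2)"
        unfolding G_def A_def using sq(1) r gint indicator_box_integrable by simp
      also have "\<dots> \<le> 4 * (4 * (e / 40)) + (e / 4 + e / 4) + 4 * (e / 40)"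
      proof -
        have "(LINT z|lborel. (mollify n h1 (dil r z))\<^sup>2) \<le> (LINT y|lborel. (h1 y)\<^sup>2) / r\<^sup>2"
          using sq(2) r by auto
        also have "\<dots> \<le> (e / 40) / (1/2)\<^sup>2"
        proof (rule frac_le)
          show "(LINT y|lborel. (h1 y)\<^sup>2) \<le> e / 40"
            using integral_mono[OF h1sq gint h1le] gle by simp
          show "(1/2)\<^sup>2 \<le> r\<^sup>2" using r by (intro power_mono) auto
        qed (use \<open>0 < e\<close> in auto)
        finally have "(LINT z|lborel. (mollify n h1 (dil r z))\<^sup>2) \<le> 4 * (e / 40)" by (simp add: power2_eq_square)
        moreover have "A * (4 * e2\<^sup>2 + 4 * ((r ^ m - 1)\<^sup>2 * M\<^sup>2)) \<le> e / 4 + e / 4"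
          using e2 r1 by (simp add: algebra_simps)
        ultimately show ?thesis using gle by linarith
      qed
      also have "\<dots> = e" by simp
      finally show "integrable lborel (\<lambda>z. indicator (box p q) z * (r ^ m * mollify n (\<lambda>y. w y * \<eta> y) (dil r z) - w z)\<^sup>2) \<and>
        (LINT z|lborel. indicator (box p q) z * (r ^ m * mollify n (\<lambda>y. w y * \<eta> y) (dil r z) - w z)\<^sup>2) \<le> e"
        using F by (simp add: F_def[abs_def])
    qed
  qed
qed

end

section \<open>Approximation by exponential sums\<close>

lemma smooth_ridge_exp: "smooth (ridge exp xs)"
proof (induction xs)
  case Nil
  have "ridge exp [] = (\<lambda>z. 0)" by (simp add: fun_eq_iff)
  then show ?case by (simp add: smooth_const)
next
  case (Cons x xs)
  obtain c \<alpha> \<beta> \<gamma> where x: "x = (c, \<alpha>, \<beta>, \<gamma>)" by (cases x) auto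
  have "smooth (\<lambda>z::real\<times>real. \<alpha> * fst z + \<beta> * snd z + \<gamma>)"
    by (intro smooth_add smooth_const smooth_linear bounded_linear_const_mult bounded_linear_fst bounded_linear_snd)
  from smooth_add[OF smooth_mult[OF smooth_const smooth_compose[OF smooth_exp this]] Cons]
  have "smooth (\<lambda>z. c * exp (\<alpha> * fst z + \<beta> * snd z + \<gamma>) + ridge exp xs z)" .
  moreover have "ridge exp (x # xs) = (\<lambda>z. c * exp (\<alpha> * fst z + \<beta> * snd z + \<gamma>) + ridge exp xs z)"
    by (simp add: x fun_eq_iff)
  ultimately show ?case by simp
qed

text \<open>As a function of the integration variable the kernel is again an exponential sum, with the signs
  of its derivatives reversed.\<close>

lemma reflected_ridge_exp:
  shows "smooth (\<lambda>y. ridge exp xs (x - y))"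
    and "d_x (\<lambda>y. ridge exp xs (x - y)) = (\<lambda>y. - ridge exp (ridge_dx xs) (x - y))"
    and "d_t (\<lambda>y. ridge exp xs (x - y)) = (\<lambda>y. - ridge exp (ridge_dt xs) (x - y))"
proof -
  define ys where "ys = map (\<lambda>(c, \<alpha>, \<beta>, \<gamma>). (c, - \<alpha>, - \<beta>, \<gamma> + \<alpha> * fst x + \<beta> * snd x)) xs"
  have 0: "ridge exp ys y = ridge exp xs (x - y)" for y
    unfolding ys_def by (induction xs) (auto simp: algebra_simps)
  have 1: "ridge exp (ridge_dx ys) y = - ridge exp (ridge_dx xs) (x - y)" for y
    unfolding ys_def by (induction xs) (auto simp: algebra_simps)
  have 2: "ridge exp (ridge_dt ys) y = - ridge exp (ridge_dt xs) (x - y)" for y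
    unfolding ys_def by (induction xs) (auto simp: algebra_simps)
  have eq: "(\<lambda>y. ridge exp xs (x - y)) = ridge exp ys" by (simp add: 0 fun_eq_iff)
  show "smooth (\<lambda>y. ridge exp xs (x - y))" unfolding eq by (rule smooth_ridge_exp)
  show "d_x (\<lambda>y. ridge exp xs (x - y)) = (\<lambda>y. - ridge exp (ridge_dx xs) (x - y))"
    "d_t (\<lambda>y. ridge exp xs (x - y)) = (\<lambda>y. - ridge exp (ridge_dt xs) (x - y))"
    unfolding eq ridge_partial_deriv[OF DERIV_exp] by (simp_all add: 1 2 fun_eq_iff)
qed

context approx_kernel begin

lemma integrable_mult_continuous:
  assumes h: "integrable lborel h" and out: "\<And>y. y \<notin> box p q \<Longrightarrow> h y = 0" and \<psi>: "continuous_on UNIV \<psi>"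
  shows "integrable lborel (\<lambda>y. h y * (\<psi> y :: real))"
proof -
  have [measurable]: "\<psi> \<in> borel_measurable borel" by (rule borel_measurable_continuous_onI[OF \<psi>])
  have [measurable]: "h \<in> borel_measurable borel" using h by auto
  have "bounded (\<psi> ` cbox p q)"
    by (intro compact_imp_bounded compact_continuous_image continuous_on_subset[OF \<psi>] compact_cbox) auto
  then obtain B where B: "\<And>y. y \<in> cbox p q \<Longrightarrow> \<bar>\<psi> y\<bar> \<le> B" by (auto simp: bounded_iff)
  show ?thesis
  proof (rule integrable_abs_bound[OF integrable_mult_right[OF integrable_abs[OF h], of B]])
    show "\<bar>h y * \<psi> y\<bar> \<le> B * \<bar>h y\<bar>" for y
    proof (cases "y \<in> box p q")
      case True
      then show ?thesis
        using mult_left_mono[OF B[OF subsetD[OF box_subset_cbox True]], of "\<bar>h y\<bar>"] by (simp add: abs_mult mult.commute)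
    qed (simp add: out)
  qed auto
qed

text \<open>The convolution of \<open>h\<close> with an exponential sum, followed by the contraction, is again an
  exponential sum.\<close>

definition conv :: "real \<Rightarrow> (real \<times> real \<Rightarrow> real) \<Rightarrow> (real \<times> real \<times> real \<times> real) list
    \<Rightarrow> (real \<times> real \<times> real \<times> real) list" where
  "conv r h = map (\<lambda>(c, \<alpha>, \<beta>, \<gamma>). (c * (LINT y|lborel. h y *
     exp (\<alpha> * (fst (dil r 0) - fst y) + \<beta> * (snd (dil r 0) - snd y) + \<gamma>)), r * \<alpha>, r * \<beta>, 0))"

lemma conv_Nil [simp]: "conv r h [] = []"
  and conv_Cons [simp]: "conv r h ((c, \<alpha>, \<beta>, \<gamma>) # xs) = (c * (LINT y|lborel. h y *
     exp (\<alpha> * (fst (dil r 0) - fst y) + \<beta> * (snd (dil r 0) - snd y) + \<gamma>)), r * \<alpha>, r * \<beta>, 0) # conv r h xs"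
  by (simp_all add: conv_def)

lemma ridge_conv:
  assumes h: "integrable lborel h" "\<And>y. y \<notin> box p q \<Longrightarrow> h y = 0"
  shows "ridge exp (conv r h xs) z = (LINT y|lborel. h y * ridge exp xs (dil r z - y))"
proof (induction xs)
  case (Cons x xs)
  obtain c \<alpha> \<beta> \<gamma> where x: "x = (c, \<alpha>, \<beta>, \<gamma>)" by (cases x) auto
  let ?E = "\<lambda>y. exp (\<alpha> * (fst (dil r 0) - fst y) + \<beta> * (snd (dil r 0) - snd y) + \<gamma>)"
  have eq: "h y * ridge exp (x # xs) (dil r z - y)
      = c * exp (r * \<alpha> * fst z + r * \<beta> * snd z) * (h y * ?E y) + h y * ridge exp xs (dil r z - y)" for y
    by (simp add: x dil_def algebra_simps flip: exp_add)
  have 1: "integrable lborel (\<lambda>y. h y * ?E y)"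
    by (rule integrable_mult_continuous[OF h]) (auto intro!: continuous_intros)
  have 2: "integrable lborel (\<lambda>y. h y * ridge exp xs (dil r z - y))"
    by (rule integrable_mult_continuous[OF h]) (simp, rule smooth_continuous_on[OF reflected_ridge_exp(1)])
  show ?case
    unfolding eq using 1 2 Cons by (simp add: x)
qed simp

lemma ridge_dx_conv: "ridge exp (ridge_dx (conv r h xs)) z = r * ridge exp (conv r h (ridge_dx xs)) z"
  and ridge_dt_conv: "ridge exp (ridge_dt (conv r h xs)) z = r * ridge exp (conv r h (ridge_dt xs)) z"
  and ridge_dxx_conv: "ridge exp (ridge_dx (ridge_dx (conv r h xs))) z
    = r\<^sup>2 * ridge exp (conv r h (ridge_dx (ridge_dx xs))) z"
  by (induction xs) (auto simp: algebra_simps power2_eq_square)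

lemma mollify_eq:
  assumes "\<And>y. y \<notin> box p q \<Longrightarrow> h y = 0" "0 \<le> r" "r \<le> 1" "z \<in> cbox p q"
  shows "mollify n h (dil r z) = (LINT y|lborel. h y * ridge exp (K n) (dil r z - y))"
  unfolding mollify_def
proof (rule Bochner_Integration.integral_cong)
  fix y
  show "h y * kern n (dil r z - y) = h y * ridge exp (K n) (dil r z - y)"
    using diff_in_cbox[OF dil_in_cbox[OF assms(2-4)] subsetD[OF box_subset_cbox]] assms(1)
    by (cases "y \<in> box p q") (auto simp: kern_def)
qed simp

lemma compact_support_partial_deriv:
  assumes "compact_support \<eta>"
  shows "compact_support (partial_deriv e \<eta>)"
proof -
  obtain p' q' where sub: "cbox p' q' \<subseteq> box p q" and out: "\<And>y. y \<notin> cbox p' q' \<Longrightarrow> \<eta> y = 0"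
    using assms unfolding compact_support_def by blast
  have "partial_deriv e \<eta> y = 0" if "y \<notin> cbox p' q'" for y
    by (rule partial_deriv_eq_0_if_const_on_open[of "- cbox p' q'"])
       (use that out in \<open>auto intro: closed_cbox\<close>)
  with sub show ?thesis unfolding compact_support_def by blast
qed

lemma test_function_mult:
  assumes "smooth \<eta>" "compact_support \<eta>" "smooth \<psi>"
  shows "test_function (box p q) (\<lambda>y. \<eta> y * \<psi> y)"
proof -
  obtain p' q' where "cbox p' q' \<subseteq> box p q" "\<And>y. y \<notin> cbox p' q' \<Longrightarrow> \<eta> y = 0"
    using assms(2) unfolding compact_support_def by blast
  then show ?thesis
    by (intro test_functionI[OF smooth_mult[OF assms(1,3)], of p' q']) auto
qed

text \<open>The kernel is not compactly supported, so it is the product with the cutoff that is inserted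
  into the definition of the weak derivative.\<close>

lemma integration_by_parts_x:
  assumes u: "integrable lborel u" "\<And>y. y \<notin> box p q \<Longrightarrow> u y = 0"
    and weak: "\<And>\<phi>. test_function (box p q) \<phi> \<Longrightarrow>
      (LINT y|lborel. u y * d_x \<phi> y) = - (LINT y|lborel. w y * \<phi> y)"
    and \<eta>: "smooth \<eta>" "compact_support \<eta>"
  shows "(LINT y|lborel. u y * \<eta> y * ridge exp (ridge_dx xs) (x - y))
    = (LINT y|lborel. w y * \<eta> y * ridge exp xs (x - y)) + (LINT y|lborel. u y * d_x \<eta> y * ridge exp xs (x - y))"
proof -
  note G = reflected_ridge_exp[of xs x]
  have d\<eta>: "smooth (d_x \<eta>)" using \<eta>(1) by (rule smooth_partial_deriv) (simp add: Basis_prod_def)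
  have "d_x (\<lambda>y. \<eta> y * ridge exp xs (x - y)) y
      = d_x \<eta> y * ridge exp xs (x - y) - \<eta> y * ridge exp (ridge_dx xs) (x - y)" for y
    by (subst partial_deriv_mult) (auto intro: smooth_differentiable \<eta> G simp: G(2))
  then have "- (LINT y|lborel. w y * (\<eta> y * ridge exp xs (x - y)))
      = (LINT y|lborel. u y * (d_x \<eta> y * ridge exp xs (x - y)) - u y * (\<eta> y * ridge exp (ridge_dx xs) (x - y)))"
    using weak[OF test_function_mult[OF \<eta> G(1)]] by (simp add: right_diff_distrib)
  also have "\<dots> = (LINT y|lborel. u y * (d_x \<eta> y * ridge exp xs (x - y)))
      - (LINT y|lborel. u y * (\<eta> y * ridge exp (ridge_dx xs) (x - y)))"
    by (intro Bochner_Integration.integral_diff integrable_mult_continuous[OF u] continuous_on_mult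
        smooth_continuous_on \<eta> d\<eta> reflected_ridge_exp(1))
  finally show ?thesis by (simp add: mult.assoc)
qed

lemma integration_by_parts_t:
  assumes u: "integrable lborel u" "\<And>y. y \<notin> box p q \<Longrightarrow> u y = 0"
    and weak: "\<And>\<phi>. test_function (box p q) \<phi> \<Longrightarrow>
      (LINT y|lborel. u y * d_t \<phi> y) = - (LINT y|lborel. w y * \<phi> y)"
    and \<eta>: "smooth \<eta>" "compact_support \<eta>"
  shows "(LINT y|lborel. u y * \<eta> y * ridge exp (ridge_dt xs) (x - y))
    = (LINT y|lborel. w y * \<eta> y * ridge exp xs (x - y)) + (LINT y|lborel. u y * d_t \<eta> y * ridge exp xs (x - y))"
proof -
  note G = reflected_ridge_exp[of xs x]
  have d\<eta>: "smooth (d_t \<eta>)" using \<eta>(1) by (rule smooth_partial_deriv) (simp add: Basis_prod_def)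
  have "d_t (\<lambda>y. \<eta> y * ridge exp xs (x - y)) y
      = d_t \<eta> y * ridge exp xs (x - y) - \<eta> y * ridge exp (ridge_dt xs) (x - y)" for y
    by (subst partial_deriv_mult) (auto intro: smooth_differentiable \<eta> G simp: G(3))
  then have "- (LINT y|lborel. w y * (\<eta> y * ridge exp xs (x - y)))
      = (LINT y|lborel. u y * (d_t \<eta> y * ridge exp xs (x - y)) - u y * (\<eta> y * ridge exp (ridge_dt xs) (x - y)))"
    using weak[OF test_function_mult[OF \<eta> G(1)]] by (simp add: right_diff_distrib)
  also have "\<dots> = (LINT y|lborel. u y * (d_t \<eta> y * ridge exp xs (x - y)))
      - (LINT y|lborel. u y * (\<eta> y * ridge exp (ridge_dt xs) (x - y)))"
    by (intro Bochner_Integration.integral_diff integrable_mult_continuous[OF u] continuous_on_mult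
        smooth_continuous_on \<eta> d\<eta> reflected_ridge_exp(1))
  finally show ?thesis by (simp add: mult.assoc)
qed

lemma integration_by_parts_xx:
  assumes u: "integrable lborel u" "\<And>y. y \<notin> box p q \<Longrightarrow> u y = 0"
    and weak: "\<And>\<phi>. test_function (box p q) \<phi> \<Longrightarrow>
      (LINT y|lborel. u y * d_x \<phi> y) = - (LINT y|lborel. w y * \<phi> y)"
    and weak2: "\<And>\<phi>. test_function (box p q) \<phi> \<Longrightarrow>
      (LINT y|lborel. u y * d_x (d_x \<phi>) y) = (LINT y|lborel. w2 y * \<phi> y)"
    and \<eta>: "smooth \<eta>" "compact_support \<eta>"
  shows "(LINT y|lborel. u y * \<eta> y * ridge exp (ridge_dx (ridge_dx xs)) (x - y))
    = (LINT y|lborel. w2 y * \<eta> y * ridge exp xs (x - y))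
      + 2 * (LINT y|lborel. w y * d_x \<eta> y * ridge exp xs (x - y))
      + (LINT y|lborel. u y * d_x (d_x \<eta>) y * ridge exp xs (x - y))"
proof -
  define G where "G xs = (\<lambda>y. ridge exp xs (x - y))" for xs
  have G: "smooth (G xs)" "d_x (G xs) = (\<lambda>y. - G (ridge_dx xs) y)" for xs
    unfolding G_def by (rule reflected_ridge_exp)+
  note diff = smooth_differentiable
  have d\<eta>: "smooth (d_x \<eta>)" "smooth (d_x (d_x \<eta>))"
    using \<eta>(1) by (auto intro!: smooth_partial_deriv simp: Basis_prod_def)
  have "d_x (\<lambda>y. \<eta> y * G xs y) = (\<lambda>y. d_x \<eta> y * G xs y + (- 1) * (\<eta> y * G (ridge_dx xs) y))"
    by (rule ext, subst partial_deriv_mult) (auto intro: diff \<eta> G simp: G(2))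
  moreover have "d_x (\<lambda>y. d_x \<eta> y * G xs y + (- 1) * (\<eta> y * G (ridge_dx xs) y)) y
     = d_x (d_x \<eta>) y * G xs y - 2 * (d_x \<eta> y * G (ridge_dx xs) y) + \<eta> y * G (ridge_dx (ridge_dx xs)) y" for y
    by (subst partial_deriv_add partial_deriv_mult;
        (intro diff smooth_mult smooth_const \<eta> d\<eta> G)?)+ (simp add: G(2))
  ultimately have "d_x (d_x (\<lambda>y. \<eta> y * G xs y)) y
      = d_x (d_x \<eta>) y * G xs y - 2 * (d_x \<eta> y * G (ridge_dx xs) y) + \<eta> y * G (ridge_dx (ridge_dx xs)) y" for y
    by simp
  note dd = this
  have "(LINT y|lborel. w2 y * (\<eta> y * G xs y)) = (LINT y|lborel. u y * d_x (d_x (\<lambda>y. \<eta> y * G xs y)) y)"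
    using weak2[OF test_function_mult[OF \<eta> G(1)[of xs]]] by simp
  also have "\<dots> = (LINT y|lborel. u y * (d_x (d_x \<eta>) y * G xs y) - 2 * (u y * (d_x \<eta> y * G (ridge_dx xs) y))
          + u y * (\<eta> y * G (ridge_dx (ridge_dx xs)) y))"
    unfolding dd by (rule Bochner_Integration.integral_cong) (auto simp: algebra_simps)
  also have "\<dots> = (LINT y|lborel. u y * (d_x (d_x \<eta>) y * G xs y)) - 2 * (LINT y|lborel. u y * (d_x \<eta> y * G (ridge_dx xs) y))
          + (LINT y|lborel. u y * (\<eta> y * G (ridge_dx (ridge_dx xs)) y))"
  proof -
    have i: "integrable lborel (\<lambda>y. u y * (\<zeta> y * G ys y))" if "smooth \<zeta>" for \<zeta> ys
      by (intro integrable_mult_continuous[OF u] continuous_on_mult smooth_continuous_on that G)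
    show ?thesis using i[OF \<eta>(1)] i[OF d\<eta>(1)] i[OF d\<eta>(2)] by simp
  qed
  finally show ?thesis
    using integration_by_parts_x[OF u weak d\<eta>(1) compact_support_partial_deriv[OF \<eta>(2)], of xs x]
    by (simp add: mult.assoc G_def)
qed

lemma square_error_add:
  assumes A: "integrable lborel (\<lambda>z. indicator (box p q) z * (A z - w z)\<^sup>2)"
      "(LINT z|lborel. indicator (box p q) z * (A z - w z)\<^sup>2) \<le> e / 4"
    and V: "\<And>z. z \<in> box p q \<Longrightarrow> V z = A z + E z" and E: "\<And>z. z \<in> box p q \<Longrightarrow> \<bar>E z\<bar> \<le> \<epsilon>"
    and \<epsilon>: "4 * (\<epsilon>\<^sup>2 * measure lborel (box p q)) \<le> e"
    and [measurable]: "V \<in> borel_measurable borel" "w \<in> borel_measurable borel"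
  shows "integrable lborel (\<lambda>z. indicator (box p q) z * (V z - w z)\<^sup>2)"
      "(LINT z|lborel. indicator (box p q) z * (V z - w z)\<^sup>2) \<le> e"
proof -
  let ?G = "\<lambda>z. 2 * (indicator (box p q) z * (A z - w z)\<^sup>2) + indicator (box p q) z * (2 * \<epsilon>\<^sup>2)"
  have G: "integrable lborel ?G" using A(1) indicator_box_integrable by simp
  have le: "indicator (box p q) z * (V z - w z)\<^sup>2 \<le> ?G z" for z
  proof (cases "z \<in> box p q")
    case True
    have "(x + y)\<^sup>2 \<le> 2 * x\<^sup>2 + 2 * y\<^sup>2" for x y :: real
      using sum_squares_bound[of x y] by (simp add: power2_sum)
    from this[of "A z - w z" "E z"]
    have "(V z - w z)\<^sup>2 \<le> 2 * (A z - w z)\<^sup>2 + 2 * (E z)\<^sup>2"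
      using V[OF True] by (simp add: algebra_simps)
    moreover have "(E z)\<^sup>2 \<le> \<epsilon>\<^sup>2"
      using E[OF True] by (intro abs_le_square_iff[THEN iffD1]) simp
    ultimately show ?thesis using True by simp
  qed simp
  show int: "integrable lborel (\<lambda>z. indicator (box p q) z * (V z - w z)\<^sup>2)"
    by (rule integrable_abs_bound[OF G]) (use le in \<open>auto simp: abs_mult\<close>)
  have "(LINT z|lborel. indicator (box p q) z * (V z - w z)\<^sup>2) \<le> (LINT z|lborel. ?G z)"
    by (rule integral_mono[OF int G le])
  also have "\<dots> = 2 * (LINT z|lborel. indicator (box p q) z * (A z - w z)\<^sup>2) + measure lborel (box p q) * (2 * \<epsilon>\<^sup>2)"
    using A(1) indicator_box_integrable by simp
  also have "\<dots> \<le> e" using A(2) \<epsilon> by (simp add: algebra_simps)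
  finally show "(LINT z|lborel. indicator (box p q) z * (V z - w z)\<^sup>2) \<le> e" .
qed


text \<open>The weak derivatives belong to \<open>u\<close> extended by zero, as all integrals are over the whole plane.\<close>

lemma exp_sum_approximation:
  assumes u: "continuous_on (cbox p q) u"
    and ut: "ut \<in> borel_measurable borel" "integrable lborel (\<lambda>z. (ut z)\<^sup>2)" "\<And>z. z \<notin> box p q \<Longrightarrow> ut z = 0"
    and ux: "ux \<in> borel_measurable borel" "integrable lborel (\<lambda>z. (ux z)\<^sup>2)" "\<And>z. z \<notin> box p q \<Longrightarrow> ux z = 0"
    and uxx: "uxx \<in> borel_measurable borel" "integrable lborel (\<lambda>z. (uxx z)\<^sup>2)" "\<And>z. z \<notin> box p q \<Longrightarrow> uxx z = 0"
    and weak_t: "\<And>\<phi>. test_function (box p q) \<phi> \<Longrightarrow>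
      (LINT y|lborel. (indicator (box p q) y * u y) * d_t \<phi> y) = - (LINT y|lborel. ut y * \<phi> y)"
    and weak_x: "\<And>\<phi>. test_function (box p q) \<phi> \<Longrightarrow>
      (LINT y|lborel. (indicator (box p q) y * u y) * d_x \<phi> y) = - (LINT y|lborel. ux y * \<phi> y)"
    and weak_xx: "\<And>\<phi>. test_function (box p q) \<phi> \<Longrightarrow>
      (LINT y|lborel. (indicator (box p q) y * u y) * d_x (d_x \<phi>) y) = (LINT y|lborel. uxx y * \<phi> y)"
    and "0 < e"
  obtains ys where "\<And>z. z \<in> cbox p q \<Longrightarrow> \<bar>ridge exp ys z - u z\<bar> \<le> e"
    "integrable lborel (\<lambda>z. indicator (box p q) z * (ridge exp (ridge_dt ys) z - ut z)\<^sup>2)"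
    "(LINT z|lborel. indicator (box p q) z * (ridge exp (ridge_dt ys) z - ut z)\<^sup>2) \<le> e"
    "integrable lborel (\<lambda>z. indicator (box p q) z * (ridge exp (ridge_dx ys) z - ux z)\<^sup>2)"
    "(LINT z|lborel. indicator (box p q) z * (ridge exp (ridge_dx ys) z - ux z)\<^sup>2) \<le> e"
    "integrable lborel (\<lambda>z. indicator (box p q) z * (ridge exp (ridge_dx (ridge_dx ys)) z - uxx z)\<^sup>2)"
    "(LINT z|lborel. indicator (box p q) z * (ridge exp (ridge_dx (ridge_dx ys)) z - uxx z)\<^sup>2) \<le> e"
proof -
  define u0 where "u0 y = indicator (box p q) y * u y" for y
  have u0_out: "u0 y = 0" if "y \<notin> box p q" for y using that by (simp add: u0_def)
  have "(\<lambda>y. indicator (box p q) y *\<^sub>R u y) \<in> borel_measurable borel"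
    by (intro borel_measurable_continuous_on_indicator continuous_on_subset[OF u box_subset_cbox]) auto
  then have [measurable]: "u0 \<in> borel_measurable borel" by (simp add: u0_def[abs_def])
  obtain M where M: "0 < M" "\<And>z. z \<in> cbox p q \<Longrightarrow> \<bar>u z\<bar> \<le> M"
    using compact_imp_bounded[OF compact_continuous_image[OF u compact_cbox]]
    by (auto simp: bounded_pos)
  have u0_int: "integrable lborel u0"
    by (rule integrable_abs_bound[OF indicator_box_integrable[of M]])
       (use M(2) box_subset_cbox[of p q] in \<open>auto simp: u0_def indicator_def subset_iff\<close>)
  have [measurable]: "ut \<in> borel_measurable borel" "ux \<in> borel_measurable borel" "uxx \<in> borel_measurable borel"
    using ut ux uxx by auto
  have ux_int: "integrable lborel ux" using ux by (rule integrable_if_square_integrable)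
  define A where "A = measure lborel (box p q)"
  have A: "0 \<le> A" by (simp add: A_def)
  define \<epsilon> where "\<epsilon> = sqrt (e / (4 * (A + 1)))"
  have \<epsilon>: "0 < \<epsilon>" using A \<open>0 < e\<close> by (simp add: \<epsilon>_def)
  have \<epsilon>A: "4 * (\<epsilon>\<^sup>2 * A) \<le> e"
  proof -
    have "\<epsilon>\<^sup>2 = e / (4 * (A + 1))" using A \<open>0 < e\<close> by (simp add: \<epsilon>_def)
    moreover have "e * A \<le> e * (A + 1)" using \<open>0 < e\<close> by simp
    ultimately show ?thesis using A \<open>0 < e\<close> by (simp add: divide_le_eq)
  qed
  define err where "err w m r \<eta> n = (\<lambda>z. indicator (box p q) z * (r ^ m * mollify n (\<lambda>y. w y * \<eta> y) (dil r z) - w z)\<^sup>2)"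
    for w m r \<eta> n
  have e4: "0 < e / 4" using \<open>0 < e\<close> by simp
  have L2: "\<forall>\<^sub>F r in at_left 1. \<forall>\<eta> \<delta>. cutoff r \<eta> \<delta> \<longrightarrow> (\<forall>\<^sub>F n in sequentially.
      integrable lborel (err w m r \<eta> n) \<and> integral\<^sup>L lborel (err w m r \<eta> n) \<le> e / 4)"
    if "w \<in> borel_measurable borel" "integrable lborel (\<lambda>z. (w z)\<^sup>2)" "\<forall>z. z \<notin> box p q \<longrightarrow> w z = 0" for w m
    unfolding err_def by (rule mollify_L2[OF that(1,2) _ e4]) (use that(3) in blast)
  have L2s: "\<forall>z. z \<notin> box p q \<longrightarrow> ut z = 0" "\<forall>z. z \<notin> box p q \<longrightarrow> ux z = 0" "\<forall>z. z \<notin> box p q \<longrightarrow> uxx z = 0"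
    using ut(3) ux(3) uxx(3) by blast+
  have "\<forall>\<^sub>F r in at_left (1::real). 0 < r \<and> r < 1"
    by (auto simp: eventually_at_left_field intro!: exI[of _ 0])
  then have "\<forall>\<^sub>F r in at_left 1. (0 < r \<and> r < 1) \<and> (\<forall>\<eta> \<delta>. cutoff r \<eta> \<delta> \<longrightarrow> (\<forall>\<^sub>F n in sequentially.
      (\<forall>z\<in>cbox p q. \<bar>mollify n (\<lambda>y. u0 y * \<eta> y) (dil r z) - u z\<bar> \<le> e) \<and>
      (integrable lborel (err ut 1 r \<eta> n) \<and> integral\<^sup>L lborel (err ut 1 r \<eta> n) \<le> e / 4) \<and>
      (integrable lborel (err ux 1 r \<eta> n) \<and> integral\<^sup>L lborel (err ux 1 r \<eta> n) \<le> e / 4) \<and>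
      (integrable lborel (err uxx 2 r \<eta> n) \<and> integral\<^sup>L lborel (err uxx 2 r \<eta> n) \<le> e / 4)))"
    using mollify_uniform[OF u \<open>0 < e\<close>, folded u0_def] L2[OF ut(1,2) L2s(1), of 1] L2[OF ux(1,2) L2s(2), of 1]
      L2[OF uxx(1,2) L2s(3), of 2]
  proof eventually_elim
    case (elim r)
    have conj: "(\<forall>\<^sub>F n in sequentially. P1 n \<and> P2 n \<and> P3 n \<and> P4 n)"
      if "\<forall>\<^sub>F n in sequentially. P1 n" "\<forall>\<^sub>F n in sequentially. P2 n" "\<forall>\<^sub>F n in sequentially. P3 n" "\<forall>\<^sub>F n in sequentially. P4 n"
      for P1 P2 P3 P4 :: "nat \<Rightarrow> bool"
      using that by (simp add: eventually_conj_iff)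
    show ?case
      using elim by (intro conjI allI impI conj) blast+
  qed
  then obtain r where r: "0 < r" "r < 1"
    and ev: "\<And>\<eta> \<delta>. cutoff r \<eta> \<delta> \<Longrightarrow> (\<forall>\<^sub>F n in sequentially.
      (\<forall>z\<in>cbox p q. \<bar>mollify n (\<lambda>y. u0 y * \<eta> y) (dil r z) - u z\<bar> \<le> e) \<and>
      (integrable lborel (err ut 1 r \<eta> n) \<and> integral\<^sup>L lborel (err ut 1 r \<eta> n) \<le> e / 4) \<and>
      (integrable lborel (err ux 1 r \<eta> n) \<and> integral\<^sup>L lborel (err ux 1 r \<eta> n) \<le> e / 4) \<and>
      (integrable lborel (err uxx 2 r \<eta> n) \<and> integral\<^sup>L lborel (err uxx 2 r \<eta> n) \<le> e / 4))"
    using eventually_happens'[OF trivial_limit_at_left_real] by blast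
  obtain \<eta> \<delta> where cut: "cutoff r \<eta> \<delta>" using cutoff_exists[OF r] by blast
  have \<eta>: "smooth \<eta>" and supp: "compact_support \<eta>" and "0 < \<delta>"
    and one: "\<And>z y. z \<in> cbox p q \<Longrightarrow> dist y (dil r z) < \<delta> \<Longrightarrow> \<eta> y = 1"
    using cut unfolding cutoff_def by auto
  have d\<eta>: "smooth (d_x \<eta>)" "smooth (d_t \<eta>)" "smooth (d_x (d_x \<eta>))"
    using \<eta> by (auto intro!: smooth_partial_deriv simp: Basis_prod_def)
  \<comment> \<open>The derivatives of the cutoff vanish where the cutoff is constant.\<close>
  have near: "partial_deriv v \<eta> y = 0" "partial_deriv v' (partial_deriv v \<eta>) y = 0"
    if "z \<in> cbox p q" "dist y (dil r z) < \<delta>" for v v' z y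
  proof -
    have *: "partial_deriv v \<eta> y = 0" if "y \<in> ball (dil r z) \<delta>" for y v
      by (rule partial_deriv_eq_0_if_const_on_open[OF open_ball that, of _ 1])
         (use one[OF \<open>z \<in> cbox p q\<close>] in \<open>auto simp: dist_commute\<close>)
    show "partial_deriv v \<eta> y = 0" using * that by (simp add: dist_commute)
    show "partial_deriv v' (partial_deriv v \<eta>) y = 0"
      by (rule partial_deriv_eq_0_if_const_on_open[OF open_ball, of y "dil r z" \<delta> _ 0])
         (use that * in \<open>auto simp: dist_commute\<close>)
  qed
  have r': "0 \<le> r" "r \<le> 1" using r by auto
  have far: "\<forall>\<^sub>F n in sequentially. \<forall>z\<in>cbox p q. \<bar>mollify n (\<lambda>y. h y * \<zeta> y) (dil r z)\<bar> \<le> \<epsilon> / 3"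
    if "integrable lborel h" "\<And>y. y \<notin> box p q \<Longrightarrow> h y = 0" "smooth \<zeta>"
      "\<And>z y. z \<in> cbox p q \<Longrightarrow> dist y (dil r z) < \<delta> \<Longrightarrow> \<zeta> y = 0" for h \<zeta>
    by (rule mollify_far[OF _ _ r' \<open>0 < \<delta>\<close>])
       (use that \<epsilon> in \<open>auto intro: integrable_mult_continuous smooth_continuous_on\<close>)
  have "\<forall>\<^sub>F n in sequentially.
      (\<forall>z\<in>cbox p q. \<bar>mollify n (\<lambda>y. u0 y * d_t \<eta> y) (dil r z)\<bar> \<le> \<epsilon> / 3) \<and>
      (\<forall>z\<in>cbox p q. \<bar>mollify n (\<lambda>y. u0 y * d_x \<eta> y) (dil r z)\<bar> \<le> \<epsilon> / 3) \<and>
      (\<forall>z\<in>cbox p q. \<bar>mollify n (\<lambda>y. ux y * d_x \<eta> y) (dil r z)\<bar> \<le> \<epsilon> / 3) \<and>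
      (\<forall>z\<in>cbox p q. \<bar>mollify n (\<lambda>y. u0 y * d_x (d_x \<eta>) y) (dil r z)\<bar> \<le> \<epsilon> / 3)"
    by (intro eventually_conj far u0_int ux_int u0_out ux(3) d\<eta> near)
  with ev[OF cut] have "\<forall>\<^sub>F n in sequentially.
      ((\<forall>z\<in>cbox p q. \<bar>mollify n (\<lambda>y. u0 y * \<eta> y) (dil r z) - u z\<bar> \<le> e) \<and>
      (integrable lborel (err ut 1 r \<eta> n) \<and> integral\<^sup>L lborel (err ut 1 r \<eta> n) \<le> e / 4) \<and>
      (integrable lborel (err ux 1 r \<eta> n) \<and> integral\<^sup>L lborel (err ux 1 r \<eta> n) \<le> e / 4) \<and>
      (integrable lborel (err uxx 2 r \<eta> n) \<and> integral\<^sup>L lborel (err uxx 2 r \<eta> n) \<le> e / 4)) \<and>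
      (\<forall>z\<in>cbox p q. \<bar>mollify n (\<lambda>y. u0 y * d_t \<eta> y) (dil r z)\<bar> \<le> \<epsilon> / 3) \<and>
      (\<forall>z\<in>cbox p q. \<bar>mollify n (\<lambda>y. u0 y * d_x \<eta> y) (dil r z)\<bar> \<le> \<epsilon> / 3) \<and>
      (\<forall>z\<in>cbox p q. \<bar>mollify n (\<lambda>y. ux y * d_x \<eta> y) (dil r z)\<bar> \<le> \<epsilon> / 3) \<and>
      (\<forall>z\<in>cbox p q. \<bar>mollify n (\<lambda>y. u0 y * d_x (d_x \<eta>) y) (dil r z)\<bar> \<le> \<epsilon> / 3)"
    by (rule eventually_conj)
  then obtain n where
      n0: "\<And>z. z \<in> cbox p q \<Longrightarrow> \<bar>mollify n (\<lambda>y. u0 y * \<eta> y) (dil r z) - u z\<bar> \<le> e"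
    and nt: "integrable lborel (err ut 1 r \<eta> n)" "integral\<^sup>L lborel (err ut 1 r \<eta> n) \<le> e / 4"
    and nx: "integrable lborel (err ux 1 r \<eta> n)" "integral\<^sup>L lborel (err ux 1 r \<eta> n) \<le> e / 4"
    and nxx: "integrable lborel (err uxx 2 r \<eta> n)" "integral\<^sup>L lborel (err uxx 2 r \<eta> n) \<le> e / 4"
    and et: "\<And>z. z \<in> cbox p q \<Longrightarrow> \<bar>mollify n (\<lambda>y. u0 y * d_t \<eta> y) (dil r z)\<bar> \<le> \<epsilon> / 3"
    and ex: "\<And>z. z \<in> cbox p q \<Longrightarrow> \<bar>mollify n (\<lambda>y. u0 y * d_x \<eta> y) (dil r z)\<bar> \<le> \<epsilon> / 3"
    and ex': "\<And>z. z \<in> cbox p q \<Longrightarrow> \<bar>mollify n (\<lambda>y. ux y * d_x \<eta> y) (dil r z)\<bar> \<le> \<epsilon> / 3"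
    and exx: "\<And>z. z \<in> cbox p q \<Longrightarrow> \<bar>mollify n (\<lambda>y. u0 y * d_x (d_x \<eta>) y) (dil r z)\<bar> \<le> \<epsilon> / 3"
    using eventually_happens'[OF sequentially_bot] by blast
  define ys where "ys = conv r (\<lambda>y. u0 y * \<eta> y) (K n)"
  have u\<eta>: "integrable lborel (\<lambda>y. u0 y * \<eta> y)" "\<And>y. y \<notin> box p q \<Longrightarrow> u0 y * \<eta> y = 0"
    by (auto intro!: integrable_mult_continuous u0_int smooth_continuous_on \<eta> simp: u0_out)
  have rc: "ridge exp (conv r (\<lambda>y. u0 y * \<eta> y) xs) z = (LINT y|lborel. u0 y * \<eta> y * ridge exp xs (dil r z - y))" for xs z
    by (rule ridge_conv) (fact u\<eta>)+
  have moll: "mollify n (\<lambda>y. h y * \<zeta> y) (dil r z) = (LINT y|lborel. h y * \<zeta> y * ridge exp (K n) (dil r z - y))"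
    if "h = u0 \<or> h = ut \<or> h = ux \<or> h = uxx" "z \<in> cbox p q" for h \<zeta> z
    by (rule mollify_eq) (use that r' u0_out ut(3) ux(3) uxx(3) in auto)
  have V0: "ridge exp ys z = mollify n (\<lambda>y. u0 y * \<eta> y) (dil r z)" if "z \<in> cbox p q" for z
    using that by (simp add: ys_def rc moll)
  note weak = weak_t[folded u0_def] weak_x[folded u0_def] weak_xx[folded u0_def]
  have rb: "\<bar>r * a\<bar> \<le> \<bar>a\<bar>" "\<bar>r\<^sup>2 * a\<bar> \<le> \<bar>a\<bar>" for a
    using r' by (auto simp: abs_mult power_le_one intro!: mult_left_le_one_le)
  have Vt: "ridge exp (ridge_dt ys) z = r ^ 1 * mollify n (\<lambda>y. ut y * \<eta> y) (dil r z)
      + r * mollify n (\<lambda>y. u0 y * d_t \<eta> y) (dil r z)" if "z \<in> cbox p q" for z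
  proof -
    have "(LINT y|lborel. u0 y * \<eta> y * ridge exp (ridge_dt (K n)) (dil r z - y))
      = (LINT y|lborel. ut y * \<eta> y * ridge exp (K n) (dil r z - y)) + (LINT y|lborel. u0 y * d_t \<eta> y * ridge exp (K n) (dil r z - y))"
      by (rule integration_by_parts_t[OF u0_int _ _ \<eta> supp]) (fact u0_out weak(1))+
    then show ?thesis using that by (simp add: ys_def ridge_dt_conv rc moll distrib_left)
  qed
  have Vx: "ridge exp (ridge_dx ys) z = r ^ 1 * mollify n (\<lambda>y. ux y * \<eta> y) (dil r z)
      + r * mollify n (\<lambda>y. u0 y * d_x \<eta> y) (dil r z)" if "z \<in> cbox p q" for z
  proof -
    have "(LINT y|lborel. u0 y * \<eta> y * ridge exp (ridge_dx (K n)) (dil r z - y))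
      = (LINT y|lborel. ux y * \<eta> y * ridge exp (K n) (dil r z - y)) + (LINT y|lborel. u0 y * d_x \<eta> y * ridge exp (K n) (dil r z - y))"
      by (rule integration_by_parts_x[OF u0_int _ _ \<eta> supp]) (fact u0_out weak(2))+
    then show ?thesis using that by (simp add: ys_def ridge_dx_conv rc moll distrib_left)
  qed
  have Vxx: "ridge exp (ridge_dx (ridge_dx ys)) z = r ^ 2 * mollify n (\<lambda>y. uxx y * \<eta> y) (dil r z)
      + r\<^sup>2 * (2 * mollify n (\<lambda>y. ux y * d_x \<eta> y) (dil r z) + mollify n (\<lambda>y. u0 y * d_x (d_x \<eta>) y) (dil r z))"
    if "z \<in> cbox p q" for z
  proof -
    have "(LINT y|lborel. u0 y * \<eta> y * ridge exp (ridge_dx (ridge_dx (K n))) (dil r z - y))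
      = (LINT y|lborel. uxx y * \<eta> y * ridge exp (K n) (dil r z - y))
        + 2 * (LINT y|lborel. ux y * d_x \<eta> y * ridge exp (K n) (dil r z - y))
        + (LINT y|lborel. u0 y * d_x (d_x \<eta>) y * ridge exp (K n) (dil r z - y))"
      by (rule integration_by_parts_xx[OF u0_int _ _ _ \<eta> supp]) (fact u0_out weak(2) weak(3))+
    then show ?thesis using that by (simp add: ys_def ridge_dxx_conv rc moll distrib_left)
  qed
  have bc: "z \<in> cbox p q" if "z \<in> box p q" for z using that box_subset_cbox by blast
  have Vm: "ridge exp xs \<in> borel_measurable borel" for xs
    by (intro borel_measurable_continuous_onI continuous_K)
  have E1: "\<bar>r * mollify n (\<lambda>y. u0 y * d_t \<eta> y) (dil r z)\<bar> \<le> \<epsilon>" if "z \<in> box p q" for z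
    using order_trans[OF rb(1) et[OF bc[OF that]]] \<epsilon> by simp
  have E2: "\<bar>r * mollify n (\<lambda>y. u0 y * d_x \<eta> y) (dil r z)\<bar> \<le> \<epsilon>" if "z \<in> box p q" for z
    using order_trans[OF rb(1) ex[OF bc[OF that]]] \<epsilon> by simp
  have E3: "\<bar>r\<^sup>2 * (2 * mollify n (\<lambda>y. ux y * d_x \<eta> y) (dil r z) + mollify n (\<lambda>y. u0 y * d_x (d_x \<eta>) y) (dil r z))\<bar> \<le> \<epsilon>"
    if "z \<in> box p q" for z
    by (rule order_trans[OF rb(2)]) (use ex'[OF bc[OF that]] exx[OF bc[OF that]] in linarith)
  show thesis
  proof (rule that[of ys])
    show "\<bar>ridge exp ys z - u z\<bar> \<le> e" if "z \<in> cbox p q" for z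
      using n0[OF that] V0[OF that] by simp
  qed (rule square_error_add[OF nt[unfolded err_def] Vt[OF bc] E1 \<epsilon>A[unfolded A_def] Vm ut(1)]
        square_error_add[OF nx[unfolded err_def] Vx[OF bc] E2 \<epsilon>A[unfolded A_def] Vm ux(1)]
        square_error_add[OF nxx[unfolded err_def] Vxx[OF bc] E3 \<epsilon>A[unfolded A_def] Vm uxx(1)]; assumption)+
qed

end

section \<open>Networks\<close>

text \<open>The logistic function \<open>e\<^sup>s / (1 + \<rho> e\<^sup>s)\<close>, a shifted and rescaled \<open>tanh\<close>, converges to the
  exponential function as \<open>\<rho> \<rightarrow> 0\<close>, locally uniformly with its first two derivatives.\<close>

definition logi :: "real \<Rightarrow> real \<Rightarrow> real" where
  "logi \<rho> s = exp s / (1 + \<rho> * exp s)"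

text \<open>Its first and second derivatives.\<close>

definition logi' :: "real \<Rightarrow> real \<Rightarrow> real" where
  "logi' \<rho> s = exp s / (1 + \<rho> * exp s)\<^sup>2"

definition logi'' :: "real \<Rightarrow> real \<Rightarrow> real" where
  "logi'' \<rho> s = exp s * (1 - \<rho> * exp s) / (1 + \<rho> * exp s) ^ 3"

lemma logi_deriv:
  assumes "0 < \<rho>"
  shows "(logi \<rho> has_real_derivative logi' \<rho> s) (at s)" "(logi' \<rho> has_real_derivative logi'' \<rho> s) (at s)"
proof -
  have pos: "0 < 1 + \<rho> * exp s" using assms by (simp add: add_pos_pos)
  show "(logi \<rho> has_real_derivative logi' \<rho> s) (at s)"
    unfolding logi_def[abs_def] logi'_def using pos
    by (auto intro!: derivative_eq_intros simp: power2_eq_square field_simps)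
  have d: "((\<lambda>s. exp s / (1 + \<rho> * exp s)\<^sup>2) has_real_derivative
      (exp s * (1 + \<rho> * exp s)\<^sup>2 - exp s * (2 * (1 + \<rho> * exp s) * (\<rho> * exp s))) / ((1 + \<rho> * exp s)\<^sup>2 * (1 + \<rho> * exp s)\<^sup>2)) (at s)"
    using pos by (auto intro!: derivative_eq_intros)
  have alg: "(E * (1 + x)\<^sup>2 - E * (2 * (1 + x) * x)) / ((1 + x)\<^sup>2 * (1 + x)\<^sup>2) = E * (1 - x) / (1 + x) ^ 3"
    if "0 < 1 + x" for E x :: real
  proof -
    have "E * (1 + x)\<^sup>2 - E * (2 * (1 + x) * x) = (1 + x) * (E * (1 - x))"
      by (simp add: power2_eq_square algebra_simps)
    moreover have "(1 + x)\<^sup>2 * (1 + x)\<^sup>2 = (1 + x) * (1 + x) ^ 3"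
      by (simp add: power2_eq_square power3_eq_cube)
    ultimately show ?thesis using that by simp
  qed
  show "(logi' \<rho> has_real_derivative logi'' \<rho> s) (at s)"
    unfolding logi'_def[abs_def] logi''_def by (rule DERIV_cong[OF d alg[OF pos]])
qed

text \<open>With \<open>x = \<rho> e\<^sup>s\<close> each of the three functions is \<open>e\<^sup>s\<close> times a factor between \<open>1 - 4 x\<close> and \<open>1\<close>.\<close>

lemma logi_close:
  assumes "0 < \<rho>" "exp s \<le> B"
  shows "\<bar>logi \<rho> s - exp s\<bar> \<le> 4 * \<rho> * B\<^sup>2" "\<bar>logi' \<rho> s - exp s\<bar> \<le> 4 * \<rho> * B\<^sup>2"
    "\<bar>logi'' \<rho> s - exp s\<bar> \<le> 4 * \<rho> * B\<^sup>2"
proof -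
  define x where "x = \<rho> * exp s"
  have x: "0 < x" using assms by (simp add: x_def)
  have key: "\<bar>exp s * a - exp s\<bar> \<le> 4 * \<rho> * B\<^sup>2" if "1 - 4 * x \<le> a" "a \<le> 1" for a
  proof -
    have "\<bar>exp s * a - exp s\<bar> = exp s * (1 - a)"
      using that by (simp add: abs_if algebra_simps)
    also have "\<dots> \<le> exp s * (4 * x)" using that by (intro mult_left_mono) auto
    also have "\<dots> = 4 * \<rho> * (exp s)\<^sup>2" by (simp add: x_def power2_eq_square)
    also have "\<dots> \<le> 4 * \<rho> * B\<^sup>2"
      using assms by (intro mult_left_mono power_mono) auto
    finally show ?thesis .
  qed
  have b1: "1 - 4 * x \<le> 1 / (1 + x)" "1 / (1 + x) \<le> 1"
    using x by (auto simp: field_simps)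
  have b2: "1 - 4 * x \<le> 1 / (1 + x)\<^sup>2" "1 / (1 + x)\<^sup>2 \<le> 1"
  proof -
    have "0 \<le> x ^ 3" "0 \<le> x\<^sup>2" using x by auto
    moreover have "(1 - 4 * x) * (1 + x)\<^sup>2 = 1 - 2 * x - 7 * x\<^sup>2 - 4 * x ^ 3"
      by (simp add: power2_eq_square power3_eq_cube algebra_simps)
    ultimately have "(1 - 4 * x) * (1 + x)\<^sup>2 \<le> 1" using x by linarith
    then show "1 - 4 * x \<le> 1 / (1 + x)\<^sup>2" using x by (simp add: pos_le_divide_eq)
    show "1 / (1 + x)\<^sup>2 \<le> 1" using x one_le_power[of "1 + x" 2] by (simp add: pos_divide_le_eq)
  qed
  have b3: "1 - 4 * x \<le> (1 - x) / (1 + x) ^ 3" "(1 - x) / (1 + x) ^ 3 \<le> 1"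
  proof -
    have "0 \<le> x ^ 3" "0 \<le> x\<^sup>2" "0 \<le> x ^ 4" using x by auto
    moreover have "(1 - 4 * x) * (1 + x) ^ 3 = 1 - x - 9 * x\<^sup>2 - 11 * x ^ 3 - 4 * x ^ 4"
      by (simp add: power2_eq_square power3_eq_cube power4_eq_xxxx algebra_simps)
    moreover have "(1 + x) ^ 3 = 1 + 3 * x + 3 * x\<^sup>2 + x ^ 3"
      by (simp add: power2_eq_square power3_eq_cube algebra_simps)
    ultimately have "(1 - 4 * x) * (1 + x) ^ 3 \<le> 1 - x" "1 - x \<le> (1 + x) ^ 3" using x by linarith+
    then show "1 - 4 * x \<le> (1 - x) / (1 + x) ^ 3" "(1 - x) / (1 + x) ^ 3 \<le> 1"
      using x by (auto simp: pos_le_divide_eq pos_divide_le_eq)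
  qed
  show "\<bar>logi \<rho> s - exp s\<bar> \<le> 4 * \<rho> * B\<^sup>2" using key[OF b1] by (simp add: logi_def x_def)
  show "\<bar>logi' \<rho> s - exp s\<bar> \<le> 4 * \<rho> * B\<^sup>2" using key[OF b2] by (simp add: logi'_def x_def)
  show "\<bar>logi'' \<rho> s - exp s\<bar> \<le> 4 * \<rho> * B\<^sup>2" using key[OF b3] by (simp add: logi''_def x_def)
qed

lemma ridge_close:
  assumes "\<And>c \<alpha> \<beta> \<gamma>. (c, \<alpha>, \<beta>, \<gamma>) \<in> set xs \<Longrightarrow>
      \<bar>g (\<alpha> * fst z + \<beta> * snd z + \<gamma>) - h (\<alpha> * fst z + \<beta> * snd z + \<gamma>)\<bar> \<le> d"
  shows "\<bar>ridge g xs z - ridge h xs z\<bar> \<le> d * (\<Sum>(c, \<alpha>, \<beta>, \<gamma>)\<leftarrow>xs. \<bar>c\<bar>)"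
  using assms
proof (induction xs)
  case (Cons x xs)
  obtain c \<alpha> \<beta> \<gamma> where x: "x = (c, \<alpha>, \<beta>, \<gamma>)" by (cases x) auto
  let ?s = "\<alpha> * fst z + \<beta> * snd z + \<gamma>"
  have "\<bar>ridge g (x # xs) z - ridge h (x # xs) z\<bar> \<le> \<bar>c * g ?s - c * h ?s\<bar> + \<bar>ridge g xs z - ridge h xs z\<bar>"
    by (simp add: x)
  also have "\<bar>c * g ?s - c * h ?s\<bar> = \<bar>c\<bar> * \<bar>g ?s - h ?s\<bar>" by (simp flip: abs_mult right_diff_distrib)
  also have "\<dots> \<le> \<bar>c\<bar> * d" using Cons.prems[of c \<alpha> \<beta> \<gamma>] by (intro mult_left_mono) (auto simp: x)
  finally have "\<bar>ridge g (x # xs) z - ridge h (x # xs) z\<bar> \<le> \<bar>c\<bar> * d + \<bar>ridge g xs z - ridge h xs z\<bar>"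
    by simp
  moreover have "\<bar>ridge g xs z - ridge h xs z\<bar> \<le> d * (\<Sum>(c, \<alpha>, \<beta>, \<gamma>)\<leftarrow>xs. \<bar>c\<bar>)"
  proof (rule Cons.IH)
    fix c \<alpha> \<beta> \<gamma> assume "(c, \<alpha>, \<beta>, \<gamma>) \<in> set xs"
    then show "\<bar>g (\<alpha> * fst z + \<beta> * snd z + \<gamma>) - h (\<alpha> * fst z + \<beta> * snd z + \<gamma>)\<bar> \<le> d"
      by (intro Cons.prems[of c]) simp
  qed
  ultimately have "\<bar>ridge g (x # xs) z - ridge h (x # xs) z\<bar> \<le> \<bar>c\<bar> * d + d * (\<Sum>(c, \<alpha>, \<beta>, \<gamma>)\<leftarrow>xs. \<bar>c\<bar>)"
    by (rule order_trans[OF _ add_left_mono])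
  then show ?case by (simp add: x distrib_left mult.commute case_prod_unfold)
qed simp

lemma ridge_logi_close:
  assumes "0 < e"
  obtains \<rho> where "0 < \<rho>" and
    "\<And>z. z \<in> cbox p q \<Longrightarrow> \<bar>ridge (logi \<rho>) xs z - ridge exp xs z\<bar> \<le> e"
    "\<And>z. z \<in> cbox p q \<Longrightarrow> \<bar>ridge (logi' \<rho>) (ridge_dx xs) z - ridge exp (ridge_dx xs) z\<bar> \<le> e"
    "\<And>z. z \<in> cbox p q \<Longrightarrow> \<bar>ridge (logi' \<rho>) (ridge_dt xs) z - ridge exp (ridge_dt xs) z\<bar> \<le> e"
    "\<And>z. z \<in> cbox p q \<Longrightarrow> \<bar>ridge (logi'' \<rho>) (ridge_dx (ridge_dx xs)) z - ridge exp (ridge_dx (ridge_dx xs)) z\<bar> \<le> e"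
proof -
  have "\<exists>B>0. \<forall>(c, \<alpha>, \<beta>, \<gamma>)\<in>set xs. \<forall>z\<in>cbox p q. exp (\<alpha> * fst z + \<beta> * snd z + \<gamma>) \<le> B" for xs :: "(real \<times> real \<times> real \<times> real) list"
  proof (induction xs)
    case (Cons x xs)
    obtain c \<alpha> \<beta> \<gamma> where x: "x = (c, \<alpha>, \<beta>, \<gamma>)" by (cases x) auto
    obtain B where B: "B > 0" "\<forall>(c, \<alpha>, \<beta>, \<gamma>)\<in>set xs. \<forall>z\<in>cbox p q. exp (\<alpha> * fst z + \<beta> * snd z + \<gamma>) \<le> B"
      using Cons by auto
    have "bounded ((\<lambda>z. exp (\<alpha> * fst z + \<beta> * snd z + \<gamma>)) ` cbox p q)"
      by (intro compact_imp_bounded compact_continuous_image compact_cbox continuous_intros)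
    then obtain B' where B': "\<forall>z\<in>cbox p q. exp (\<alpha> * fst z + \<beta> * snd z + \<gamma>) \<le> B'"
      by (auto simp: bounded_iff)
    show ?case
      by (rule exI[of _ "max B B'"]) (use B B' in \<open>fastforce simp: x le_max_iff_disj\<close>)
  qed (auto intro: exI[of _ 1])
  note bdd = this
  define zs where "zs = xs @ ridge_dx xs @ ridge_dt xs @ ridge_dx (ridge_dx xs)"
  obtain B where B: "B > 0" "\<forall>(c, \<alpha>, \<beta>, \<gamma>)\<in>set zs. \<forall>z\<in>cbox p q. exp (\<alpha> * fst z + \<beta> * snd z + \<gamma>) \<le> B"
    using bdd[of zs] by auto
  define S where "S = (\<Sum>(c, \<alpha>, \<beta>, \<gamma>)\<leftarrow>zs. \<bar>c\<bar>)"
  define \<sigma> where "\<sigma> ys = (\<Sum>(c, \<alpha>, \<beta>, \<gamma>)\<leftarrow>ys. \<bar>c\<bar>)" for ys :: "(real \<times> real \<times> real \<times> real) list"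
  have \<sigma>: "0 \<le> \<sigma> ys" for ys unfolding \<sigma>_def by (rule sum_list_nonneg) auto
  have "S = \<sigma> xs + \<sigma> (ridge_dx xs) + \<sigma> (ridge_dt xs) + \<sigma> (ridge_dx (ridge_dx xs))"
    by (simp add: S_def \<sigma>_def zs_def)
  then have le: "\<sigma> xs \<le> S" "\<sigma> (ridge_dx xs) \<le> S" "\<sigma> (ridge_dt xs) \<le> S" "\<sigma> (ridge_dx (ridge_dx xs)) \<le> S" "0 \<le> S"
    using \<sigma>[of xs] \<sigma>[of "ridge_dx xs"] \<sigma>[of "ridge_dt xs"] \<sigma>[of "ridge_dx (ridge_dx xs)"] by linarith+
  define \<rho> where "\<rho> = e / (4 * B\<^sup>2 * (S + 1))"
  have \<rho>: "0 < \<rho>" using B assms le by (simp add: \<rho>_def)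
  have small: "4 * \<rho> * B\<^sup>2 * s \<le> e" if "s \<le> S" for s
  proof -
    have "4 * \<rho> * B\<^sup>2 = e / (S + 1)" using B(1) by (simp add: \<rho>_def)
    moreover have "e * s \<le> e * (S + 1)" using that assms by simp
    ultimately show ?thesis using le(5) by (simp add: divide_le_eq)
  qed
  have close: "\<bar>ridge g ys z - ridge exp ys z\<bar> \<le> e"
    if "set ys \<subseteq> set zs" "\<sigma> ys \<le> S" "z \<in> cbox p q" "\<And>s. exp s \<le> B \<Longrightarrow> \<bar>g s - exp s\<bar> \<le> 4 * \<rho> * B\<^sup>2" for g ys z
  proof (rule order_trans[OF ridge_close[of ys g z exp "4 * \<rho> * B\<^sup>2"]])
    fix c \<alpha> \<beta> \<gamma> assume "(c, \<alpha>, \<beta>, \<gamma>) \<in> set ys"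
    then have "exp (\<alpha> * fst z + \<beta> * snd z + \<gamma>) \<le> B" using B(2) that(1,3) by fastforce
    then show "\<bar>g (\<alpha> * fst z + \<beta> * snd z + \<gamma>) - exp (\<alpha> * fst z + \<beta> * snd z + \<gamma>)\<bar> \<le> 4 * \<rho> * B\<^sup>2"
      by (rule that(4))
  qed (use small[OF that(2)] in \<open>simp add: \<sigma>_def\<close>)
  show thesis
    by (rule that[OF \<rho>]; rule close) (use le logi_close[OF \<rho>] in \<open>auto simp: zs_def\<close>)
qed

lemma ridge_eq_sum:
  "ridge g xs z = (\<Sum>j<length xs. fst (xs ! j) *
     g (fst (snd (xs ! j)) * fst z + fst (snd (snd (xs ! j))) * snd z + snd (snd (snd (xs ! j)))))"
  by (simp add: ridge_def sum_list_sum_nth case_prod_unfold atLeast0LessThan)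

lemma logi_eq_tanh:
  assumes "0 < \<rho>"
  shows "logi \<rho> s = (tanh ((s + ln \<rho>) / 2) + 1) / (2 * \<rho>)"
proof -
  define E where "E = exp ((s + ln \<rho>) / 2)"
  have E: "0 < E" by (simp add: E_def)
  have E2: "E * E = \<rho> * exp s"
  proof -
    have "E * E = exp (s + ln \<rho>)" by (simp add: E_def flip: exp_add)
    then show ?thesis using assms by (simp add: exp_add)
  qed
  have "tanh ((s + ln \<rho>) / 2) = (E - 1 / E) / (E + 1 / E)"
    by (simp add: tanh_altdef E_def exp_minus inverse_eq_divide)
  also have "\<dots> = ((E * E - 1) / E) / ((E * E + 1) / E)" using E by (simp add: diff_divide_distrib add_divide_distrib)
  also have "\<dots> = (E * E - 1) / (E * E + 1)" using E by simp
  finally have "tanh ((s + ln \<rho>) / 2) = (\<rho> * exp s - 1) / (\<rho> * exp s + 1)" by (simp add: E2)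
  moreover have "0 < \<rho> * exp s + 1" using assms by (simp add: add_pos_pos)
  ultimately show ?thesis using assms by (simp add: logi_def field_simps)
qed

lemma is_hlconc_pinn_ridge_logi:
  assumes L: "3 \<le> L" and \<sigma>: "hlconc_activations L \<sigma>" and \<rho>: "0 < \<rho>"
  shows "is_hlconc_pinn L \<sigma> (ridge (logi \<rho>) xs)"
proof -
  \<comment> \<open>A vanishing summand makes the hidden layer nonempty; the later layers have weight zero.\<close>
  define ys where "ys = (0, 0, 0, 0) # xs"
  define w where "w l = (if l = 0 then 2 else if l = 1 then length ys else 1 :: nat)" for l :: nat
  define \<theta> where "\<theta> = \<lparr>
    hl_W = (\<lambda>l r c. if l = 1 then (if c = 0 then fst (snd (ys ! r)) else fst (snd (snd (ys ! r)))) / 2 else 0),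
    hl_b = (\<lambda>l r. if l = 1 then (snd (snd (snd (ys ! r))) + ln \<rho>) / 2 else 0),
    hl_M = (\<lambda>l r c. if l = 1 then fst (ys ! c) / (2 * \<rho>) else 0),
    hl_bout = (\<lambda>r. \<Sum>j<length ys. fst (ys ! j) / (2 * \<rho>))\<rparr>"
  have "ridge (logi \<rho>) xs (x, t) = hlconc_net L \<sigma> w \<theta> (\<lambda>c. if c = 0 then x else t) 0" for x t
  proof -
    let ?z = "\<lambda>c::nat. if c = 0 then x else t"
    let ?s = "\<lambda>j. fst (snd (ys ! j)) * x + fst (snd (snd (ys ! j))) * t + snd (snd (snd (ys ! j)))"
    have layer: "hlconc_layer \<sigma> w \<theta> ?z 1 j = tanh ((?s j + ln \<rho>) / 2)" for j
      using \<sigma> by (simp add: hlconc_activations_def w_def \<theta>_def numeral_2_eq_2 field_simps)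
    have "hlconc_net L \<sigma> w \<theta> ?z 0
        = (\<Sum>l\<in>{1..L - 1}. if l = 1 then (\<Sum>c<length ys. fst (ys ! c) / (2 * \<rho>) * hlconc_layer \<sigma> w \<theta> ?z 1 c) else 0)
          + (\<Sum>j<length ys. fst (ys ! j) / (2 * \<rho>))"
      unfolding hlconc_net_def
      by (intro arg_cong2[where f="(+)"] sum.cong) (auto simp: \<theta>_def w_def)
    also have "\<dots> = (\<Sum>c<length ys. fst (ys ! c) / (2 * \<rho>) * hlconc_layer \<sigma> w \<theta> ?z 1 c)
          + (\<Sum>j<length ys. fst (ys ! j) / (2 * \<rho>))"
      using L by (subst sum.delta) auto
    also have "\<dots> = (\<Sum>j<length ys. fst (ys ! j) * logi \<rho> (?s j))"
      unfolding layer sum.distrib[symmetric]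
      by (intro sum.cong refl) (simp add: logi_eq_tanh[OF \<rho>] add_divide_distrib algebra_simps)
    also have "\<dots> = ridge (logi \<rho>) ys (x, t)" by (simp add: ridge_eq_sum)
    also have "\<dots> = ridge (logi \<rho>) xs (x, t)" by (simp add: ys_def)
    finally show ?thesis ..
  qed
  moreover have "w 0 = 2" "w L = 1" "\<forall>m\<in>{1..<L}. 1 \<le> w m"
    using L by (auto simp: w_def ys_def)
  ultimately show ?thesis unfolding is_hlconc_pinn_def using L \<sigma> by blast
qed

context approx_kernel begin

lemma network_approximation:
  assumes u: "continuous_on (cbox p q) u"
    and ut: "ut \<in> borel_measurable borel" "integrable lborel (\<lambda>z. (ut z)\<^sup>2)" "\<And>z. z \<notin> box p q \<Longrightarrow> ut z = 0"
    and ux: "ux \<in> borel_measurable borel" "integrable lborel (\<lambda>z. (ux z)\<^sup>2)" "\<And>z. z \<notin> box p q \<Longrightarrow> ux z = 0"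
    and uxx: "uxx \<in> borel_measurable borel" "integrable lborel (\<lambda>z. (uxx z)\<^sup>2)" "\<And>z. z \<notin> box p q \<Longrightarrow> uxx z = 0"
    and weak_t: "\<And>\<phi>. test_function (box p q) \<phi> \<Longrightarrow>
      (LINT y|lborel. (indicator (box p q) y * u y) * d_t \<phi> y) = - (LINT y|lborel. ut y * \<phi> y)"
    and weak_x: "\<And>\<phi>. test_function (box p q) \<phi> \<Longrightarrow>
      (LINT y|lborel. (indicator (box p q) y * u y) * d_x \<phi> y) = - (LINT y|lborel. ux y * \<phi> y)"
    and weak_xx: "\<And>\<phi>. test_function (box p q) \<phi> \<Longrightarrow>
      (LINT y|lborel. (indicator (box p q) y * u y) * d_x (d_x \<phi>) y) = (LINT y|lborel. uxx y * \<phi> y)"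
    and "0 < e"
  obtains \<rho> ys where "0 < \<rho>" "\<And>z. z \<in> cbox p q \<Longrightarrow> \<bar>ridge (logi \<rho>) ys z - u z\<bar> \<le> e"
    "integrable lborel (\<lambda>z. indicator (box p q) z * (ridge (logi' \<rho>) (ridge_dt ys) z - ut z)\<^sup>2)"
    "(LINT z|lborel. indicator (box p q) z * (ridge (logi' \<rho>) (ridge_dt ys) z - ut z)\<^sup>2) \<le> e"
    "integrable lborel (\<lambda>z. indicator (box p q) z * (ridge (logi' \<rho>) (ridge_dx ys) z - ux z)\<^sup>2)"
    "(LINT z|lborel. indicator (box p q) z * (ridge (logi' \<rho>) (ridge_dx ys) z - ux z)\<^sup>2) \<le> e"
    "integrable lborel (\<lambda>z. indicator (box p q) z * (ridge (logi'' \<rho>) (ridge_dx (ridge_dx ys)) z - uxx z)\<^sup>2)"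
    "(LINT z|lborel. indicator (box p q) z * (ridge (logi'' \<rho>) (ridge_dx (ridge_dx ys)) z - uxx z)\<^sup>2) \<le> e"
proof -
  have e4: "0 < e / 4" using \<open>0 < e\<close> by simp
  obtain ys where V: "\<And>z. z \<in> cbox p q \<Longrightarrow> \<bar>ridge exp ys z - u z\<bar> \<le> e / 4"
    "integrable lborel (\<lambda>z. indicator (box p q) z * (ridge exp (ridge_dt ys) z - ut z)\<^sup>2)"
    "(LINT z|lborel. indicator (box p q) z * (ridge exp (ridge_dt ys) z - ut z)\<^sup>2) \<le> e / 4"
    "integrable lborel (\<lambda>z. indicator (box p q) z * (ridge exp (ridge_dx ys) z - ux z)\<^sup>2)"
    "(LINT z|lborel. indicator (box p q) z * (ridge exp (ridge_dx ys) z - ux z)\<^sup>2) \<le> e / 4"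
    "integrable lborel (\<lambda>z. indicator (box p q) z * (ridge exp (ridge_dx (ridge_dx ys)) z - uxx z)\<^sup>2)"
    "(LINT z|lborel. indicator (box p q) z * (ridge exp (ridge_dx (ridge_dx ys)) z - uxx z)\<^sup>2) \<le> e / 4"
    by (rule exp_sum_approximation[OF u ut ux uxx weak_t weak_x weak_xx e4]) (assumption | blast)+
  define A where "A = measure lborel (box p q)"
  have A: "0 \<le> A" by (simp add: A_def)
  define \<epsilon> where "\<epsilon> = min (e / 4) (sqrt (e / (4 * (A + 1))))"
  have \<epsilon>: "0 < \<epsilon>" "\<epsilon> \<le> e / 4" using A \<open>0 < e\<close> by (auto simp: \<epsilon>_def)
  have \<epsilon>A: "4 * (\<epsilon>\<^sup>2 * measure lborel (box p q)) \<le> e"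
  proof -
    have "\<epsilon>\<^sup>2 \<le> (sqrt (e / (4 * (A + 1))))\<^sup>2" using \<epsilon> by (intro power_mono) (auto simp: \<epsilon>_def)
    also have "\<dots> = e / (4 * (A + 1))" using A \<open>0 < e\<close> by simp
    finally have "\<epsilon>\<^sup>2 * A \<le> e / (4 * (A + 1)) * A" using A by (rule mult_right_mono)
    moreover have "e * A \<le> e * (A + 1)" using \<open>0 < e\<close> by simp
    then have "4 * (e / (4 * (A + 1)) * A) \<le> e" using A \<open>0 < e\<close> by (simp add: divide_le_eq)
    ultimately show ?thesis by (simp add: A_def)
  qed
  obtain \<rho> where \<rho>: "0 < \<rho>"
    and close: "\<And>z. z \<in> cbox p q \<Longrightarrow> \<bar>ridge (logi \<rho>) ys z - ridge exp ys z\<bar> \<le> \<epsilon>"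
      "\<And>z. z \<in> cbox p q \<Longrightarrow> \<bar>ridge (logi' \<rho>) (ridge_dx ys) z - ridge exp (ridge_dx ys) z\<bar> \<le> \<epsilon>"
      "\<And>z. z \<in> cbox p q \<Longrightarrow> \<bar>ridge (logi' \<rho>) (ridge_dt ys) z - ridge exp (ridge_dt ys) z\<bar> \<le> \<epsilon>"
      "\<And>z. z \<in> cbox p q \<Longrightarrow> \<bar>ridge (logi'' \<rho>) (ridge_dx (ridge_dx ys)) z - ridge exp (ridge_dx (ridge_dx ys)) z\<bar> \<le> \<epsilon>"
    using ridge_logi_close[OF \<epsilon>(1), where p=p and q=q and xs=ys] by metis
  have pos: "1 + \<rho> * exp s \<noteq> 0" for s
    using \<rho> by (metis add_pos_pos exp_gt_zero less_irrefl mult_pos_pos zero_less_one)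
  have c': "continuous_on UNIV (logi' \<rho>)"
    unfolding logi'_def[abs_def] by (intro continuous_intros) (use pos in auto)
  have c'': "continuous_on UNIV (logi'' \<rho>)"
    unfolding logi''_def[abs_def] by (intro continuous_intros) (use pos in auto)
  have Vm: "ridge (logi' \<rho>) xs \<in> borel_measurable borel" "ridge (logi'' \<rho>) xs \<in> borel_measurable borel" for xs
    by (intro borel_measurable_continuous_onI ridge_continuous_on c' c'')+
  have bc: "z \<in> cbox p q" if "z \<in> box p q" for z using that box_subset_cbox by blast
  have add: "integrable lborel (\<lambda>z. indicator (box p q) z * (V' z - w z)\<^sup>2) \<and>
      (LINT z|lborel. indicator (box p q) z * (V' z - w z)\<^sup>2) \<le> e"
    if "integrable lborel (\<lambda>z. indicator (box p q) z * (A' z - w z)\<^sup>2)"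
      "(LINT z|lborel. indicator (box p q) z * (A' z - w z)\<^sup>2) \<le> e / 4"
      "\<And>z. z \<in> cbox p q \<Longrightarrow> \<bar>V' z - A' z\<bar> \<le> \<epsilon>" "V' \<in> borel_measurable borel" "w \<in> borel_measurable borel" for A' V' w
  proof -
    have E: "\<bar>V' z - A' z\<bar> \<le> \<epsilon>" if "z \<in> box p q" for z using \<open>\<And>z. z \<in> cbox p q \<Longrightarrow> \<bar>V' z - A' z\<bar> \<le> \<epsilon>\<close>[OF bc[OF that]] .
    have V': "V' z = A' z + (V' z - A' z)" for z by simp
    show ?thesis using square_error_add[OF that(1,2) V' E \<epsilon>A that(4,5)] by blast
  qed
  note res = add[OF V(2,3) close(3) Vm(1) ut(1)] add[OF V(4,5) close(2) Vm(1) ux(1)] add[OF V(6,7) close(4) Vm(2) uxx(1)]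
  show thesis
  proof (rule that[OF \<rho>])
    show "\<bar>ridge (logi \<rho>) ys z - u z\<bar> \<le> e" if "z \<in> cbox p q" for z
      using V(1)[OF that] close(1)[OF that] \<epsilon>(2) e4 by linarith
  qed (use res in blast)+
qed

end

section \<open>Solutions of Burgers' equation\<close>

lemma weak_deriv_restrict:
  assumes w: "weak_deriv U i j g v" and UV: "V \<subseteq> U"
  shows "weak_deriv V i j g v"
  unfolding weak_deriv_def
proof (intro conjI allI impI)
  show "locally_integrable V g" "locally_integrable V v"
    using w UV by (auto simp: weak_deriv_def locally_integrable_def)
  fix \<phi> assume \<phi>: "test_function V \<phi>"
  define S where "S = - closure {z. \<phi> z \<noteq> 0}"
  have S: "open S" "- V \<subseteq> S" using \<phi> by (auto simp: S_def test_function_def)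
  have S0: "z \<in> S \<Longrightarrow> \<phi> z = 0" for z
    using closure_subset[of "{z. \<phi> z \<noteq> 0}"] by (auto simp: S_def)
  have dt0: "z \<in> S \<Longrightarrow> (d_t ^^ j) \<phi> z = 0" for z
    by (induction j arbitrary: z) (auto simp: S0 intro: partial_deriv_eq_0_if_const_on_open[OF S(1)])
  have dx0: "z \<in> S \<Longrightarrow> (d_x ^^ i) ((d_t ^^ j) \<phi>) z = 0" for z
    by (induction i arbitrary: z) (auto simp: dt0 intro: partial_deriv_eq_0_if_const_on_open[OF S(1)])
  have eq: "(LINT z:U|lebesgue. h z * \<psi> z) = (LINT z:V|lebesgue. h z * \<psi> z)"
    if "\<And>z. z \<in> S \<Longrightarrow> \<psi> z = 0" for h \<psi> :: "real \<times> real \<Rightarrow> real"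
    unfolding set_lebesgue_integral_def
    by (rule Bochner_Integration.integral_cong) (use that S(2) UV in \<open>auto simp: indicator_def subset_iff\<close>)
  have "test_function U \<phi>" using \<phi> UV by (auto simp: test_function_def)
  with w have "(LINT z:U|lebesgue. g z * (d_x ^^ i) ((d_t ^^ j) \<phi>) z) = (- 1) ^ (i + j) * (LINT z:U|lebesgue. v z * \<phi> z)"
    unfolding weak_deriv_def by blast
  then show "(LINT z:V|lebesgue. g z * (d_x ^^ i) ((d_t ^^ j) \<phi>) z) = (- 1) ^ (i + j) * (LINT z:V|lebesgue. v z * \<phi> z)"
    by (simp only: eq[OF dx0] eq[OF S0])
qed

lemma L2_representative:
  fixes w :: "'a::euclidean_space \<Rightarrow> real"
  assumes "in_L2 (box p q) w"
  obtains w0 where "w0 \<in> borel_measurable borel" "integrable lborel (\<lambda>z. (w0 z)\<^sup>2)"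
    "\<And>z. z \<notin> box p q \<Longrightarrow> w0 z = 0" "AE z in lborel. z \<in> box p q \<longrightarrow> w0 z = w z"
proof -
  have m: "set_borel_measurable lebesgue (box p q) w"
    and i: "integrable lebesgue (\<lambda>z. indicator (box p q) z *\<^sub>R (w z)\<^sup>2)"
    using assms by (auto simp: in_L2_def set_integrable_def)
  obtain w0 where [measurable]: "w0 \<in> borel_measurable borel" and out: "\<And>z. z \<notin> box p q \<Longrightarrow> w0 z = 0"
    and ae: "AE z in lborel. z \<in> box p q \<longrightarrow> w0 z = w z"
    using borel_representative[OF _ m] by auto
  have "integrable lebesgue (\<lambda>z. (w0 z)\<^sup>2)"
  proof (rule integrable_cong_AE_imp[OF i])
    show "(\<lambda>z. (w0 z)\<^sup>2) \<in> borel_measurable lebesgue" by (intro measurable_completion) simp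
    show "AE z in lebesgue. indicator (box p q) z *\<^sub>R (w z)\<^sup>2 = (w0 z)\<^sup>2"
      using AE_completion[OF ae] by eventually_elim (auto simp: out indicator_def)
  qed
  then have "integrable lborel (\<lambda>z. (w0 z)\<^sup>2)" by (simp add: integrable_completion)
  then show thesis by (intro that[of w0]) (simp_all add: out ae)
qed

lemma in_L2_L2_norm_le_if_continuous:
  fixes h :: "real \<Rightarrow> real"
  assumes "continuous_on {c..d} h" "c \<le> d" "\<And>x. x \<in> {c..d} \<Longrightarrow> \<bar>h x\<bar> \<le> s" "0 \<le> s"
  shows "in_L2 {c..d} h \<and> L2_norm {c..d} h \<le> s * sqrt (d - c)"
proof -
  have m: "set_borel_measurable lebesgue {c..d} h"
    unfolding set_borel_measurable_def
    by (intro measurable_completion) (use borel_measurable_continuous_on_indicator[OF _ assms(1)] in simp)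
  have i: "set_integrable lborel {c..d} (\<lambda>x. (h x)\<^sup>2)"
    using borel_integrable_compact[of "{c..d}" "\<lambda>x. (h x)\<^sup>2"] assms(1)
    by (simp add: set_integrable_def continuous_on_power)
  have mb: "(\<lambda>x. indicator {c..d} x *\<^sub>R (h x)\<^sup>2) \<in> borel_measurable lborel"
    using i by (simp add: set_integrable_def)
  have i': "set_integrable lebesgue {c..d} (\<lambda>x. (h x)\<^sup>2)"
    using i mb unfolding set_integrable_def by (simp only: integrable_completion)
  have "(LINT x:{c..d}|lebesgue. (h x)\<^sup>2) = (LINT x:{c..d}|lborel. (h x)\<^sup>2)"
    unfolding set_lebesgue_integral_def using mb by (rule integral_completion)
  also have "\<dots> \<le> (LINT x:{c..d}|lborel. s\<^sup>2)"
  proof (rule set_integral_mono[OF i])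
    show "set_integrable lborel {c..d} (\<lambda>x. s\<^sup>2)" 
      using borel_integrable_compact[of "{c..d}" "\<lambda>x. s\<^sup>2"] by (simp add: set_integrable_def)
    show "(h x)\<^sup>2 \<le> s\<^sup>2" if "x \<in> {c..d}" for x
      using assms(3)[OF that] assms(4) by (intro abs_le_square_iff[THEN iffD1]) simp
  qed
  also have "\<dots> = s\<^sup>2 * (d - c)" using assms(2) by (simp add: set_lebesgue_integral_def)
  finally have "L2_norm {c..d} h \<le> sqrt (s\<^sup>2 * (d - c))" by (simp add: L2_norm_def)
  also have "\<dots> = s * sqrt (d - c)" using assms(4) by (simp add: real_sqrt_mult)
  finally show ?thesis using m i' by (simp add: in_L2_def)
qed

text \<open>On the open rectangle the right-hand side \<open>f\<close> is replaced by the weak derivatives of \<open>u\<close>, so that the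
  residual of a network \<open>v\<close> is
  \<open>(v\<^sub>t - u\<^sub>t) - \<nu> (v\<^sub>x\<^sub>x - u\<^sub>x\<^sub>x) + v (v\<^sub>x - u\<^sub>x) + (v - u) u\<^sub>x\<close> almost everywhere.\<close>

lemma burgers_residual_approximation:
  assumes ab: "a < b" and \<tau>: "0 < \<tau>" "\<tau> \<le> T" and L: "3 \<le> L" "hlconc_activations L \<sigma>"
    and burg: "burgers_solution a b T \<nu> f u_in g1 g2 u"
    and sob: "sobolev_H k ({a..b} \<times> {0..\<tau>}) u" and k: "2 \<le> k"
    and cont: "continuous_on ({a..b} \<times> {0..\<tau>}) u" and "0 < e"
  obtains v where "is_hlconc_pinn L \<sigma> v" "continuous_on UNIV v"
    "\<And>z. z \<in> {a..b} \<times> {0..\<tau>} \<Longrightarrow> \<bar>v z - u z\<bar> \<le> e"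
    "in_L2 ({a..b} \<times> {0..\<tau>}) (R_int \<nu> f v)" "L2_norm ({a..b} \<times> {0..\<tau>}) (R_int \<nu> f v) \<le> e"
proof -
  define p q where "p = (a, 0::real)" and "q = (b, \<tau>)"
  have cb: "{a..b} \<times> {0..\<tau>} = cbox p q" by (simp add: cbox_prod_eq p_def q_def)
  have bx: "{a<..<b} \<times> {0<..<\<tau>} = box p q" by (auto simp: mem_box_prod p_def q_def)
  have sub: "box p q \<subseteq> {a<..<b} \<times> {0<..<T}" using \<tau> by (auto simp: bx[symmetric])
  have uc: "continuous_on (cbox p q) u" using cont by (simp add: cb)
  have L2u: "in_L2 (box p q) u"
    and wk: "\<And>i j. i + j \<le> k \<Longrightarrow> \<exists>v. weak_deriv (box p q) i j u v \<and> in_L2 (box p q) v"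
    using sob unfolding sobolev_H_def cb interior_cbox by auto
  obtain vt where vt: "weak_deriv (box p q) 0 1 u vt" "in_L2 (box p q) vt" using wk[of 0 1] k by auto
  obtain vx where vx: "weak_deriv (box p q) 1 0 u vx" "in_L2 (box p q) vx" using wk[of 1 0] k by auto
  obtain vxx where vxx: "weak_deriv (box p q) 2 0 u vxx" "in_L2 (box p q) vxx" using wk[of 2 0] k by auto
  obtain ut ux uxx where b: "weak_deriv ({a<..<b} \<times> {0<..<T}) 0 1 u ut" "weak_deriv ({a<..<b} \<times> {0<..<T}) 1 0 u ux"
    "weak_deriv ({a<..<b} \<times> {0<..<T}) 2 0 u uxx"
    and eqn: "AE z in lebesgue. z \<in> {a<..<b} \<times> {0<..<T} \<longrightarrow> ut z - \<nu> * uxx z + u z * ux z = f z"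
    using burg unfolding burgers_solution_def Let_def by blast
  obtain wt where wt: "wt \<in> borel_measurable borel" "integrable lborel (\<lambda>z. (wt z)\<^sup>2)" "\<And>z. z \<notin> box p q \<Longrightarrow> wt z = 0"
    and wt_ae: "AE z in lborel. z \<in> box p q \<longrightarrow> wt z = vt z" by (rule L2_representative[OF vt(2)]) blast
  obtain wx where wx: "wx \<in> borel_measurable borel" "integrable lborel (\<lambda>z. (wx z)\<^sup>2)" "\<And>z. z \<notin> box p q \<Longrightarrow> wx z = 0"
    and wx_ae: "AE z in lborel. z \<in> box p q \<longrightarrow> wx z = vx z" by (rule L2_representative[OF vx(2)]) blast
  obtain wxx where wxx: "wxx \<in> borel_measurable borel" "integrable lborel (\<lambda>z. (wxx z)\<^sup>2)" "\<And>z. z \<notin> box p q \<Longrightarrow> wxx z = 0"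
    and wxx_ae: "AE z in lborel. z \<in> box p q \<longrightarrow> wxx z = vxx z" by (rule L2_representative[OF vxx(2)]) blast
  have [measurable]: "wt \<in> borel_measurable borel" "wx \<in> borel_measurable borel" "wxx \<in> borel_measurable borel"
    using wt wx wxx by auto
  define u0 where "u0 y = indicator (box p q) y * u y" for y
  have "(\<lambda>y. indicator (box p q) y *\<^sub>R u y) \<in> borel_measurable borel"
    by (intro borel_measurable_continuous_on_indicator continuous_on_subset[OF uc box_subset_cbox]) auto
  then have u0m [measurable]: "u0 \<in> borel_measurable borel" by (simp add: u0_def[abs_def])
  \<comment> \<open>The weak derivatives in the equation agree almost everywhere with the square-integrable ones.\<close>
  have f_eq: "AE z in lborel. z \<in> box p q \<longrightarrow> f z = wt z - \<nu> * wxx z + u0 z * wx z"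
    using weak_deriv_unique[OF weak_deriv_restrict[OF b(1) sub] vt(1)]
      weak_deriv_unique[OF weak_deriv_restrict[OF b(2) sub] vx(1)]
      weak_deriv_unique[OF weak_deriv_restrict[OF b(3) sub] vxx(1)]
      eqn[unfolded AE_completion_iff] wt_ae wx_ae wxx_ae
    by eventually_elim (use sub in \<open>auto simp: u0_def\<close>)
  have weak: "(LINT z|lborel. u0 z * (d_x ^^ i) ((d_t ^^ j) \<phi>) z) = (- 1) ^ (i + j) * (LINT z|lborel. w z * \<phi> z)"
    if v: "weak_deriv (box p q) i j u v" "in_L2 (box p q) v"
      and w: "w \<in> borel_measurable borel" "\<forall>z. z \<notin> box p q \<longrightarrow> w z = 0" "AE z in lborel. z \<in> box p q \<longrightarrow> w z = v z"
      and \<phi>: "test_function (box p q) \<phi>" for i j v w \<phi>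
  proof -
    have s: "smooth \<phi>" using \<phi> by (simp add: test_function_def)
    have st: "smooth ((d_t ^^ j) \<phi>)"
      by (induction j) (auto simp: s intro!: smooth_partial_deriv simp: Basis_prod_def)
    have sx: "smooth ((d_x ^^ i) ((d_t ^^ j) \<phi>))"
      by (induction i) (auto simp: st intro!: smooth_partial_deriv simp: Basis_prod_def)
    have "(LINT z:box p q|lebesgue. u z * (d_x ^^ i) ((d_t ^^ j) \<phi>) z) = (LINT z|lborel. u0 z * (d_x ^^ i) ((d_t ^^ j) \<phi>) z)"
    proof (rule set_integral_eq_representative)
      show "set_borel_measurable lebesgue (box p q) u" using L2u by (simp add: in_L2_def)
      show "(d_x ^^ i) ((d_t ^^ j) \<phi>) \<in> borel_measurable borel"
        by (intro borel_measurable_continuous_onI smooth_continuous_on sx)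
      show "u0 \<in> borel_measurable borel" by (rule u0m)
    qed (auto simp: u0_def)
    moreover have "(LINT z:box p q|lebesgue. v z * \<phi> z) = (LINT z|lborel. w z * \<phi> z)"
    proof (rule set_integral_eq_representative)
      show "set_borel_measurable lebesgue (box p q) v" using v by (simp add: in_L2_def)
      show "\<phi> \<in> borel_measurable borel"
        by (intro borel_measurable_continuous_onI smooth_continuous_on s)
    qed (use w in auto)
    moreover have "(LINT z:box p q|lebesgue. u z * (d_x ^^ i) ((d_t ^^ j) \<phi>) z)
        = (- 1) ^ (i + j) * (LINT z:box p q|lebesgue. v z * \<phi> z)"
      using v(1) \<phi> unfolding weak_deriv_def by blast
    ultimately show ?thesis by simp
  qed
  have weak_t: "(LINT y|lborel. (indicator (box p q) y * u y) * d_t \<phi> y) = - (LINT y|lborel. wt y * \<phi> y)"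
    if "test_function (box p q) \<phi>" for \<phi>
    using weak[OF vt wt(1) _ wt_ae that] wt(3) by (simp add: u0_def)
  have weak_x: "(LINT y|lborel. (indicator (box p q) y * u y) * d_x \<phi> y) = - (LINT y|lborel. wx y * \<phi> y)"
    if "test_function (box p q) \<phi>" for \<phi>
    using weak[OF vx wx(1) _ wx_ae that] wx(3) by (simp add: u0_def)
  have weak_xx: "(LINT y|lborel. (indicator (box p q) y * u y) * d_x (d_x \<phi>) y) = (LINT y|lborel. wxx y * \<phi> y)"
    if "test_function (box p q) \<phi>" for \<phi>
    using weak[OF vxx wxx(1) _ wxx_ae that] wxx(3) by (simp add: u0_def numeral_2_eq_2)
  obtain K where "approx_kernel p q K"
  proof -
    have D: "cbox (- (b - a), - \<tau>) (b - a, \<tau>) = cbox (p - q) (q - p)" by (simp add: p_def q_def)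
    have "0 < b - a" using ab by simp
    from landau_kernel_exists[OF this \<tau>(1), unfolded D] obtain K where
      "\<And>n s. s \<in> cbox (p - q) (q - p) \<Longrightarrow> 0 \<le> ridge exp (K n) s"
      "\<And>n. (LINT s|lborel. indicator (cbox (p - q) (q - p)) s * ridge exp (K n) s) = 1"
      "\<And>\<delta> e. 0 < \<delta> \<Longrightarrow> 0 < e \<Longrightarrow>
         \<forall>\<^sub>F n in sequentially. \<forall>s\<in>cbox (p - q) (q - p). \<delta> \<le> norm s \<longrightarrow> ridge exp (K n) s \<le> e"
      by blast
    then show thesis using ab \<tau> by (intro that[of K] approx_kernel.intro) (auto simp: p_def q_def)
  qed
  then interpret approx_kernel p q K .
  obtain M where M: "0 < M" "\<And>z. z \<in> cbox p q \<Longrightarrow> \<bar>u z\<bar> \<le> M"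
    using compact_imp_bounded[OF compact_continuous_image[OF uc compact_cbox]]
    by (auto simp: bounded_pos)
  define J where "J = (LINT z|lborel. (wx z)\<^sup>2)"
  have J: "0 \<le> J" unfolding J_def by (rule integral_nonneg_AE) simp
  \<comment> \<open>The squared residual norm will be at most \<open>B * d\<close>, where \<open>d\<close> bounds all approximation errors.\<close>
  define B where "B = 4 * (1 + \<nu>\<^sup>2 + (M + 1)\<^sup>2 + J)"
  have B: "0 < B" unfolding B_def using J by (simp add: add_pos_nonneg)
  define d where "d = min 1 (min e (e\<^sup>2 / B))"
  have d: "0 < d" "d \<le> 1" "d \<le> e" using B \<open>0 < e\<close> by (auto simp: d_def)
  have dB: "B * d \<le> e\<^sup>2"
  proof -
    have "d \<le> e\<^sup>2 / B" by (simp add: d_def)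
    then show ?thesis using B by (simp add: pos_le_divide_eq mult.commute)
  qed
  obtain \<rho> ys where \<rho>: "0 < \<rho>" and near: "\<And>z. z \<in> cbox p q \<Longrightarrow> \<bar>ridge (logi \<rho>) ys z - u z\<bar> \<le> d"
    and it: "integrable lborel (\<lambda>z. indicator (box p q) z * (ridge (logi' \<rho>) (ridge_dt ys) z - wt z)\<^sup>2)"
    "(LINT z|lborel. indicator (box p q) z * (ridge (logi' \<rho>) (ridge_dt ys) z - wt z)\<^sup>2) \<le> d"
    and ix: "integrable lborel (\<lambda>z. indicator (box p q) z * (ridge (logi' \<rho>) (ridge_dx ys) z - wx z)\<^sup>2)"
    "(LINT z|lborel. indicator (box p q) z * (ridge (logi' \<rho>) (ridge_dx ys) z - wx z)\<^sup>2) \<le> d"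
    and ixx: "integrable lborel (\<lambda>z. indicator (box p q) z * (ridge (logi'' \<rho>) (ridge_dx (ridge_dx ys)) z - wxx z)\<^sup>2)"
    "(LINT z|lborel. indicator (box p q) z * (ridge (logi'' \<rho>) (ridge_dx (ridge_dx ys)) z - wxx z)\<^sup>2) \<le> d"
    by (rule network_approximation[OF uc wt wx wxx weak_t weak_x weak_xx d(1)]) (assumption | blast)+
  define v where "v = ridge (logi \<rho>) ys"
  define Vt where "Vt = ridge (logi' \<rho>) (ridge_dt ys)"
  define Vx where "Vx = ridge (logi' \<rho>) (ridge_dx ys)"
  define Vxx where "Vxx = ridge (logi'' \<rho>) (ridge_dx (ridge_dx ys))"
  have deriv: "d_t v = Vt" "d_x v = Vx" "d_x Vx = Vxx"
    unfolding v_def Vt_def Vx_def Vxx_def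
    by (simp_all add: ridge_partial_deriv[OF logi_deriv(1)[OF \<rho>]] ridge_partial_deriv[OF logi_deriv(2)[OF \<rho>]])
  have pos: "1 + \<rho> * exp s \<noteq> 0" for s
    using \<rho> by (metis add_pos_pos exp_gt_zero less_irrefl mult_pos_pos zero_less_one)
  have vc: "continuous_on UNIV v" "continuous_on UNIV Vt" "continuous_on UNIV Vx" "continuous_on UNIV Vxx"
    unfolding v_def Vt_def Vx_def Vxx_def
    by (intro ridge_continuous_on; unfold logi_def logi'_def logi''_def; intro continuous_intros; use pos in simp)+
  note [measurable] = vc[THEN borel_measurable_continuous_onI]
  define F where "F z = indicator (box p q) z *
    ((Vt z - wt z) - \<nu> * (Vxx z - wxx z) + v z * (Vx z - wx z) + (v z - u0 z) * wx z)" for z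
  have [measurable]: "F \<in> borel_measurable borel" unfolding F_def by measurable
  define G where "G z = 4 * (indicator (box p q) z * (Vt z - wt z)\<^sup>2 + \<nu>\<^sup>2 * (indicator (box p q) z * (Vxx z - wxx z)\<^sup>2)
    + (M + 1)\<^sup>2 * (indicator (box p q) z * (Vx z - wx z)\<^sup>2) + d\<^sup>2 * (wx z)\<^sup>2)" for z
  have ints: "integrable lborel (\<lambda>z. indicator (box p q) z * (Vt z - wt z)\<^sup>2)"
    "integrable lborel (\<lambda>z. indicator (box p q) z * (Vxx z - wxx z)\<^sup>2)"
    "integrable lborel (\<lambda>z. indicator (box p q) z * (Vx z - wx z)\<^sup>2)"
    using it ix ixx by (simp_all add: Vt_def Vx_def Vxx_def)
  have Gint: "integrable lborel G" unfolding G_def using ints wx(2) by simp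
  have FG: "(F z)\<^sup>2 \<le> G z" for z
  proof (cases "z \<in> box p q")
    case True
    then have z: "z \<in> cbox p q" using box_subset_cbox by blast
    have "(F z)\<^sup>2 = ((Vt z - wt z) + - \<nu> * (Vxx z - wxx z) + v z * (Vx z - wx z) + (v z - u0 z) * wx z)\<^sup>2"
      using True by (simp add: F_def)
    also have "\<dots> \<le> 4 * ((Vt z - wt z)\<^sup>2 + (- \<nu> * (Vxx z - wxx z))\<^sup>2 + (v z * (Vx z - wx z))\<^sup>2 + ((v z - u0 z) * wx z)\<^sup>2)"
      by (rule four_term_square_bound)
    also have "\<dots> = 4 * ((Vt z - wt z)\<^sup>2 + \<nu>\<^sup>2 * (Vxx z - wxx z)\<^sup>2 + (v z)\<^sup>2 * (Vx z - wx z)\<^sup>2 + (v z - u0 z)\<^sup>2 * (wx z)\<^sup>2)"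
      by (simp add: power_mult_distrib)
    also have "\<dots> \<le> 4 * ((Vt z - wt z)\<^sup>2 + \<nu>\<^sup>2 * (Vxx z - wxx z)\<^sup>2 + (M + 1)\<^sup>2 * (Vx z - wx z)\<^sup>2 + d\<^sup>2 * (wx z)\<^sup>2)"
    proof -
      have n: "\<bar>v z - u z\<bar> \<le> d" using near[OF z] by (simp add: v_def)
      have "\<bar>v z\<bar> \<le> \<bar>M + 1\<bar>" using n M(1) M(2)[OF z] d(2) by linarith
      then have "(v z)\<^sup>2 \<le> (M + 1)\<^sup>2" by (simp add: abs_le_square_iff)
      moreover have "(v z - u0 z)\<^sup>2 \<le> d\<^sup>2"
        using n True by (intro abs_le_square_iff[THEN iffD1]) (simp add: u0_def)
      ultimately show ?thesis by (intro mult_left_mono add_mono mult_right_mono order_refl) auto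
    qed
    also have "\<dots> = G z" using True by (simp add: G_def)
    finally show ?thesis .
  qed (simp add: F_def G_def)
  have F2: "integrable lborel (\<lambda>z. (F z)\<^sup>2)"
    by (rule integrable_abs_bound[OF Gint]) (simp_all add: FG)
  have "(LINT z|lborel. (F z)\<^sup>2) \<le> (LINT z|lborel. G z)" by (rule integral_mono[OF F2 Gint FG])
  also have "\<dots> = 4 * ((LINT z|lborel. indicator (box p q) z * (Vt z - wt z)\<^sup>2)
      + \<nu>\<^sup>2 * (LINT z|lborel. indicator (box p q) z * (Vxx z - wxx z)\<^sup>2)
      + (M + 1)\<^sup>2 * (LINT z|lborel. indicator (box p q) z * (Vx z - wx z)\<^sup>2) + d\<^sup>2 * J)"
    unfolding G_def J_def using ints wx(2) by simp
  also have "\<dots> \<le> 4 * (d + \<nu>\<^sup>2 * d + (M + 1)\<^sup>2 * d + d * J)"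
  proof -
    have "d\<^sup>2 \<le> d" using d by (simp add: power2_eq_square mult_left_le)
    then show ?thesis
      using it(2) ix(2) ixx(2) J unfolding Vt_def Vx_def Vxx_def
      by (intro mult_left_mono add_mono mult_right_mono) auto
  qed
  also have "\<dots> = B * d" by (simp add: B_def algebra_simps)
  also have "\<dots> \<le> e\<^sup>2" by (rule dB)
  finally have F2e: "(LINT z|lborel. (F z)\<^sup>2) \<le> e\<^sup>2" .
  have "AE z in lebesgue. z \<notin> cbox p q - box p q"
    using negligible_frontier_interval[of p q] unfolding negligible_iff_null_sets by (rule AE_not_in)
  then have "AE z in lborel. z \<notin> cbox p q - box p q" unfolding AE_completion_iff .
  with f_eq have "AE z in lborel. F z = indicator (cbox p q) z * R_int \<nu> f v z"
  proof eventually_elim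
    case (elim z)
    show ?case
    proof (cases "z \<in> box p q")
      case True
      then have "z \<in> cbox p q" using box_subset_cbox by blast
      then show ?thesis using True elim by (simp add: F_def R_int_def deriv algebra_simps)
    qed (use elim in \<open>auto simp: F_def indicator_def\<close>)
  qed
  then have ae: "AE z in lebesgue. F z = indicator (cbox p q) z * R_int \<nu> f v z" by (rule AE_completion)
  have Fl: "F \<in> borel_measurable lebesgue" by (intro measurable_completion) simp
  have Rm: "(\<lambda>z. indicator (cbox p q) z * R_int \<nu> f v z) \<in> borel_measurable lebesgue"
    by (rule borel_measurable_AE[OF Fl ae])
  have sq: "indicator (cbox p q) z *\<^sub>R (R_int \<nu> f v z)\<^sup>2 = (indicator (cbox p q) z * R_int \<nu> f v z)\<^sup>2" for z
    by (simp add: indicator_def)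
  have F2l: "integrable lebesgue (\<lambda>z. (F z)\<^sup>2)" using F2 by (simp add: integrable_completion)
  have R2: "integrable lebesgue (\<lambda>z. indicator (cbox p q) z *\<^sub>R (R_int \<nu> f v z)\<^sup>2)"
    unfolding sq by (rule integrable_cong_AE_imp[OF F2l]) (use Rm ae in \<open>auto elim: eventually_mono\<close>)
  have "(LINT z|lebesgue. indicator (cbox p q) z *\<^sub>R (R_int \<nu> f v z)\<^sup>2) = (LINT z|lebesgue. (F z)\<^sup>2)"
    unfolding sq by (rule integral_cong_AE) (use Rm Fl ae in \<open>auto elim: eventually_mono\<close>)
  also have "\<dots> = (LINT z|lborel. (F z)\<^sup>2)" by (rule integral_completion) simp
  finally have norm: "(LINT z|lebesgue. indicator (cbox p q) z *\<^sub>R (R_int \<nu> f v z)\<^sup>2) \<le> e\<^sup>2" using F2e by simp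
  show thesis
  proof (rule that[of v])
    show "is_hlconc_pinn L \<sigma> v" unfolding v_def by (rule is_hlconc_pinn_ridge_logi[OF L \<rho>])
    show "continuous_on UNIV v" by (rule vc)
    show "\<bar>v z - u z\<bar> \<le> e" if "z \<in> {a..b} \<times> {0..\<tau>}" for z
      using near[of z] that d(3) by (simp add: cb v_def)
    show "in_L2 ({a..b} \<times> {0..\<tau>}) (R_int \<nu> f v)"
      using Rm R2 by (simp add: cb in_L2_def set_borel_measurable_def set_integrable_def)
    show "L2_norm ({a..b} \<times> {0..\<tau>}) (R_int \<nu> f v) \<le> e"
      unfolding L2_norm_def set_lebesgue_integral_def cb
      by (rule real_le_lsqrt[OF less_imp_le[OF \<open>0 < e\<close>] norm])
  qed
qed

theorem theorem4p1:
  fixes a b T \<nu> :: real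
    and f u :: "real \<times> real \<Rightarrow> real"
    and u_in g1 g2 :: "real \<Rightarrow> real"
    and n k l i L :: nat
    and \<sigma> :: "nat \<Rightarrow> real \<Rightarrow> real"
  assumes "a < b" and "0 < T" and "0 < \<nu>"
    and "2 \<le> n" and "3 \<le> k"
    and "1 \<le> l" and "1 \<le> i" and "i \<le> l"
    and "3 \<le> L" and "hlconc_activations L \<sigma>"
    and "burgers_solution a b T \<nu> f u_in g1 g2 u"
    and "sobolev_H k ({a..b} \<times> {0..block_time T l i}) u"
    and "continuous_on ({a..b} \<times> {0..block_time T l i}) u"
  shows "\<exists>C\<ge>0. \<forall>N::nat. 5 < N \<longrightarrow>
    (\<exists>u\<theta> :: nat \<Rightarrow> real \<times> real \<Rightarrow> real.
      (\<forall>j\<in>{1..i}. is_hlconc_pinn L \<sigma> (u\<theta> j)) \<and>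
      in_L2 ({a..b} \<times> {0..block_time T l i}) (R_int \<nu> f (u\<theta> i)) \<and>
      L2_norm ({a..b} \<times> {0..block_time T l i}) (R_int \<nu> f (u\<theta> i))
        \<le> C * (real N powr (- real k + 2) * (ln (real N))\<^sup>2) \<and>
      (\<forall>j\<in>{1..i}.
        in_L2 {a..b} (R_tb T l u_in u\<theta> i j) \<and>
        L2_norm {a..b} (R_tb T l u_in u\<theta> i j)
          \<le> C * (real N powr (- real k + 1) * ln (real N))) \<and>
      in_L2 {0..block_time T l i} (R_sb a g1 (u\<theta> i)) \<and>
      L2_norm {0..block_time T l i} (R_sb a g1 (u\<theta> i))
        \<le> C * (real N powr (- real k + 1) * ln (real N)) \<and>
      in_L2 {0..block_time T l i} (R_sb b g2 (u\<theta> i)) \<and>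
      L2_norm {0..block_time T l i} (R_sb b g2 (u\<theta> i))
        \<le> C * (real N powr (- real k + 1) * ln (real N)))"
proof (rule exI[of _ 1], intro conjI allI impI)
  fix N :: nat assume N: "5 < N"
  define \<tau> where "\<tau> = block_time T l i"
  have \<tau>: "0 < \<tau>" "\<tau> \<le> T"
  proof -
    have "\<tau> = T * (real i / real l)" by (simp add: \<tau>_def block_time_def)
    moreover have "0 < real i / real l" "real i / real l \<le> 1" using assms by auto
    ultimately show "0 < \<tau>" "\<tau> \<le> T"
      using \<open>0 < T\<close> mult_pos_pos[of T "real i / real l"] mult_left_le[of "real i / real l" T] by simp_all
  qed
  define \<beta>1 where "\<beta>1 = real N powr (- real k + 2) * (ln (real N))\<^sup>2"
  define \<beta>2 where "\<beta>2 = real N powr (- real k + 1) * ln (real N)"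
  have \<beta>: "0 < \<beta>1" "0 < \<beta>2" using N by (auto simp: \<beta>1_def \<beta>2_def)
  define S where "S = sqrt (b - a) + sqrt \<tau>"
  have S: "0 < S" "sqrt (b - a) \<le> S" "sqrt \<tau> \<le> S" using \<open>a < b\<close> \<tau> by (auto simp: S_def add_pos_pos)
  define e where "e = min \<beta>1 (\<beta>2 / S)"
  have e: "0 < e" "e \<le> \<beta>1" using \<beta> S by (auto simp: e_def)
  have eS: "e * s \<le> \<beta>2" if "s \<le> S" for s
  proof -
    have "e * s \<le> e * S" using that e by simp
    also have "\<dots> \<le> \<beta>2 / S * S" using S by (intro mult_right_mono) (auto simp: e_def)
    finally show ?thesis using S by simp
  qed
  have k2: "2 \<le> k" using \<open>3 \<le> k\<close> by simp
  obtain v where v: "is_hlconc_pinn L \<sigma> v" "continuous_on UNIV v"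
    "\<And>z. z \<in> {a..b} \<times> {0..\<tau>} \<Longrightarrow> \<bar>v z - u z\<bar> \<le> e"
    "in_L2 ({a..b} \<times> {0..\<tau>}) (R_int \<nu> f v)" "L2_norm ({a..b} \<times> {0..\<tau>}) (R_int \<nu> f v) \<le> e"
    by (rule burgers_residual_approximation[OF assms(1) \<tau> assms(9-11) assms(12)[folded \<tau>_def] k2
          assms(13)[folded \<tau>_def] e(1)]) blast
  have data: "x \<in> {a..b} \<Longrightarrow> u_in x = u (x, 0)" "t \<in> {0..T} \<Longrightarrow> g1 t = u (a, t)" "t \<in> {0..T} \<Longrightarrow> g2 t = u (b, t)" for x t
    using assms(11) unfolding burgers_solution_def by auto
  have err: "continuous_on ({a..b} \<times> {0..\<tau>}) (\<lambda>z. v z - u z)"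
    using assms(13)[folded \<tau>_def] v(2) by (intro continuous_intros) (auto intro: continuous_on_subset)
  have init: "in_L2 {a..b} (R_tb T l u_in (\<lambda>_. v) i j) \<and> L2_norm {a..b} (R_tb T l u_in (\<lambda>_. v) i j) \<le> \<beta>2"
    if "j \<in> {1..i}" for j
  proof -
    have eq: "R_tb T l u_in (\<lambda>_. v) i j x = (if j = 1 then v (x, 0) - u (x, 0) else 0)" if "x \<in> {a..b}" for x
      using data(1)[OF that] by (simp add: R_tb_def block_time_def)
    have "continuous_on {a..b} (\<lambda>x. v (x, 0) - u (x, 0))"
      by (rule continuous_on_compose2[OF err]) (use \<tau> in \<open>auto intro!: continuous_intros\<close>)
    then have "continuous_on {a..b} (\<lambda>x. if j = 1 then v (x, 0) - u (x, 0) else 0)" by (cases "j = 1") auto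
    then have "continuous_on {a..b} (R_tb T l u_in (\<lambda>_. v) i j)"
      by (subst continuous_on_cong[OF refl eq]) auto
    moreover have "\<bar>R_tb T l u_in (\<lambda>_. v) i j x\<bar> \<le> e" if "x \<in> {a..b}" for x
      using eq[OF that] v(3)[of "(x, 0)"] that \<tau> e by auto
    ultimately show ?thesis
      using in_L2_L2_norm_le_if_continuous[of a b "R_tb T l u_in (\<lambda>_. v) i j" e] eS[OF S(2)] e \<open>a < b\<close>
      by force
  qed
  have bdry: "in_L2 {0..\<tau>} (R_sb c g v) \<and> L2_norm {0..\<tau>} (R_sb c g v) \<le> \<beta>2"
    if c: "c \<in> {a..b}" and g: "\<And>t. t \<in> {0..T} \<Longrightarrow> g t = u (c, t)" for c g
  proof -
    have eq: "R_sb c g v t = v (c, t) - u (c, t)" if "t \<in> {0..\<tau>}" for t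
      using g[of t] that \<tau> by (simp add: R_sb_def)
    have "continuous_on {0..\<tau>} (\<lambda>t. v (c, t) - u (c, t))"
      by (rule continuous_on_compose2[OF err]) (use c in \<open>auto intro!: continuous_intros\<close>)
    then have "continuous_on {0..\<tau>} (R_sb c g v)"
      by (subst continuous_on_cong[OF refl eq]) auto
    moreover have "\<bar>R_sb c g v t\<bar> \<le> e" if "t \<in> {0..\<tau>}" for t
      using eq[OF that] v(3)[of "(c, t)"] that c by auto
    ultimately show ?thesis
      using in_L2_L2_norm_le_if_continuous[of 0 \<tau> "R_sb c g v" e] eS[OF S(3)] e \<tau>
      by force
  qed
  have a: "a \<in> {a..b}" and b: "b \<in> {a..b}" using \<open>a < b\<close> by auto
  \<comment> \<open>The same network is used in every time block.\<close>
  show "\<exists>u\<theta> :: nat \<Rightarrow> real \<times> real \<Rightarrow> real.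
      (\<forall>j\<in>{1..i}. is_hlconc_pinn L \<sigma> (u\<theta> j)) \<and>
      in_L2 ({a..b} \<times> {0..block_time T l i}) (R_int \<nu> f (u\<theta> i)) \<and>
      L2_norm ({a..b} \<times> {0..block_time T l i}) (R_int \<nu> f (u\<theta> i))
        \<le> 1 * (real N powr (- real k + 2) * (ln (real N))\<^sup>2) \<and>
      (\<forall>j\<in>{1..i}.
        in_L2 {a..b} (R_tb T l u_in u\<theta> i j) \<and>
        L2_norm {a..b} (R_tb T l u_in u\<theta> i j)
          \<le> 1 * (real N powr (- real k + 1) * ln (real N))) \<and>
      in_L2 {0..block_time T l i} (R_sb a g1 (u\<theta> i)) \<and>
      L2_norm {0..block_time T l i} (R_sb a g1 (u\<theta> i))
        \<le> 1 * (real N powr (- real k + 1) * ln (real N)) \<and>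
      in_L2 {0..block_time T l i} (R_sb b g2 (u\<theta> i)) \<and>
      L2_norm {0..block_time T l i} (R_sb b g2 (u\<theta> i))
        \<le> 1 * (real N powr (- real k + 1) * ln (real N))"
    unfolding \<tau>_def[symmetric] \<beta>1_def[symmetric] \<beta>2_def[symmetric] mult_1
    by (rule exI[of _ "\<lambda>_. v"])
       (use v(1,4) order_trans[OF v(5) e(2)] init bdry[OF a data(2)] bdry[OF b data(3)] in blast)
qed simp

end
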